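(* Let $m\ge2$ be an integer and let $g:[0,2\pi]\to\mathbb{R}$ be continuous, three times continuously differentiable in some neighborhood of $\frac{2\pi}{m}$, with $g''\left(\frac{2\pi}{m}\right)\ne0$. Let $f:(S^1)^m\to\mathbb{R}$ be the side-type kernel generated by $g$ (see context), and suppose that $f$ attains its maximum only at the vertices of a regular $m$-gon. Let $U_1,U_2,\dots$ be independent points on $S^1$ with a common continuous density $p(x)$ such that $\int_0^{2\pi}\prod_{l=0}^{m-1}p\left(x+\frac{2\pi l}{m}\right)dx>0$, and for $n\ge m$ let $H_n=\max_{1\le i_1<\dots<i_m\le n}f(U_{i_1},\dots,U_{i_m})$. Then for every $t>0$ $$\lim_{n\to\infty}\mathbb{P}\left\{n^{\frac{2m}{m-1}}\left(m\,g\left(\tfrac{2\pi}{m}\right)-H_n\right)\le t\right\}=1-\exp\left(-\frac{t^{\frac{m-1}{2}}K}{m}\right),$$ where $$K=\frac{(2\pi)^{\frac{m-1}{2}}\left[\int_0^{2\pi}\prod_{l=0}^{m-1}p\left(x+\frac{2\pi l}{m}\right)dx\right]}{\left(-g''\left(\frac{2\pi}{m}\right)\right)^{\frac{m-1}{2}}\Gamma\left(\frac{m+1}{2}\right)\sqrt{m}}.$$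
   Context: $S^1$ is the unit circle with center $O$; points are identified with polar angles modulo $2\pi$, and a density $p$ on $S^1$ is regarded as a $2\pi$-periodic non-negative function on $\mathbb{R}$ with $\int_0^{2\pi}p(x)\,dx=1$. Side-type kernel generated by $g$: for $U_1,\dots,U_m\in S^1$ let $\beta_i\in[0,2\pi)$ be the counterclockwise angle from $OU_1$ to $OU_{i+1}$, $i=1,\dots,m-1$. If $0=\beta_0\le\beta_1\le\dots\le\beta_{m-1}\le\beta_m=2\pi$, put $$f(U_1,\dots,U_m)=h(\beta_1,\dots,\beta_{m-1})=\sum_{i=1}^m g(\beta_i-\beta_{i-1}),$$ and extend $h$ to all of $[0,2\pi]^{m-1}$ as a symmetric function (so $f$ is the sum of $g$ over the $m$ angles between cyclically neighboring vectors $OU_j$, for the points in counterclockwise order). "$f$ attains its maximum only at the vertices of a regular $m$-gon" means that $(U_1,\dots,U_m)$ is a maximum point of $f$ if and only if $U_1,\dots,U_m$ are, in some order, the vertices of a regular $m$-gon inscribed in $S^1$ (an antipodal pair if $m=2$). *)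

theory Defs
  imports "HOL-Probability.Probability"
begin

abbreviation unit_circle :: "complex set" where
  "unit_circle \<equiv> sphere 0 1"

(* Arc length on the circle, of total mass 2 pi. Its space is the circle itself, so that a
   random variable with values in this measure space lies on the circle everywhere. *)
definition arc_length :: "complex measure" where
  "arc_length = distr (restrict_space lborel {0..<2*pi}) (restrict_space borel unit_circle) cis"

definition circle_density :: "(real \<Rightarrow> real) \<Rightarrow> bool" where
  "circle_density p \<longleftrightarrow>
     (\<forall>x. 0 \<le> p x) \<and> (\<forall>x. p (x + 2*pi) = p x) \<and> (p has_integral 1) {0..2*pi}"

(* The k-th derivative is iterated deriv, which is meaningful only where the preceding
   derivatives exist; the first conjunct guarantees this throughout the neighbourhood. *)
definition Ck_near :: "nat \<Rightarrow> (real \<Rightarrow> real) \<Rightarrow> real \<Rightarrow> bool" where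
  "Ck_near k g a \<longleftrightarrow>
     (\<exists>\<epsilon>>0. (\<forall>j<k. \<forall>x\<in>ball a \<epsilon>. (deriv ^^ j) g field_differentiable at x) \<and>
             continuous_on (ball a \<epsilon>) ((deriv ^^ k) g))"

(* The function h(beta_1, ..., beta_(m-1)). Sorting the arguments is the symmetric extension
   from nondecreasing tuples to all tuples; entry i of the list is beta_i for i = 0, ..., m. *)
definition side_h :: "(real \<Rightarrow> real) \<Rightarrow> real list \<Rightarrow> real" where
  "side_h g \<beta>s =
     (let \<beta> = [0] @ sort \<beta>s @ [2*pi]
      in \<Sum>i=1..length \<beta>s + 1. g (\<beta> ! i - \<beta> ! (i - 1)))"

(* For u and v on the circle, Arg2pi (v / u) is the counterclockwise angle in [0, 2 pi)
   from u to v. *)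
definition side_kernel :: "(real \<Rightarrow> real) \<Rightarrow> complex list \<Rightarrow> real" where
  "side_kernel g us = side_h g (map (\<lambda>v. Arg2pi (v / hd us)) (tl us))"

definition circle_tuples :: "nat \<Rightarrow> complex list set" where
  "circle_tuples m = {us. length us = m \<and> set us \<subseteq> unit_circle}"

(* For a list of length m, the equality of sets says that the list runs through the m vertices
   without repetition, in some order. *)
definition regular_polygon_vertices :: "complex list \<Rightarrow> bool" where
  "regular_polygon_vertices us \<longleftrightarrow>
     (\<exists>z\<in>unit_circle. set us = {z * cis (2*pi * real l / real (length us)) | l. l < length us})"

definition max_only_at_regular_polygons :: "nat \<Rightarrow> (complex list \<Rightarrow> real) \<Rightarrow> bool" where
  "max_only_at_regular_polygons m f \<longleftrightarrow>
     (\<forall>us\<in>circle_tuples m.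
        (\<forall>vs\<in>circle_tuples m. f vs \<le> f us) \<longleftrightarrow> regular_polygon_vertices us)"

(* The maximum of f (u i_1, ..., u i_m) over 1 \<le> i_1 < ... < i_m \<le> n; only used for n \<ge> m. *)
definition U_max :: "(complex list \<Rightarrow> real) \<Rightarrow> nat \<Rightarrow> (nat \<Rightarrow> complex) \<Rightarrow> nat \<Rightarrow> real" where
  "U_max f m u n =
     Max {f (map u is) | is. length is = m \<and> sorted_wrt (<) is \<and> set is \<subseteq> {1..n}}"

definition limit_const :: "nat \<Rightarrow> (real \<Rightarrow> real) \<Rightarrow> (real \<Rightarrow> real) \<Rightarrow> real" where
  "limit_const m g p =
     (2*pi) powr ((real m - 1) / 2)
       * integral {0..2*pi} (\<lambda>x. \<Prod>l<m. p (x + 2*pi * real l / real m))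
     / ((- (deriv ^^ 2) g (2*pi / real m)) powr ((real m - 1) / 2)
        * Gamma ((real m + 1) / 2) * sqrt (real m))"

end

theory Submission
  imports Defs "HOL-Combinatorics.Permutations"
begin

text \<open>
  Put \<open>s = t n powr (- 2 m / (m - 1))\<close>. The complement of the event in question says that no \<open>m\<close>-tuple
  of the sample is a hit, that is, has a kernel value of at least the maximum minus \<open>s\<close>.
  Near the maximum the kernel depends on the gaps between neighbouring points only through the sum of
  their squared deviations from \<open>2 pi / m\<close>, up to a factor \<open>g'' / 2 < 0\<close> and smaller terms; by compactness
  every hit lies within order \<open>sqrt s\<close> of a regular polygon. Rescaling by \<open>sqrt s\<close> around the
  polygon of the first point turns the hits into an ellipsoid and gives the probability of one hit,
  asymptotically \<open>(m - 1)! K s powr ((m - 1) / 2)\<close>, so that the mean number of hits tends to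
  \<open>t powr ((m - 1) / 2) K / m\<close>.
  Two hits with a common point force all their points to be aligned with that point, hence are too
  rare to matter, and the number of hits is asymptotically Poisson.
\<close>

section \<open>Poisson approximation\<close>

text \<open>Write \<epsilon> = sqrt s, of order n powr (- m / (m - 1)). A hit leaves one point free
  and pins the other m - 1 angles to within order \<epsilon>, so about n^m tuples have a bounded
  mean number of hits exactly when n^m \<epsilon>^(m - 1) stays constant, and then n \<epsilon>
  tends to 0. This also settles the dependent pairs: two different lists with a common index and u >
  m indices in all contribute at most order n^u \<epsilon>^(u - 1), a constant times (n
  \<epsilon>)^(u - m). The obstacle on the deterministic side is that Taylor's formula is available
  only near 2 pi / m, while a hit is a condition on the value of the kernel alone. Working with gaps
  resolves this: gap tuples form a compact set, and their fixed sum removes the linear term. On the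
  probabilistic side the rescaled hits converge to the ellipsoid only off its boundary, so the
  boundary has to be null, and one fixed box has to contain all rescaled hits. A hit does not know
  the order of its points; the resulting (m - 1)! labellings, set against n choose m, leave the
  factor 1 / m.\<close>

lemma abs_power_diff_le:
  fixes u :: real
  assumes "0 \<le> u" "u \<le> 1" "k \<le> l"
  shows "\<bar>u ^ k - u ^ l\<bar> \<le> real (l - k)"
proof (cases "k = l")
  case False
  with assms have "l - k \<ge> 1" by simp
  moreover have "0 \<le> u ^ k" "u ^ k \<le> 1" "0 \<le> u ^ l" "u ^ l \<le> 1"
    using assms by (auto simp: power_le_one)
  ultimately show ?thesis by (auto simp: abs_le_iff)
qed simp

text \<open>With \<open>W\<close> the number of occurring events, Stein's equation can be avoided: the derivative of \<open>u \<mapsto> E(u ^ W) exp (- \<lambda> u)\<close> on \<open>[0, 1]\<close> is bounded by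
  the right-hand side, and its values at \<open>0\<close> and \<open>1\<close> are the two quantities compared.\<close>

lemma (in prob_space) prob_none_poisson_approx:
  fixes E :: "'i \<Rightarrow> 'a set" and A :: "'i set" and B :: "'i \<Rightarrow> 'i set"
  assumes fin: "finite A" and E [measurable]: "\<And>\<alpha>. \<alpha> \<in> A \<Longrightarrow> E \<alpha> \<in> events"
    and B: "\<And>\<alpha>. \<alpha> \<in> A \<Longrightarrow> \<alpha> \<in> B \<alpha>" "\<And>\<alpha>. \<alpha> \<in> A \<Longrightarrow> B \<alpha> \<subseteq> A"
    and indep: "\<And>\<alpha> u::real. \<alpha> \<in> A \<Longrightarrow> 0 \<le> u \<Longrightarrow> u \<le> 1 \<Longrightarrow>
      expectation (\<lambda>\<omega>. indicator (E \<alpha>) \<omega> * u ^ card {\<beta>\<in>A - B \<alpha>. \<omega> \<in> E \<beta>}) =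
      prob (E \<alpha>) * expectation (\<lambda>\<omega>. u ^ card {\<beta>\<in>A - B \<alpha>. \<omega> \<in> E \<beta>})"
  shows "\<bar>prob {\<omega>\<in>space M. \<forall>\<alpha>\<in>A. \<omega> \<notin> E \<alpha>} - exp (- (\<Sum>\<alpha>\<in>A. prob (E \<alpha>)))\<bar>
    \<le> (\<Sum>\<alpha>\<in>A. \<Sum>\<beta>\<in>B \<alpha>. prob (E \<alpha>) * prob (E \<beta>)) +
       (\<Sum>\<alpha>\<in>A. \<Sum>\<beta>\<in>B \<alpha> - {\<alpha>}. prob (E \<alpha> \<inter> E \<beta>))" (is "_ \<le> ?b")
proof -
  define N where "N S \<omega> = card {\<beta>\<in>S. \<omega> \<in> E \<beta>}" for S \<omega>
  define lam where "lam = (\<Sum>\<alpha>\<in>A. prob (E \<alpha>))"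
  define G where "G u = expectation (\<lambda>\<omega>. u ^ N A \<omega>)" for u :: real
  have N_sum: "N S \<omega> = (\<Sum>\<beta>\<in>S. indicator (E \<beta>) \<omega>)" if "finite S" for S \<omega>
    unfolding N_def using that by (simp add: indicator_def sum.If_cases Int_def)
  have N_sum_real: "real (N S \<omega>) = (\<Sum>\<beta>\<in>S. indicator (E \<beta>) \<omega>)" if "finite S" for S \<omega>
    using that by (simp add: N_sum) (auto intro!: sum.cong simp: indicator_def)
  have N_meas [measurable]: "N S \<in> M \<rightarrow>\<^sub>M count_space UNIV" if "S \<subseteq> A" for S
  proof -
    have "finite S" using that fin finite_subset by blast
    then show ?thesis unfolding N_sum[OF \<open>finite S\<close>, abs_def] indicator_def using that
      by (intro measurable_sum_nat measurable_If measurable_const) (auto intro!: predE E simp: space_count_space)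
  qed
  have N_le: "N S \<omega> \<le> card S" if "finite S" for S \<omega>
    unfolding N_def using that by (intro card_mono) auto
  have N_mono: "N S \<omega> \<le> N T \<omega>" if "S \<subseteq> T" "finite T" for S T \<omega>
    unfolding N_def using that by (intro card_mono) auto
  have N_diff: "N A \<omega> - N (A - S) \<omega> = N S \<omega>" if "S \<subseteq> A" for S \<omega>
  proof -
    have "N A \<omega> = N (A - S) \<omega> + N S \<omega>" using fin that finite_subset[OF that fin]
      by (simp add: N_sum sum.subset_diff)
    then show ?thesis by simp
  qed
  have meas_pow [measurable]: "(\<lambda>\<omega>. u ^ (N S \<omega> - j)) \<in> borel_measurable M"
    if "S \<subseteq> A" for u :: real and S j using N_meas[OF that] by measurable
  have meas_pow0 [measurable]: "(\<lambda>\<omega>. u ^ (N S \<omega>)) \<in> borel_measurable M"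
    if "S \<subseteq> A" for u :: real and S using N_meas[OF that] by measurable
  have int_pow: "integrable M (\<lambda>\<omega>. u ^ N S \<omega>)" if "S \<subseteq> A" "0 \<le> u" "u \<le> 1" for u :: real and S
    using that by (intro integrable_const_bound[where B=1]) (auto simp: power_le_one)
  have int_Epow: "integrable M (\<lambda>\<omega>. indicator (E \<alpha>) \<omega> * u ^ (N S \<omega> - j))"
    if "\<alpha> \<in> A" "S \<subseteq> A" "0 \<le> u" "u \<le> 1" for u :: real and S j \<alpha>
    using that by (intro integrable_const_bound[where B=1])
      (auto simp: power_le_one abs_mult indicator_def)
  have [measurable]: "Measurable.pred M (\<lambda>\<omega>. N A \<omega> = k)" for k using N_meas[of A] by measurable
  \<comment> \<open>The count takes finitely many values, so the generating function G is a
    polynomial in u and may be differentiated term by term.\<close>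
  have expect_N: "expectation (\<lambda>\<omega>. F (N A \<omega>)) = (\<Sum>k\<le>card A. prob {\<omega>\<in>space M. N A \<omega> = k} * F k)"
    for F :: "nat \<Rightarrow> real"
  proof -
    have "expectation (\<lambda>\<omega>. F (N A \<omega>)) =
        expectation (\<lambda>\<omega>. \<Sum>k\<le>card A. indicator {\<omega>\<in>space M. N A \<omega> = k} \<omega> * F k)"
      by (intro Bochner_Integration.integral_cong refl)
         (use N_le[OF fin] in \<open>auto simp: indicator_def if_distrib[of "\<lambda>x. x * _"] cong: if_cong\<close>)
    also have "\<dots> = (\<Sum>k\<le>card A. expectation (\<lambda>\<omega>. indicator {\<omega>\<in>space M. N A \<omega> = k} \<omega> * F k))"
      by (intro Bochner_Integration.integral_sum integrable_mult_left integrable_real_indicator)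
         (auto simp: emeasure_eq_measure)
    finally show ?thesis by simp
  qed
  define G' where "G' u = expectation (\<lambda>\<omega>. real (N A \<omega>) * u ^ (N A \<omega> - 1))" for u :: real
  have G_deriv: "(G has_real_derivative G' u) (at u)" for u
    unfolding G_def[abs_def] G'_def expect_N[of "\<lambda>k. _ ^ k"] expect_N[of "\<lambda>k. real k * u ^ (k - 1)"]
    by (auto intro!: derivative_eq_intros sum.cong)
  \<comment> \<open>Serves both comparisons below: each changes only an exponent of u, at a cost of
    at most the number of neighbouring events that occur.\<close>
  have diff_le: "\<bar>expectation f - expectation h\<bar> \<le> (\<Sum>\<beta>\<in>S. prob (F \<beta>))"
    if "integrable M f" "integrable M h" and F: "\<And>\<beta>. \<beta> \<in> S \<Longrightarrow> F \<beta> \<in> events"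
      and le: "\<And>\<omega>. \<bar>f \<omega> - h \<omega>\<bar> \<le> (\<Sum>\<beta>\<in>S. indicator (F \<beta>) \<omega>)"
    for f h :: "'a \<Rightarrow> real" and S :: "'i set" and F
  proof -
    have ind: "integrable M (indicator (F \<beta>) :: 'a \<Rightarrow> real)" if "\<beta> \<in> S" for \<beta>
      using F[OF that] by (intro integrable_real_indicator) (auto simp: emeasure_eq_measure)
    have "\<bar>expectation f - expectation h\<bar> = \<bar>expectation (\<lambda>\<omega>. f \<omega> - h \<omega>)\<bar>" using that by simp
    also have "\<dots> \<le> expectation (\<lambda>\<omega>. \<bar>f \<omega> - h \<omega>\<bar>)" by (rule integral_abs_bound)
    also have "\<dots> \<le> expectation (\<lambda>\<omega>. \<Sum>\<beta>\<in>S. indicator (F \<beta>) \<omega>)"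
      using that ind by (intro integral_mono le integrable_abs Bochner_Integration.integrable_diff
          Bochner_Integration.integrable_sum)
    also have "\<dots> = (\<Sum>\<beta>\<in>S. prob (F \<beta>))"
      using ind F by (subst Bochner_Integration.integral_sum) auto
    finally show ?thesis .
  qed
  have bound: "\<bar>G' u - lam * G u\<bar> \<le> ?b" if u: "0 \<le> u" "u \<le> 1" for u
  proof -
    have B_fin: "finite (B \<alpha>)" if "\<alpha> \<in> A" for \<alpha> using B(2)[OF that] fin finite_subset by blast
    \<comment> \<open>d1 is the cost of dropping the neighbours of \<alpha> from the count, after
      which \<open>indep\<close> factors the expectation; d2 is the cost of putting them
      back.\<close>
    define d1 where "d1 \<alpha> = expectation (\<lambda>\<omega>. indicator (E \<alpha>) \<omega> * u ^ (N A \<omega> - 1))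
        - expectation (\<lambda>\<omega>. indicator (E \<alpha>) \<omega> * u ^ N (A - B \<alpha>) \<omega>)" for \<alpha>
    define d2 where "d2 \<alpha> = expectation (\<lambda>\<omega>. u ^ N (A - B \<alpha>) \<omega>) - G u" for \<alpha>
    have "G' u = expectation (\<lambda>\<omega>. \<Sum>\<alpha>\<in>A. indicator (E \<alpha>) \<omega> * u ^ (N A \<omega> - 1))"
      unfolding G'_def by (intro Bochner_Integration.integral_cong refl)
        (simp only: N_sum_real[OF fin] sum_distrib_right)
    also have "\<dots> = (\<Sum>\<alpha>\<in>A. expectation (\<lambda>\<omega>. indicator (E \<alpha>) \<omega> * u ^ (N A \<omega> - 1)))"
      using u by (intro Bochner_Integration.integral_sum int_Epow) auto
    also have "\<dots> = (\<Sum>\<alpha>\<in>A. d1 \<alpha> + prob (E \<alpha>) * d2 \<alpha> + prob (E \<alpha>) * G u)"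
    proof (intro sum.cong refl)
      fix \<alpha> assume "\<alpha> \<in> A"
      from indep[OF this u, folded N_def]
      show "expectation (\<lambda>\<omega>. indicator (E \<alpha>) \<omega> * u ^ (N A \<omega> - 1)) =
         d1 \<alpha> + prob (E \<alpha>) * d2 \<alpha> + prob (E \<alpha>) * G u"
        unfolding d1_def d2_def by (simp add: algebra_simps)
    qed
    finally have eq: "G' u - lam * G u = (\<Sum>\<alpha>\<in>A. d1 \<alpha> + prob (E \<alpha>) * d2 \<alpha>)"
      by (simp add: lam_def sum.distrib sum_distrib_right)
    have d1: "\<bar>d1 \<alpha>\<bar> \<le> (\<Sum>\<beta>\<in>B \<alpha> - {\<alpha>}. prob (E \<alpha> \<inter> E \<beta>))" if \<alpha>: "\<alpha> \<in> A" for \<alpha> unfolding d1_def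
    proof (rule diff_le)
      note BA = B(2)[OF \<alpha>]
      show "integrable M (\<lambda>\<omega>. indicator (E \<alpha>) \<omega> * u ^ (N A \<omega> - 1))"
        using \<alpha> u by (intro int_Epow) auto
      show "integrable M (\<lambda>\<omega>. indicator (E \<alpha>) \<omega> * u ^ N (A - B \<alpha>) \<omega>)"
        using int_Epow[of \<alpha> "A - B \<alpha>" u 0] \<alpha> u by simp
      show "E \<alpha> \<inter> E \<beta> \<in> events" if "\<beta> \<in> B \<alpha> - {\<alpha>}" for \<beta>
        using \<alpha> BA that by (auto intro!: sets.Int E)
      show "\<bar>indicator (E \<alpha>) \<omega> * u ^ (N A \<omega> - 1) - indicator (E \<alpha>) \<omega> * u ^ N (A - B \<alpha>) \<omega>\<bar>
        \<le> (\<Sum>\<beta>\<in>B \<alpha> - {\<alpha>}. indicator (E \<alpha> \<inter> E \<beta>) \<omega>)" for \<omega>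
      proof (cases "\<omega> \<in> E \<alpha>")
        case True
        have eq: "(\<Sum>\<beta>\<in>B \<alpha> - {\<alpha>}. indicator (E \<alpha> \<inter> E \<beta>) \<omega>) = real (N (B \<alpha> - {\<alpha>}) \<omega>)"
          using True B_fin[OF \<alpha>] by (simp add: N_sum_real indicator_def)
        \<comment> \<open>\<alpha> itself is counted in \<open>B \<alpha>\<close>, so lowering the
          exponent by one leaves exactly \<open>N (B \<alpha> - {\<alpha>})\<close> between the two
          exponents.\<close>
        have 1: "N (B \<alpha>) \<omega> = Suc (N (B \<alpha> - {\<alpha>}) \<omega>)" using True B(1)[OF \<alpha>] B_fin[OF \<alpha>]
          by (simp add: N_sum sum.remove[of "B \<alpha>" \<alpha>])
        have 2: "N A \<omega> = N (A - B \<alpha>) \<omega> + N (B \<alpha>) \<omega>"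
          using N_diff[OF BA, of \<omega>] N_mono[of "A - B \<alpha>" A \<omega>] fin by auto
        have "\<bar>u ^ N (A - B \<alpha>) \<omega> - u ^ (N A \<omega> - 1)\<bar> \<le> real ((N A \<omega> - 1) - N (A - B \<alpha>) \<omega>)"
          using u 1 2 by (intro abs_power_diff_le) auto
        also have "(N A \<omega> - 1) - N (A - B \<alpha>) \<omega> = N (B \<alpha> - {\<alpha>}) \<omega>" using 1 2 by simp
        finally show ?thesis using True by (simp add: eq abs_minus_commute)
      qed (simp add: sum_nonneg)
    qed
    have d2: "\<bar>d2 \<alpha>\<bar> \<le> (\<Sum>\<beta>\<in>B \<alpha>. prob (E \<beta>))" if \<alpha>: "\<alpha> \<in> A" for \<alpha> unfolding d2_def G_def
    proof (rule diff_le)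
      note BA = B(2)[OF \<alpha>]
      show "\<bar>u ^ N (A - B \<alpha>) \<omega> - u ^ N A \<omega>\<bar> \<le> (\<Sum>\<beta>\<in>B \<alpha>. indicator (E \<beta>) \<omega>)" for \<omega>
      proof -
        have "\<bar>u ^ N (A - B \<alpha>) \<omega> - u ^ N A \<omega>\<bar> \<le> real (N A \<omega> - N (A - B \<alpha>) \<omega>)"
          using u fin by (intro abs_power_diff_le N_mono) auto
        also have "\<dots> = (\<Sum>\<beta>\<in>B \<alpha>. indicator (E \<beta>) \<omega>)"
          by (simp only: N_diff[OF BA] N_sum_real[OF B_fin[OF \<alpha>]])
        finally show ?thesis .
      qed
    qed (use B(2)[OF \<alpha>] u in \<open>auto intro!: int_pow\<close>)
    have "\<bar>G' u - lam * G u\<bar> \<le> (\<Sum>\<alpha>\<in>A. \<bar>d1 \<alpha> + prob (E \<alpha>) * d2 \<alpha>\<bar>)" unfolding eq by (rule sum_abs)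
    also have "\<dots> \<le> (\<Sum>\<alpha>\<in>A. prob (E \<alpha>) * (\<Sum>\<beta>\<in>B \<alpha>. prob (E \<beta>)) + (\<Sum>\<beta>\<in>B \<alpha> - {\<alpha>}. prob (E \<alpha> \<inter> E \<beta>)))"
    proof (intro sum_mono)
      fix \<alpha> assume \<alpha>: "\<alpha> \<in> A"
      have "\<bar>prob (E \<alpha>) * d2 \<alpha>\<bar> \<le> prob (E \<alpha>) * (\<Sum>\<beta>\<in>B \<alpha>. prob (E \<beta>))"
        unfolding abs_mult using d2[OF \<alpha>] by (auto intro!: mult_left_mono)
      then show "\<bar>d1 \<alpha> + prob (E \<alpha>) * d2 \<alpha>\<bar> \<le>
         prob (E \<alpha>) * (\<Sum>\<beta>\<in>B \<alpha>. prob (E \<beta>)) + (\<Sum>\<beta>\<in>B \<alpha> - {\<alpha>}. prob (E \<alpha> \<inter> E \<beta>))"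
        using d1[OF \<alpha>] by linarith
    qed
    also have "\<dots> = ?b" by (simp add: sum.distrib sum_distrib_left)
    finally show ?thesis .
  qed
  define H where "H u = G u * exp (- lam * u)" for u
  have H_deriv: "(H has_field_derivative (G' u - lam * G u) * exp (- lam * u)) (at u within {0..1})" for u
  proof -
    have "(H has_real_derivative G' u * exp (- lam * u) + G u * (exp (- lam * u) * (- lam))) (at u)"
      unfolding H_def[abs_def] by (auto intro!: derivative_eq_intros G_deriv)
    then have "(H has_real_derivative (G' u - lam * G u) * exp (- lam * u)) (at u)"
      by (simp add: algebra_simps)
    then show ?thesis by (rule has_field_derivative_at_within)
  qed
  have lam0: "0 \<le> lam" by (simp add: lam_def sum_nonneg)
  have "norm (H 1 - H 0) \<le> ?b * norm (1 - 0 :: real)"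
  proof (rule field_differentiable_bound[OF _ H_deriv])
    fix u :: real assume "u \<in> {0..1}"
    then have u: "0 \<le> u" "u \<le> 1" by auto
    have "norm ((G' u - lam * G u) * exp (- lam * u)) = \<bar>G' u - lam * G u\<bar> * exp (- lam * u)"
      by (simp add: abs_mult)
    also have "\<dots> \<le> ?b * 1"
      using bound[OF u] lam0 u by (intro mult_mono) (auto intro: order_trans[OF abs_ge_zero])
    finally show "norm ((G' u - lam * G u) * exp (- lam * u)) \<le> ?b" by simp
  qed auto
  moreover have "H 1 = exp (- lam)" unfolding H_def G_def by (simp add: prob_space)
  moreover have "H 0 = prob {\<omega>\<in>space M. \<forall>\<alpha>\<in>A. \<omega> \<notin> E \<alpha>}"
  proof -
    \<comment> \<open>Since \<open>0 ^ 0 = 1\<close>, the integrand is the indicator that no event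
      occurs.\<close>
    have "H 0 = expectation (\<lambda>\<omega>. 0 ^ N A \<omega>)" by (simp add: H_def G_def)
    also have "\<dots> = expectation (indicator {\<omega>\<in>space M. \<forall>\<alpha>\<in>A. \<omega> \<notin> E \<alpha>})"
      by (intro Bochner_Integration.integral_cong refl)
        (auto simp: N_def power_0_left indicator_def fin)
    also have "\<dots> = prob ({\<omega>\<in>space M. \<forall>\<alpha>\<in>A. \<omega> \<notin> E \<alpha>} \<inter> space M)"
      by (rule Bochner_Integration.integral_indicator)
    also have "{\<omega>\<in>space M. \<forall>\<alpha>\<in>A. \<omega> \<notin> E \<alpha>} \<inter> space M = {\<omega>\<in>space M. \<forall>\<alpha>\<in>A. \<omega> \<notin> E \<alpha>}" by blast
    finally show ?thesis .
  qed
  ultimately show ?thesis by (simp add: lam_def abs_minus_commute)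
qed

section \<open>Gaps between neighbouring points\<close>

lemma Arg2pi_cis: "0 \<le> x \<Longrightarrow> x < 2*pi \<Longrightarrow> Arg2pi (cis x) = x"
  by (rule Arg2pi_unique[of 1]) (auto simp: cis_conv_exp)

lemma incseq_upto:
  fixes \<beta> :: "nat \<Rightarrow> real"
  assumes "\<And>i. i < m \<Longrightarrow> \<beta> i \<le> \<beta> (Suc i)" "i \<le> j" "j \<le> m"
  shows "\<beta> i \<le> \<beta> j" using assms(2,3)
proof (induction j rule: dec_induct)
  case (step n)
  then show ?case using assms(1)[of n] by simp
qed simp

lemma side_h_mono:
  assumes "m \<ge> 1" and \<beta>: "\<beta> 0 = 0" "\<beta> m = 2*pi" "\<And>i. i < m \<Longrightarrow> \<beta> i \<le> \<beta> (Suc i)"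
  shows "side_h g (map \<beta> [1..<m]) = (\<Sum>i<m. g (\<beta> (Suc i) - \<beta> i))"
proof -
  have mono: "\<beta> i \<le> \<beta> j" if "i \<le> j" "j \<le> m" for i j using incseq_upto[of m \<beta>] \<beta>(3) that by blast
  have "sorted (map \<beta> [1..<m])"
    by (auto simp: sorted_wrt_map sorted_wrt_iff_nth_less intro!: mono)
  then have srt: "sort (map \<beta> [1..<m]) = map \<beta> [1..<m]" by (rule sorted_sort_id)
  have nth: "([0] @ map \<beta> [1..<m] @ [2*pi]) ! i = \<beta> i" if "i \<le> m" for i
    using that \<open>m \<ge> 1\<close> \<beta>(1,2) by (cases "i = m"; cases i) (auto simp: nth_append)
  have "side_h g (map \<beta> [1..<m]) = (\<Sum>i=1..length (map \<beta> [1..<m]) + 1.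
      g (([0] @ map \<beta> [1..<m] @ [2*pi]) ! i - ([0] @ map \<beta> [1..<m] @ [2*pi]) ! (i - 1)))"
    by (simp only: side_h_def Let_def srt)
  also have "\<dots> = (\<Sum>i=1..length (map \<beta> [1..<m]) + 1. g (\<beta> i - \<beta> (i - 1)))"
  proof (intro sum.cong refl)
    fix i assume "i \<in> {1..length (map \<beta> [1..<m]) + 1}"
    then have "i \<le> m" "i - 1 \<le> m" using \<open>m \<ge> 1\<close> by auto
    then show "g (([0] @ map \<beta> [1..<m] @ [2*pi]) ! i - ([0] @ map \<beta> [1..<m] @ [2*pi]) ! (i - 1)) = g (\<beta> i - \<beta> (i - 1))"
      by (simp only: nth)
  qed
  also have "{1..length (map \<beta> [1..<m]) + 1} = Suc ` {..<m}"
    using \<open>m \<ge> 1\<close> by (simp add: image_Suc_lessThan)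
  finally show ?thesis by (simp add: sum.reindex)
qed

text \<open>The last angle must be strictly below 2 pi: \<open>Arg2pi\<close> would read 2 pi as 0
  and move that point from the end of the tuple to its front.\<close>

lemma side_kernel_cis_mono:
  assumes "m \<ge> 1" and \<beta>: "\<beta> 0 = 0" "\<beta> m = 2*pi" "\<And>i. i < m \<Longrightarrow> \<beta> i \<le> \<beta> (Suc i)"
    and lt: "\<beta> (m - 1) < 2*pi"
  shows "side_kernel g (map (\<lambda>i. cis (\<beta> i)) [0..<m]) = (\<Sum>i<m. g (\<beta> (Suc i) - \<beta> i))"
proof -
  have mono: "\<beta> i \<le> \<beta> j" if "i \<le> j" "j \<le> m" for i j using incseq_upto[of m \<beta>] \<beta>(3) that by blast
  have "[0..<m] = 0 # [1..<m]" using \<open>m \<ge> 1\<close> by (simp add: upt_rec)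
  then have "side_kernel g (map (\<lambda>i. cis (\<beta> i)) [0..<m]) = side_h g (map (\<lambda>i. Arg2pi (cis (\<beta> i))) [1..<m])"
    using \<beta>(1) by (simp add: side_kernel_def comp_def del: upt_Suc)
  also have "map (\<lambda>i. Arg2pi (cis (\<beta> i))) [1..<m] = map \<beta> [1..<m]"
  proof (intro map_cong refl Arg2pi_cis)
    fix i assume "i \<in> set [1..<m]"
    then have "i \<le> m - 1" "i \<le> m" by auto
    then show "0 \<le> \<beta> i" "\<beta> i < 2*pi" using mono[of 0 i] mono[of i "m - 1"] \<beta>(1) lt by auto
  qed
  also have "side_h g (map \<beta> [1..<m]) = (\<Sum>i<m. g (\<beta> (Suc i) - \<beta> i))"
    using assms by (intro side_h_mono) auto
  finally show ?thesis .
qed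

section \<open>Second-order expansion of the generating function\<close>

lemma second_order_taylor:
  fixes g :: "real \<Rightarrow> real"
  assumes "Ck_near 3 g a" "e > 0"
  shows "\<exists>\<eta>>0. \<forall>d. \<bar>d\<bar> < \<eta> \<longrightarrow>
    \<bar>g (a + d) - g a - deriv g a * d - (deriv ^^ 2) g a / 2 * d\<^sup>2\<bar> \<le> e * d\<^sup>2"
proof -
  obtain r where r: "r > 0" "\<And>j x. j < 3 \<Longrightarrow> x \<in> ball a r \<Longrightarrow> (deriv ^^ j) g field_differentiable at x"
    using assms(1) unfolding Ck_near_def by blast
  have d1: "(g has_real_derivative deriv g x) (at x)" if "x \<in> ball a r" for x
    using r(2)[of 0 x] that by (simp add: DERIV_deriv_iff_field_differentiable)
  have d2: "(deriv g has_real_derivative (deriv ^^ 2) g x) (at x)" if "x \<in> ball a r" for x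
    using r(2)[of 1 x] that by (simp add: DERIV_deriv_iff_field_differentiable numeral_2_eq_2)
  define D where "D = (deriv ^^ 2) g a"
  have "(deriv g has_derivative (\<lambda>h. h * D)) (at a)"
    using d2[of a] r(1) by (simp add: has_field_derivative_def D_def mult.commute[of _ "_ D"] mult_commute_abs)
  then obtain \<eta>0 where \<eta>0: "\<eta>0 > 0" "\<And>y. norm (y - a) < \<eta>0 \<Longrightarrow> norm (deriv g y - deriv g a - (y - a) * D) \<le> e * norm (y - a)"
    using \<open>e > 0\<close> unfolding has_derivative_at_alt by blast
  define \<eta> where "\<eta> = min r \<eta>0"
  have "\<bar>g (a + d) - g a - deriv g a * d - D / 2 * d\<^sup>2\<bar> \<le> e * d\<^sup>2" if "\<bar>d\<bar> < \<eta>" for d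
  proof -
    \<comment> \<open>Peano's form of the remainder: differentiability of \<open>deriv g\<close> at
      a bounds the derivative of R by e times the distance from 0, and the mean value inequality on
      the segment supplies the second factor.\<close>
    define R where "R y = g (a + y) - deriv g a * y - D / 2 * y\<^sup>2" for y
    have "norm (R d - R 0) \<le> (e * \<bar>d\<bar>) * norm (d - 0)"
    proof (rule field_differentiable_bound[of "closed_segment 0 d"])
      fix y assume y: "y \<in> closed_segment 0 d"
      then have yd: "\<bar>y\<bar> \<le> \<bar>d\<bar>" by (auto simp: closed_segment_eq_real_ivl split: if_splits)
      have "a + y \<in> ball a r" using yd that by (simp add: dist_real_def \<eta>_def)
      from d1[OF this] have "((\<lambda>y. g (a + y)) has_real_derivative deriv g (a + y)) (at y)"
        using DERIV_shift[of g "deriv g (a + y)" y a] by (simp add: add.commute)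
      then have "(R has_real_derivative deriv g (a + y) - deriv g a - y * D) (at y)"
        unfolding R_def by (auto intro!: derivative_eq_intros)
      then show "(R has_real_derivative deriv g (a + y) - deriv g a - y * D) (at y within closed_segment 0 d)"
        by (rule has_field_derivative_at_within)
      have "norm (deriv g (a + y) - deriv g a - y * D) \<le> e * \<bar>y\<bar>"
        using \<eta>0(2)[of "a + y"] yd that by (simp add: \<eta>_def)
      also have "\<dots> \<le> e * \<bar>d\<bar>" using yd \<open>e > 0\<close> by simp
      finally show "norm (deriv g (a + y) - deriv g a - y * D) \<le> e * \<bar>d\<bar>" .
    qed auto
    then show ?thesis by (simp add: R_def power2_eq_square algebra_simps)
  qed
  moreover have "\<eta> > 0" using r(1) \<eta>0(1) by (simp add: \<eta>_def)
  ultimately show ?thesis unfolding D_def by blast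
qed

section \<open>Maximising the sum over the gaps\<close>

definition gap_tuple :: "nat \<Rightarrow> (nat \<Rightarrow> real) \<Rightarrow> bool" where
  "gap_tuple m \<gamma> \<longleftrightarrow> (\<forall>i<m. 0 \<le> \<gamma> i) \<and> (\<Sum>i<m. \<gamma> i) = 2*pi"

lemma gap_tuple_le_2pi: "gap_tuple m \<gamma> \<Longrightarrow> i < m \<Longrightarrow> \<gamma> i \<le> 2*pi"
  using member_le_sum[of i "{..<m}" \<gamma>] by (auto simp: gap_tuple_def)

locale side_max =
  fixes m :: nat and g :: "real \<Rightarrow> real"
  assumes m2: "m \<ge> 2"
    and cont: "continuous_on {0..2*pi} g"
    and Ck: "Ck_near 3 g (2*pi / real m)"
    and nondeg: "(deriv ^^ 2) g (2*pi / real m) \<noteq> 0"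
    and max_only: "max_only_at_regular_polygons m (side_kernel g)"
begin

definition a :: real where "a = 2*pi / real m"

lemma a_pos: "a > 0" and ma: "real m * a = 2*pi" using m2 by (auto simp: a_def)

lemma mult_a_lt: "l < m \<Longrightarrow> a * real l < 2*pi" using m2 by (simp add: a_def field_simps)

lemma regular_value:
  "side_kernel g (map (\<lambda>i. cis (a * real i)) [0..<m]) = real m * g a"
  and regular_regular: "regular_polygon_vertices (map (\<lambda>i. cis (a * real i)) [0..<m])"
proof -
  have "side_kernel g (map (\<lambda>i. cis (a * real i)) [0..<m]) = (\<Sum>i<m. g (a * real (Suc i) - a * real i))"
    using m2 ma a_pos mult_a_lt[of "m - 1"] by (intro side_kernel_cis_mono) (auto simp: mult.commute)
  also have "\<dots> = real m * g a" by (simp add: algebra_simps)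
  finally show "side_kernel g (map (\<lambda>i. cis (a * real i)) [0..<m]) = real m * g a" .
  show "regular_polygon_vertices (map (\<lambda>i. cis (a * real i)) [0..<m])"
    unfolding regular_polygon_vertices_def by (rule bexI[of _ 1]) (auto simp: a_def)
qed

text \<open>The equivalence in \<open>max_only_at_regular_polygons\<close> is used both ways: the
  regular tuple is a maximum point, which fixes the maximal value, and a tuple that reaches this
  value is again a maximum point, hence regular.\<close>

lemma kernel_le:
  assumes "us \<in> circle_tuples m"
  shows "side_kernel g us \<le> real m * g a"
    and "side_kernel g us = real m * g a \<Longrightarrow> regular_polygon_vertices us"
proof -
  let ?v = "map (\<lambda>i. cis (a * real i)) [0..<m]"
  have v: "?v \<in> circle_tuples m" by (auto simp: circle_tuples_def)
  have "\<forall>vs\<in>circle_tuples m. side_kernel g vs \<le> side_kernel g ?v"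
    using max_only v regular_regular unfolding max_only_at_regular_polygons_def by blast
  then have le: "\<forall>vs\<in>circle_tuples m. side_kernel g vs \<le> real m * g a"
    by (simp add: regular_value)
  then show "side_kernel g us \<le> real m * g a" using assms by blast
  show "regular_polygon_vertices us" if "side_kernel g us = real m * g a"
    using max_only assms le that unfolding max_only_at_regular_polygons_def by auto
qed

text \<open>A positive last gap keeps all partial sums of the gaps below \<open>2 pi\<close>, where \<^const>\<open>Arg2pi\<close>
  recovers them. In general some gap is positive, and the sum is symmetric in the gaps.\<close>

lemma gap_sum_last_pos:
  assumes \<gamma>: "gap_tuple m \<gamma>" and last: "\<gamma> (m - 1) > 0"
  shows "(\<Sum>i<m. g (\<gamma> i)) \<le> real m * g a"
    and "(\<Sum>i<m. g (\<gamma> i)) = real m * g a \<Longrightarrow> i < m \<Longrightarrow> \<gamma> i = a"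
proof -
  define \<beta> where "\<beta> i = (\<Sum>j<i. \<gamma> j)" for i
  let ?us = "map (\<lambda>i. cis (\<beta> i)) [0..<m]"
  have \<beta>: "\<beta> 0 = 0" "\<beta> m = 2*pi" "\<And>i. i < m \<Longrightarrow> \<beta> i \<le> \<beta> (Suc i)"
    using \<gamma> by (auto simp: \<beta>_def gap_tuple_def)
  have "\<beta> m = \<beta> (m - 1) + \<gamma> (m - 1)" using m2 by (cases m) (auto simp: \<beta>_def)
  then have lt: "\<beta> (m - 1) < 2*pi" using \<beta>(2) last by simp
  have val: "side_kernel g ?us = (\<Sum>i<m. g (\<gamma> i))"
    using side_kernel_cis_mono[OF _ \<beta> lt, of g] m2 by (simp add: \<beta>_def)
  have us: "?us \<in> circle_tuples m" by (auto simp: circle_tuples_def)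
  show "(\<Sum>i<m. g (\<gamma> i)) \<le> real m * g a" using kernel_le(1)[OF us] val by simp
  assume "(\<Sum>i<m. g (\<gamma> i)) = real m * g a"
  then have "regular_polygon_vertices ?us" using kernel_le(2)[OF us] val by simp
  then obtain z where "z \<in> unit_circle" and set_us: "set ?us = {z * cis (a * real l) |l. l < m}"
    unfolding regular_polygon_vertices_def by (auto simp: a_def)
  then have z0: "z \<noteq> 0" by auto
  \<comment> \<open>The m vertices are distinct, so a list of length m that runs through all of them
    has no repetition.\<close>
  have inj: "inj_on (\<lambda>l. z * cis (a * real l)) {..<m}"
  proof (rule inj_onI)
    fix l l' assume l: "l \<in> {..<m}" "l' \<in> {..<m}" "z * cis (a * real l) = z * cis (a * real l')"
    then have "Arg2pi (cis (a * real l)) = Arg2pi (cis (a * real l'))" using z0 by simp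
    then show "l = l'" using l mult_a_lt a_pos by (simp add: Arg2pi_cis)
  qed
  have "card (set ?us) = m"
  proof -
    have "{z * cis (a * real l) |l. l < m} = (\<lambda>l. z * cis (a * real l)) ` {..<m}" by auto
    then show ?thesis unfolding set_us using card_image[OF inj] by simp
  qed
  then have dist: "distinct ?us" by (intro card_distinct) simp
  have mono: "\<beta> i \<le> \<beta> j" if "i \<le> j" "j \<le> m" for i j using incseq_upto[of m \<beta>] \<beta>(3) that by blast
  have range: "0 \<le> \<beta> i" "\<beta> i < 2*pi" if "i < m" for i
  proof -
    have "i \<le> m - 1" "i \<le> m" using that by auto
    then show "0 \<le> \<beta> i" "\<beta> i < 2*pi" using mono[of 0 i] mono[of i "m - 1"] \<beta>(1) lt by auto
  qed
  have "cis (\<beta> 0) \<in> set ?us" using m2 by auto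
  \<comment> \<open>The tuple starts at angle 0, so 1 is itself a vertex. This determines the
    rotation z by a vertex number and makes every angle a multiple of a.\<close>
  then have "1 \<in> set ?us" using \<beta>(1) by simp
  then obtain l0 where l0: "l0 < m" "z * cis (a * real l0) = 1" unfolding set_us by auto
  have mult: "\<exists>k::int. \<beta> i = a * of_int k" if i: "i < m" for i
  proof -
    have "cis (\<beta> i) \<in> set ?us" using i by auto
    then obtain l where l: "l < m" "cis (\<beta> i) = z * cis (a * real l)" unfolding set_us by auto
    have "z = cis (- (a * real l0))" using l0(2) by (metis cis_inverse cis_neq_zero divide_self_if eq_divide_eq inverse_eq_divide)
    then have eq: "cis (\<beta> i) = cis (a * (real l - real l0))" using l(2) by (simp add: cis_mult algebra_simps)
    show ?thesis
    proof (cases "l0 \<le> l")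
      case True
      have "a * (real l - real l0) < 2*pi"
        using mult_a_lt[OF l(1)] a_pos by (simp add: algebra_simps) (smt (verit) mult_nonneg_nonneg of_nat_0_le_iff)
      then have "\<beta> i = a * (real l - real l0)"
        using Arg2pi_cis[OF range[OF i]] eq Arg2pi_cis[of "a * (real l - real l0)"] True a_pos by simp
      then show ?thesis by (intro exI[of _ "int l - int l0"]) simp
    next
      case False
      \<comment> \<open>A negative difference of vertex numbers falls outside [0, 2 pi); a full
        turn, that is m steps of a, brings it back.\<close>
      have "cis (\<beta> i) = cis (a * (real l - real l0) + 2 * pi)" unfolding eq by (simp add: cis_mult[symmetric])
      also have "a * (real l - real l0) + 2 * pi = a * (real l - real l0 + real m)"
        using ma by (simp add: algebra_simps)
      finally have eq: "cis (\<beta> i) = cis (a * (real l - real l0 + real m))" .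
      have "a * (real l - real l0) < 0" using False a_pos by (simp add: mult_less_0_iff)
      then have "a * (real l - real l0 + real m) < 2 * pi" using ma by (simp add: algebra_simps)
      then have "\<beta> i = a * (real l - real l0 + real m)"
        using Arg2pi_cis[OF range[OF i]] eq Arg2pi_cis[of "a * (real l - real l0 + real m)"] l0(1) a_pos by simp
      then show ?thesis by (intro exI[of _ "int l - int l0 + int m"]) simp
    qed
  qed
  \<comment> \<open>Each gap is a positive multiple of a, hence at least a; as the gaps sum to m a,
    none can exceed it.\<close>
  have ge: "a \<le> \<gamma> i" if i: "i < m" for i
  proof -
    have \<gamma>_eq: "\<gamma> i = \<beta> (Suc i) - \<beta> i" by (simp add: \<beta>_def)
    have "\<exists>k::int. \<beta> (Suc i) = a * of_int k"
    proof (cases "Suc i = m")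
      case True
      then show ?thesis using \<beta>(2) ma by (intro exI[of _ "int m"]) (simp add: mult.commute)
    qed (use mult[of "Suc i"] i in auto)
    then obtain k l :: int where "\<beta> (Suc i) = a * of_int k" "\<beta> i = a * of_int l" using mult[OF i] by blast
    then have k: "\<gamma> i = a * of_int (k - l)" by (simp add: \<gamma>_eq algebra_simps)
    \<comment> \<open>Distinctness of the points covers every gap but the last, whose right end 2 pi
      is not an entry of the list; that gap is positive by assumption.\<close>
    have "\<gamma> i \<noteq> 0"
    proof (cases "i = m - 1")
      case False
      then have "Suc i < m" using i by auto
      then have "?us ! i \<noteq> ?us ! Suc i" using dist by (subst nth_eq_iff_index_eq) auto
      then show ?thesis using \<open>Suc i < m\<close> by (auto simp: \<gamma>_eq)
    qed (use last in auto)
    then have "\<gamma> i > 0" using \<gamma> i by (auto simp: gap_tuple_def less_le)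
    then have "k - l \<ge> 1" unfolding k using a_pos by (simp add: zero_less_mult_iff)
    then have "a * 1 \<le> a * of_int (k - l)" using a_pos by (intro mult_left_mono) (auto simp del: of_int_diff)
    then show ?thesis unfolding k by simp
  qed
  assume "i < m"
  have "(\<Sum>i<m. \<gamma> i - a) = 0" using \<gamma> ma by (simp add: gap_tuple_def sum_subtractf)
  then have "\<forall>i\<in>{..<m}. \<gamma> i - a = 0" using ge by (subst (asm) sum_nonneg_eq_0_iff) auto
  then show "\<gamma> i = a" using \<open>i < m\<close> by auto
qed

lemma gap_sum:
  assumes \<gamma>: "gap_tuple m \<gamma>"
  shows "(\<Sum>i<m. g (\<gamma> i)) \<le> real m * g a"
    and "(\<Sum>i<m. g (\<gamma> i)) = real m * g a \<Longrightarrow> i < m \<Longrightarrow> \<gamma> i = a"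
proof -
  have "\<exists>k<m. \<gamma> k > 0"
  proof (rule ccontr)
    assume "\<not> ?thesis"
    then have "(\<Sum>i<m. \<gamma> i) \<le> 0" by (intro sum_nonpos) auto
    then show False using \<gamma> pi_gt_zero by (simp add: gap_tuple_def)
  qed
  then obtain k where k: "k < m" "\<gamma> k > 0" by blast
  let ?t = "Transposition.transpose k (m - 1)"
  have perm: "?t permutes {..<m}" using k(1) by (intro permutes_swap_id) auto
  have s: "(\<Sum>i<m. f (\<gamma> (?t i))) = (\<Sum>i<m. f (\<gamma> i))" for f :: "real \<Rightarrow> real"
    using sum.permute[OF perm, of "\<lambda>i. f (\<gamma> i)"] by (simp add: comp_def)
  have gt: "gap_tuple m (\<lambda>i. \<gamma> (?t i))"
    using \<gamma> s[of "\<lambda>x. x"] permutes_in_image[OF perm] by (auto simp: gap_tuple_def)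
  have last: "\<gamma> (?t (m - 1)) > 0" using k(2) by simp
  show "(\<Sum>i<m. g (\<gamma> i)) \<le> real m * g a" using gap_sum_last_pos(1)[OF gt last] s[of g] by simp
  assume eq: "(\<Sum>i<m. g (\<gamma> i)) = real m * g a" and i: "i < m"
  have "\<gamma> (?t (?t i)) = a"
    by (rule gap_sum_last_pos(2)[OF gt last]) (use s[of g] eq i permutes_in_image[OF perm] in auto)
  then show "\<gamma> i = a" by simp
qed


text \<open>On the compact set of gap tuples with some gap off by at least \<eta>, the gap sum
  attains a maximum, which stays strictly below m g a because only the regular tuple reaches that
  value. Half of the difference serves as \<open>s0\<close>.\<close>

lemma gap_sum_compact:
  assumes "\<eta> > 0"
  shows "\<exists>s0>0. \<forall>\<gamma>. gap_tuple m \<gamma> \<longrightarrow> (\<Sum>i<m. g (\<gamma> i)) \<ge> real m * g a - s0 \<longrightarrow> (\<forall>i<m. \<bar>\<gamma> i - a\<bar> < \<eta>)"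
proof -
  \<comment> \<open>Clamping makes the gap sum continuous on all of
    \<open>nat \<Rightarrow> real\<close>, although g is continuous on [0, 2 pi] only.\<close>
  define gc where "gc x = g (max 0 (min (2*pi) x))" for x
  have gc: "continuous_on UNIV gc"
    unfolding gc_def by (rule continuous_on_compose2[OF cont]) (auto intro!: continuous_intros)
  have gc_eq: "(\<Sum>i<m. gc (\<gamma> i)) = (\<Sum>i<m. g (\<gamma> i))" if "gap_tuple m \<gamma>" for \<gamma>
    using that gap_tuple_le_2pi[OF that] by (intro sum.cong) (auto simp: gc_def gap_tuple_def)
  \<comment> \<open>Coordinates beyond m are pinned at 0, so that K is compact in the product
    topology.\<close>
  define K where "K = PiE UNIV (\<lambda>i. if i < m then {0..2*pi} else {0::real})"
  have "compactin (product_topology (\<lambda>i. euclidean) UNIV) K"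
    unfolding K_def by (subst compactin_PiE) auto
  then have K: "compact K" by (simp add: euclidean_product_topology)
  define C where "C = K \<inter> ({\<gamma>. (\<Sum>i<m. \<gamma> i) = 2*pi} \<inter> (\<Union>i<m. {\<gamma>. \<eta> \<le> \<bar>\<gamma> i - a\<bar>}))"
  have cont_coord: "continuous_on UNIV (\<lambda>\<gamma>::nat \<Rightarrow> real. f (\<gamma> i))" if "continuous_on UNIV f" for f :: "real \<Rightarrow> real" and i
    by (rule continuous_on_compose2[OF that continuous_on_product_coordinates]) auto
  have "compact C" unfolding C_def
  proof (intro compact_Int_closed K closed_Int closed_UN closed_Collect_eq closed_Collect_le ballI)
    show "continuous_on UNIV (\<lambda>\<gamma>::nat \<Rightarrow> real. \<Sum>i<m. \<gamma> i)" by (intro continuous_intros) simp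
    show "continuous_on UNIV (\<lambda>\<gamma>::nat \<Rightarrow> real. \<bar>\<gamma> i - a\<bar>)" for i
      by (intro cont_coord continuous_intros)
  qed auto
  have C_gap: "gap_tuple m \<gamma>" if "\<gamma> \<in> C" for \<gamma>
  proof -
    have "\<gamma> i \<in> {0..2*pi}" if "i < m" for i
    proof -
      have "\<gamma> \<in> K" using \<open>\<gamma> \<in> C\<close> by (simp add: C_def)
      then have "\<gamma> i \<in> (if i < m then {0..2*pi} else {0})" unfolding K_def by (rule PiE_mem) simp
      then show ?thesis using that by simp
    qed
    then show ?thesis using \<open>\<gamma> \<in> C\<close> by (auto simp: C_def gap_tuple_def)
  qed
  have C_in: "(\<lambda>i. if i < m then \<gamma> i else 0) \<in> C" if "gap_tuple m \<gamma>" "i < m" "\<eta> \<le> \<bar>\<gamma> i - a\<bar>" for \<gamma> i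
    using that gap_tuple_le_2pi[OF that(1)] by (auto simp: C_def K_def gap_tuple_def PiE_def)
  have contC: "continuous_on C (\<lambda>\<gamma>. \<Sum>i<m. gc (\<gamma> i))"
    by (rule continuous_on_subset[OF _ subset_UNIV]) (intro continuous_on_sum cont_coord gc)
  show ?thesis
  proof (cases "C = {}")
    case True
    then have "\<forall>\<gamma>. gap_tuple m \<gamma> \<longrightarrow> (\<forall>i<m. \<bar>\<gamma> i - a\<bar> < \<eta>)" using C_in by (metis empty_iff not_le)
    then show ?thesis by (intro exI[of _ 1]) auto
  next
    case False
    obtain \<gamma>0 where \<gamma>0: "\<gamma>0 \<in> C" "\<And>\<gamma>. \<gamma> \<in> C \<Longrightarrow> (\<Sum>i<m. gc (\<gamma> i)) \<le> (\<Sum>i<m. gc (\<gamma>0 i))"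
      using continuous_attains_sup[OF \<open>compact C\<close> False contC] by blast
    note gt = C_gap[OF \<gamma>0(1)]
    have "(\<Sum>i<m. g (\<gamma>0 i)) \<noteq> real m * g a"
    proof
      assume "(\<Sum>i<m. g (\<gamma>0 i)) = real m * g a"
      then have "\<forall>i<m. \<gamma>0 i = a" using gap_sum(2)[OF gt] by blast
      then show False using \<gamma>0(1) \<open>\<eta> > 0\<close> by (auto simp: C_def)
    qed
    then have lt: "(\<Sum>i<m. g (\<gamma>0 i)) < real m * g a" using gap_sum(1)[OF gt] by simp
    define s0 where "s0 = (real m * g a - (\<Sum>i<m. g (\<gamma>0 i))) / 2"
    have "s0 > 0" using lt by (simp add: s0_def)
    moreover have "\<bar>\<gamma> i - a\<bar> < \<eta>" if "gap_tuple m \<gamma>" "(\<Sum>i<m. g (\<gamma> i)) \<ge> real m * g a - s0" "i < m" for \<gamma> i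
    proof (rule ccontr)
      assume "\<not> ?thesis"
      then have "(\<lambda>i. if i < m then \<gamma> i else 0) \<in> C" using that by (intro C_in) auto
      from \<gamma>0(2)[OF this] have "(\<Sum>i<m. gc (\<gamma> i)) \<le> (\<Sum>i<m. gc (\<gamma>0 i))" by simp
      then show False using gc_eq[OF gt] gc_eq[OF that(1)] that(2) lt by (simp add: s0_def field_simps)
    qed
    ultimately show ?thesis by blast
  qed
qed

text \<open>The sign and the factor 1 / 2 are chosen so that, to second order, moving the gaps by
  \<open>d i\<close> with sum 0 lowers the gap sum by curv times the sum of the squares.\<close>

definition curv :: real where "curv = - (deriv ^^ 2) g a / 2"

lemma taylor:
  assumes "e > 0"
  shows "\<exists>\<eta>>0. \<forall>d. \<bar>d\<bar> < \<eta> \<longrightarrow> \<bar>g (a + d) - g a - deriv g a * d + curv * d\<^sup>2\<bar> \<le> e * d\<^sup>2"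
  using second_order_taylor[OF Ck[folded a_def] assms] by (simp add: curv_def)

text \<open>By \<open>nondeg\<close> only a positive second derivative has to be excluded.
  Lengthening one gap by h and shortening another by h cancels the linear terms, and a convex
  second-order term would then push the gap sum above its maximum.\<close>

lemma curv_pos: "curv > 0"
proof (rule ccontr)
  assume "\<not> ?thesis"
  then have neg: "curv < 0" using nondeg by (auto simp: curv_def a_def)
  obtain \<eta> where \<eta>: "\<eta> > 0" "\<And>d. \<bar>d\<bar> < \<eta> \<Longrightarrow>
      \<bar>g (a + d) - g a - deriv g a * d + curv * d\<^sup>2\<bar> \<le> (- curv / 2) * d\<^sup>2"
    using taylor[of "- curv / 2"] neg by auto
  \<comment> \<open>Below \<eta> for the expansion to apply, below a for the shortened gap to stay
    nonnegative.\<close>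
  define h where "h = min (\<eta> / 2) (a / 2)"
  have h: "0 < h" "h < \<eta>" "h < a" using \<eta>(1) a_pos by (auto simp: h_def min_def)
  define \<gamma> where "\<gamma> i = (if i = 0 then a + h else if i = Suc 0 then a - h else a)" for i :: nat
  have split: "{..<m} = insert 0 (insert (Suc 0) {2..<m})" using m2 by auto
  have sum: "(\<Sum>i<m. f (\<gamma> i)) = f (a + h) + f (a - h) + real (m - 2) * f a" for f :: "real \<Rightarrow> real"
    unfolding split by (simp add: \<gamma>_def)
  have "gap_tuple m \<gamma>"
    using h a_pos sum[of "\<lambda>x. x"] m2 ma by (auto simp: gap_tuple_def \<gamma>_def of_nat_diff algebra_simps)
  from gap_sum(1)[OF this] have "g (a + h) + g (a - h) \<le> 2 * g a"
    using m2 unfolding sum by (simp add: of_nat_diff algebra_simps)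
  moreover have "g (a + h) - g a - deriv g a * h + curv * h\<^sup>2 \<ge> curv / 2 * h\<^sup>2"
    using \<eta>(2)[of h] h by (auto simp: abs_le_iff)
  moreover have "g (a - h) - g a + deriv g a * h + curv * h\<^sup>2 \<ge> curv / 2 * h\<^sup>2"
    using \<eta>(2)[of "-h"] h by (auto simp: abs_le_iff)
  ultimately have "curv * h\<^sup>2 \<ge> 0" by (simp add: field_simps)
  then show False using neg h by (simp add: zero_le_mult_iff)
qed

text \<open>The deviations sum to 0 because the gaps have a fixed sum, so the linear terms cancel
  whatever the slope at a is.\<close>

lemma gap_sum_taylor:
  assumes e: "e > 0" "\<And>d. \<bar>d\<bar> < \<eta> \<Longrightarrow> \<bar>g (a + d) - g a - deriv g a * d + curv * d\<^sup>2\<bar> \<le> e * d\<^sup>2"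
    and d: "\<And>i. i < m \<Longrightarrow> \<bar>d i\<bar> < \<eta>" "(\<Sum>i<m. d i) = 0"
  shows "\<bar>(\<Sum>i<m. g (a + d i)) - real m * g a + curv * (\<Sum>i<m. (d i)\<^sup>2)\<bar> \<le> e * (\<Sum>i<m. (d i)\<^sup>2)"
proof -
  have eq: "(\<Sum>i<m. g (a + d i)) - real m * g a + curv * (\<Sum>i<m. (d i)\<^sup>2) =
    (\<Sum>i<m. g (a + d i) - g a - deriv g a * d i + curv * (d i)\<^sup>2) + deriv g a * (\<Sum>i<m. d i)"
    by (simp add: sum.distrib sum_subtractf sum_distrib_left)
  have "\<bar>(\<Sum>i<m. g (a + d i)) - real m * g a + curv * (\<Sum>i<m. (d i)\<^sup>2)\<bar>
      \<le> (\<Sum>i<m. \<bar>g (a + d i) - g a - deriv g a * d i + curv * (d i)\<^sup>2\<bar>)"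
    unfolding eq by (simp only: d(2) mult_zero_right add_0_right sum_abs)
  also have "\<dots> \<le> (\<Sum>i<m. e * (d i)\<^sup>2)"
  proof (rule sum_mono)
    fix i assume "i \<in> {..<m}"
    then show "\<bar>g (a + d i) - g a - deriv g a * d i + curv * (d i)\<^sup>2\<bar> \<le> e * (d i)\<^sup>2"
      using e(2)[OF d(1)] by simp
  qed
  finally show ?thesis by (simp add: sum_distrib_left)
qed

text \<open>Compactness forces all gaps into the range of the Taylor expansion; there an error of
  half the curvature still leaves a drop of curv / 2 times the squared deviations, whence C = 2 /
  curv.\<close>

lemma gap_sum_near:
  obtains s0 C where "s0 > 0" "C > 0"
    "\<And>s \<gamma>. s \<le> s0 \<Longrightarrow> gap_tuple m \<gamma> \<Longrightarrow> (\<Sum>i<m. g (\<gamma> i)) \<ge> real m * g a - s \<Longrightarrow>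
      (\<Sum>i<m. (\<gamma> i - a)\<^sup>2) \<le> C * s"
proof -
  obtain \<eta> where \<eta>: "\<eta> > 0" "\<And>d. \<bar>d\<bar> < \<eta> \<Longrightarrow> \<bar>g (a + d) - g a - deriv g a * d + curv * d\<^sup>2\<bar> \<le> curv / 2 * d\<^sup>2"
    using taylor[of "curv / 2"] curv_pos by auto
  obtain s0 where s0: "s0 > 0" "\<And>\<gamma> i. gap_tuple m \<gamma> \<Longrightarrow> (\<Sum>i<m. g (\<gamma> i)) \<ge> real m * g a - s0 \<Longrightarrow> i < m \<Longrightarrow> \<bar>\<gamma> i - a\<bar> < \<eta>"
    using gap_sum_compact[OF \<eta>(1)] by blast
  have "(\<Sum>i<m. (\<gamma> i - a)\<^sup>2) \<le> 2 / curv * s"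
    if "s \<le> s0" "gap_tuple m \<gamma>" "(\<Sum>i<m. g (\<gamma> i)) \<ge> real m * g a - s" for s \<gamma>
  proof -
    let ?S = "\<Sum>i<m. (\<gamma> i - a)\<^sup>2"
    have "\<bar>(\<Sum>i<m. g (a + (\<gamma> i - a))) - real m * g a + curv * ?S\<bar> \<le> curv / 2 * ?S"
      using curv_pos s0(2)[OF that(2)] that ma
      by (intro gap_sum_taylor[where \<eta>=\<eta>] \<eta>(2)) (auto simp: gap_tuple_def sum_subtractf)
    from abs_le_D1[OF this] have "curv / 2 * ?S \<le> s" using that(3) by (simp add: field_simps)
    then show ?thesis using curv_pos by (simp add: field_simps)
  qed
  then show ?thesis using s0(1) curv_pos by (intro that[of s0 "2 / curv"]) auto
qed

lemma gap_sum_scaled: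
  assumes d: "(\<Sum>i<m. d i) = 0"
  shows "((\<lambda>\<epsilon>. (real m * g a - (\<Sum>i<m. g (a + \<epsilon> * d i))) / \<epsilon>\<^sup>2) \<longlongrightarrow> curv * (\<Sum>i<m. (d i)\<^sup>2)) (at 0)"
proof (rule tendstoI)
  fix e :: real assume "e > 0"
  let ?S = "\<Sum>i<m. (d i)\<^sup>2"
  \<comment> \<open>The added 1 covers the case \<open>?S = 0\<close>.\<close>
  define e' where "e' = e / (2 * (?S + 1))"
  have S: "?S \<ge> 0" by (simp add: sum_nonneg)
  have e': "e' > 0" "e' * ?S < e" using \<open>e > 0\<close> S by (auto simp: e'_def field_simps add_pos_nonneg)
  obtain \<eta> where \<eta>: "\<eta> > 0" "\<And>d. \<bar>d\<bar> < \<eta> \<Longrightarrow> \<bar>g (a + d) - g a - deriv g a * d + curv * d\<^sup>2\<bar> \<le> e' * d\<^sup>2"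
    using taylor[OF e'(1)] by auto
  have "\<forall>\<^sub>F \<epsilon> in at 0. \<forall>i\<in>{..<m}. \<bar>\<epsilon> * d i\<bar> < \<eta>"
  proof (intro eventually_ball_finite ballI)
    fix i
    have "((\<lambda>\<epsilon>. \<bar>\<epsilon> * d i\<bar>) \<longlongrightarrow> \<bar>0 * d i\<bar>) (at 0)" by (intro tendsto_intros)
    then show "\<forall>\<^sub>F \<epsilon> in at 0. \<bar>\<epsilon> * d i\<bar> < \<eta>" using \<eta>(1) by (intro order_tendstoD(2)) auto
  qed simp
  moreover have "\<forall>\<^sub>F \<epsilon>::real in at 0. \<epsilon> \<noteq> 0" by (rule eventually_neq_at_within)
  ultimately show "\<forall>\<^sub>F \<epsilon> in at 0. dist ((real m * g a - (\<Sum>i<m. g (a + \<epsilon> * d i))) / \<epsilon>\<^sup>2) (curv * ?S) < e"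
  proof eventually_elim
    case (elim \<epsilon>)
    have eq: "(\<Sum>i<m. (\<epsilon> * d i)\<^sup>2) = \<epsilon>\<^sup>2 * ?S" by (simp add: power_mult_distrib sum_distrib_left)
    let ?G = "\<Sum>i<m. g (a + \<epsilon> * d i)"
    have "\<bar>?G - real m * g a + curv * (\<Sum>i<m. (\<epsilon> * d i)\<^sup>2)\<bar> \<le> e' * (\<Sum>i<m. (\<epsilon> * d i)\<^sup>2)"
      using elim d by (intro gap_sum_taylor[where \<eta>=\<eta>] \<eta>(2) e') (auto simp: sum_distrib_left[symmetric])
    then have "\<bar>?G - real m * g a + curv * (\<epsilon>\<^sup>2 * ?S)\<bar> \<le> \<epsilon>\<^sup>2 * (e' * ?S)" unfolding eq by (simp add: mult_ac)
    moreover have "(real m * g a - ?G) / \<epsilon>\<^sup>2 - curv * ?S = - (?G - real m * g a + curv * (\<epsilon>\<^sup>2 * ?S)) / \<epsilon>\<^sup>2"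
      using elim by (simp add: field_simps)
    ultimately have "\<bar>(real m * g a - ?G) / \<epsilon>\<^sup>2 - curv * ?S\<bar> \<le> e' * ?S"
      using elim by (simp add: abs_divide field_simps)
    then show ?case using e'(2) by (simp add: dist_real_def)
  qed
qed

text \<open>\<open>p j\<close> is the rank of \<open>y j\<close> among the sorted angles, kept so
  that statements about sorted angles can be carried back to y. One \<beta> serves every f, which
  allows g and its clamped version to be compared on the same gaps.\<close>

lemma side_h_gaps:
  assumes "\<And>j. j \<in> {1..<m} \<Longrightarrow> y j \<in> {0..2*pi}"
  obtains \<beta> p where "p permutes {1..<m}" "\<And>j. j \<in> {1..<m} \<Longrightarrow> y j = \<beta> (p j)"
    "\<beta> 0 = 0" "\<beta> m = 2*pi" "\<And>i. i < m \<Longrightarrow> \<beta> i \<le> \<beta> (Suc i)"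
    "\<And>f. side_h f (map y [1..<m]) = (\<Sum>i<m. f (\<beta> (Suc i) - \<beta> i))"
proof -
  define xs where "xs = map y [1..<m]"
  define zs where "zs = sort xs"
  have len: "length xs = m - 1" "length zs = m - 1" by (auto simp: xs_def zs_def)
  have "mset xs = mset zs" by (simp add: zs_def)
  then obtain q where q: "q permutes {..<length zs}" "permute_list q zs = xs"
    by (rule mset_eq_permutation)
  define \<beta> where "\<beta> i = (if i = 0 then 0 else if i = m then 2*pi else zs ! (i - 1))" for i
  \<comment> \<open>List positions start at 0 and angle indices at 1, so p is q shifted by
    one.\<close>
  define p where "p j = (if j \<in> {1..<m} then Suc (q (j - 1)) else j)" for j
  have q_in: "q i < m - 1" if "i < m - 1" for i
    using permutes_in_image[OF q(1), of i] that len by simp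
  have p: "p permutes {1..<m}"
  proof (rule bij_imp_permutes)
    have "bij_betw p {1..<m} {1..<m}" unfolding bij_betw_def
    proof
      have inj: "inj_on p {1..<m}"
      proof (rule inj_onI)
        fix x y assume xy: "x \<in> {1..<m}" "y \<in> {1..<m}" "p x = p y"
        then have "q (x - 1) = q (y - 1)" by (simp add: p_def)
        then have "x - 1 = y - 1" using permutes_inj[OF q(1)] by (auto dest: injD)
        then show "x = y" using xy by auto
      qed
      then show "inj_on p {1..<m}" .
      have "p ` {1..<m} \<subseteq> {1..<m}"
      proof (rule image_subsetI)
        fix j assume "j \<in> {1..<m}"
        then have "j - 1 < m - 1" by (simp add: diff_less_mono)
        then show "p j \<in> {1..<m}" using q_in[of "j - 1"] \<open>j \<in> {1..<m}\<close> unfolding p_def by simp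
      qed
      then show "p ` {1..<m} = {1..<m}" using inj by (intro endo_inj_surj) auto
    qed
    then show "bij_betw p {1..<m} {1..<m}" .
  qed (auto simp: p_def)
  have y: "y j = \<beta> (p j)" if j: "j \<in> {1..<m}" for j
  proof -
    have "y j = xs ! (j - 1)" using j by (auto simp: xs_def)
    also have "\<dots> = zs ! q (j - 1)"
      using q j len by (metis Suc_le_eq Suc_pred atLeastLessThan_iff diff_less_mono length_permute_list permute_list_nth zero_less_one less_numeral_extra(1))
    also have "\<dots> = \<beta> (p j)"
    proof -
      have "j - 1 < m - 1" using j by (simp add: diff_less_mono)
      from q_in[OF this] show ?thesis using j by (auto simp: \<beta>_def p_def)
    qed
    finally show ?thesis .
  qed
  have set: "set zs \<subseteq> {0..2*pi}" using assms by (auto simp: zs_def xs_def)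
  have srt: "sorted zs" by (simp add: zs_def)
  have mono: "\<beta> i \<le> \<beta> (Suc i)" if im: "i < m" for i
  proof -
    consider "i = 0" "Suc i = m" | "i = 0" "Suc i < m" | "0 < i" "Suc i = m" | "0 < i" "Suc i < m"
      using im by (metis Suc_lessI gr0I)
    then show ?thesis
    proof cases
      case 2
      then have "zs ! 0 \<in> {0..2*pi}" using set len by (intro subsetD[OF set] nth_mem) auto
      then show ?thesis using 2 by (auto simp: \<beta>_def)
    next
      case 3
      then have "zs ! (i - 1) \<in> {0..2*pi}" using set len by (intro subsetD[OF set] nth_mem) auto
      then show ?thesis using 3 by (auto simp: \<beta>_def)
    next
      case 4
      then have "zs ! (i - 1) \<le> zs ! i" using srt len by (intro sorted_nth_mono) auto
      then show ?thesis using 4 by (auto simp: \<beta>_def)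
    qed (auto simp: \<beta>_def)
  qed
  have "side_h f (map y [1..<m]) = (\<Sum>i<m. f (\<beta> (Suc i) - \<beta> i))" for f
  proof -
    have "zs = map \<beta> [1..<m]" using len by (intro nth_equalityI) (auto simp: \<beta>_def)
    moreover have "side_h f xs = side_h f zs"
      using sorted_sort_id[OF srt] len by (simp only: side_h_def zs_def[symmetric])
    moreover have "side_h f (map \<beta> [1..<m]) = (\<Sum>i<m. f (\<beta> (Suc i) - \<beta> i))"
      using m2 mono by (intro side_h_mono) (auto simp: \<beta>_def)
    ultimately show ?thesis by (simp add: xs_def)
  qed
  with p y mono show ?thesis using m2 by (intro that[of p \<beta>]) (auto simp: \<beta>_def)
qed

end

section \<open>Volume of the limiting ellipsoid\<close>

lemma measurable_gap:
  fixes i k :: nat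
  assumes "i \<in> {1..k}"
  shows "(\<lambda>z. z i - (if i = 1 then 0 else z (i - 1))) \<in> borel_measurable (Pi\<^sub>M {1..k} (\<lambda>_. lborel))"
proof (cases "i = 1")
  case True
  then show ?thesis using assms by simp
next
  case False
  then have "i \<in> {1..k}" "i - 1 \<in> {1..k}" using assms by auto
  then show ?thesis using False by simp
qed

lemma measurable_last:
  "(\<lambda>z. if k = 0 then 0 else z k) \<in> borel_measurable (Pi\<^sub>M {1..k::nat} (\<lambda>_. lborel :: real measure))"
  by (cases "k = 0") auto

text \<open>The argument of \<phi> is the sum of squared steps of a path from 0 to c, whose minimum
  over the intermediate points is c^2 / (k + 1). Completing the square in the last intermediate
  point removes one coordinate. The free end point c is what lets the induction go through, and the
  Jacobians sqrt ((k + 1) / (k + 2)) telescope to the factor in front.\<close>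

lemma chain_integral:
  fixes \<phi> :: "real \<Rightarrow> ennreal"
  assumes [measurable]: "\<phi> \<in> borel_measurable borel"
  shows "(\<integral>\<^sup>+z. \<phi> ((\<Sum>i=1..k. (z i - (if i = 1 then 0 else z (i - 1)))\<^sup>2) + (c - (if k = 0 then 0 else z k))\<^sup>2)
            \<partial>Pi\<^sub>M {1..k} (\<lambda>_. lborel)) =
         ennreal (1 / sqrt (real k + 1)) *
         (\<integral>\<^sup>+w. \<phi> ((\<Sum>i=1..k. (w i)\<^sup>2) + c\<^sup>2 / (real k + 1)) \<partial>Pi\<^sub>M {1..k} (\<lambda>_. lborel))"
  using assms
proof (induction k arbitrary: \<phi> c)
  case 0
  then show ?case by simp
next
  case (Suc k)
  note [measurable] = Suc.prems
  interpret product_sigma_finite "\<lambda>_. lborel :: real measure" by unfold_locales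
  let ?P = "Pi\<^sub>M {1..k} (\<lambda>_. lborel :: real measure)"
  interpret P: finite_product_sigma_finite "\<lambda>_. lborel :: real measure" "{1..k}"
    by unfold_locales simp
  note [measurable] = P.borel_measurable_nn_integral
  have ins: "{1..Suc k} = insert (Suc k) {1..k}" by auto
  have sumeq: "(\<Sum>i=1..Suc k. ((z(Suc k := y)) i - (if i = 1 then 0 else (z(Suc k := y)) (i - 1)))\<^sup>2)
      = (\<Sum>i=1..k. (z i - (if i = 1 then 0 else z (i - 1)))\<^sup>2) + (y - (if k = 0 then 0 else z k))\<^sup>2"
    for z and y :: real by (auto intro!: sum.cong)
  have sumeq2: "(\<Sum>i=1..Suc k. ((z(Suc k := y)) i)\<^sup>2) = (\<Sum>i=1..k. (z i)\<^sup>2) + y\<^sup>2" for z and y :: real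
    by simp
  have "(\<integral>\<^sup>+z. \<phi> ((\<Sum>i=1..Suc k. (z i - (if i = 1 then 0 else z (i - 1)))\<^sup>2) + (c - (if Suc k = 0 then 0 else z (Suc k)))\<^sup>2)
            \<partial>Pi\<^sub>M {1..Suc k} (\<lambda>_. lborel)) =
    (\<integral>\<^sup>+y. \<integral>\<^sup>+z. \<phi> ((\<Sum>i=1..k. (z i - (if i = 1 then 0 else z (i - 1)))\<^sup>2) + (y - (if k = 0 then 0 else z k))\<^sup>2 + (c - y)\<^sup>2) \<partial>?P \<partial>lborel)"
  proof -
    have "(\<lambda>z. \<phi> ((\<Sum>i=1..Suc k. (z i - (if i = 1 then 0 else z (i - 1)))\<^sup>2)
        + (c - (if Suc k = 0 then 0 else z (Suc k)))\<^sup>2)) \<in> borel_measurable (Pi\<^sub>M {1..Suc k} (\<lambda>_. lborel))"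
      by (intro measurable_compose[OF _ Suc.prems] borel_measurable_add borel_measurable_sum
          borel_measurable_power borel_measurable_diff[OF borel_measurable_const] measurable_gap measurable_last)
    then show ?thesis unfolding ins
      apply (subst product_nn_integral_insert_rev)
         apply simp
        apply simp
       apply assumption
      apply (unfold ins[symmetric] sumeq)
      apply simp
      done
  qed
  also have "\<dots> = (\<integral>\<^sup>+y. ennreal (1 / sqrt (real k + 1)) *
      (\<integral>\<^sup>+w. \<phi> ((\<Sum>i=1..k. (w i)\<^sup>2) + y\<^sup>2 / (real k + 1) + (c - y)\<^sup>2) \<partial>?P) \<partial>lborel)"
    by (intro nn_integral_cong Suc.IH[of "\<lambda>q. \<phi> (q + (c - _)\<^sup>2)"]) simp
  also have "\<dots> = ennreal (1 / sqrt (real k + 1)) * (\<integral>\<^sup>+y.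
      (\<integral>\<^sup>+w. \<phi> ((\<Sum>i=1..k. (w i)\<^sup>2) + y\<^sup>2 / (real k + 1) + (c - y)\<^sup>2) \<partial>?P) \<partial>lborel)"
    by (intro nn_integral_cmult) measurable
  also have "(\<integral>\<^sup>+y. (\<integral>\<^sup>+w. \<phi> ((\<Sum>i=1..k. (w i)\<^sup>2) + y\<^sup>2 / (real k + 1) + (c - y)\<^sup>2) \<partial>?P) \<partial>lborel)
    = ennreal (sqrt ((real k + 1) / (real k + 2))) * (\<integral>\<^sup>+v. (\<integral>\<^sup>+w. \<phi> ((\<Sum>i=1..k. (w i)\<^sup>2) + v\<^sup>2 + c\<^sup>2 / (real k + 2)) \<partial>?P) \<partial>lborel)"
  proof -
    \<comment> \<open>?t minimises the quadratic in y, and ?s is the scale that turns its leading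
      coefficient (k + 2) / (k + 1) into 1.\<close>
    let ?s = "sqrt ((real k + 1) / (real k + 2))" and ?t = "(real k + 1) / (real k + 2) * c"
    have key: "(\<Sum>i=1..k. (w i)\<^sup>2) + (?t + ?s * v)\<^sup>2 / (real k + 1) + (c - (?t + ?s * v))\<^sup>2
      = (\<Sum>i=1..k. (w i)\<^sup>2) + v\<^sup>2 + c\<^sup>2 / (real k + 2)" for w :: "nat \<Rightarrow> real" and v
    proof -
      define K where "K = real k"
      have K: "K + 1 \<noteq> 0" "K + 2 \<noteq> 0" "0 \<le> K" by (simp_all add: K_def)
      have square: "y\<^sup>2 / (K + 1) + (c - y)\<^sup>2 = (K + 2) / (K + 1) * (y - (K + 1) / (K + 2) * c)\<^sup>2 + c\<^sup>2 / (K + 2)" for y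
        using K(1,2) by (simp add: divide_simps) algebra
      have "(K + 2) / (K + 1) * (sqrt ((K + 1) / (K + 2)) * v)\<^sup>2 = v\<^sup>2"
        using K by (simp add: power_mult_distrib)
      then show ?thesis
        using square[of "(K + 1) / (K + 2) * c + sqrt ((K + 1) / (K + 2)) * v"] by (simp add: K_def)
    qed
    have "(\<integral>\<^sup>+y. (\<integral>\<^sup>+w. \<phi> ((\<Sum>i=1..k. (w i)\<^sup>2) + y\<^sup>2 / (real k + 1) + (c - y)\<^sup>2) \<partial>?P) \<partial>lborel)
      = \<bar>?s\<bar> * (\<integral>\<^sup>+v. (\<integral>\<^sup>+w. \<phi> ((\<Sum>i=1..k. (w i)\<^sup>2) + (?t + ?s * v)\<^sup>2 / (real k + 1) + (c - (?t + ?s * v))\<^sup>2) \<partial>?P) \<partial>lborel)"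
    proof (rule nn_integral_real_affine)
      have "(\<lambda>y. \<integral>\<^sup>+w. \<phi> ((\<Sum>i=1..k. (w i)\<^sup>2) + y\<^sup>2 / (real k + 1) + (c - y)\<^sup>2) \<partial>?P) \<in> borel_measurable lborel"
        by measurable
      then show "(\<lambda>y. \<integral>\<^sup>+w. \<phi> ((\<Sum>i=1..k. (w i)\<^sup>2) + y\<^sup>2 / (real k + 1) + (c - y)\<^sup>2) \<partial>?P) \<in> borel_measurable borel"
        by simp
    qed (simp add: real_sqrt_eq_zero_cancel_iff)
    also have "\<bar>?s\<bar> = ?s" by simp
    finally show ?thesis unfolding key .
  qed
  also have "(\<integral>\<^sup>+v. (\<integral>\<^sup>+w. \<phi> ((\<Sum>i=1..k. (w i)\<^sup>2) + v\<^sup>2 + c\<^sup>2 / (real k + 2)) \<partial>?P) \<partial>lborel)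
    = (\<integral>\<^sup>+w. \<phi> ((\<Sum>i=1..Suc k. (w i)\<^sup>2) + c\<^sup>2 / (real (Suc k) + 1)) \<partial>Pi\<^sub>M {1..Suc k} (\<lambda>_. lborel))"
    unfolding ins
    apply (subst product_nn_integral_insert_rev)
       apply simp
      apply simp
     apply measurable
    apply (unfold ins[symmetric] sumeq2)
    apply (simp add: add.commute)
    done
  also have "ennreal (1 / sqrt (real k + 1)) * (ennreal (sqrt ((real k + 1) / (real k + 2))) * X) =
    ennreal (1 / sqrt (real (Suc k) + 1)) * X" for X
    by (simp add: mult.assoc[symmetric] ennreal_mult[symmetric] real_sqrt_divide add.commute)
  finally show ?case .
qed

text \<open>The quadratic form of the tridiagonal matrix with 2 on the diagonal and -1 beside it,
  whose determinant is k + 1; the case c = 0 of \<open>chain_integral\<close>, for paths that return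
  to 0.\<close>

definition chain_form :: "nat \<Rightarrow> (nat \<Rightarrow> real) \<Rightarrow> real" where
  "chain_form k z = (\<Sum>i=1..k. (z i - (if i = 1 then 0 else z (i - 1)))\<^sup>2) + (0 - (if k = 0 then 0 else z k))\<^sup>2"

lemma measurable_chain_form [measurable]:
  "chain_form k \<in> borel_measurable (Pi\<^sub>M {1..k} (\<lambda>_. lborel))" unfolding chain_form_def[abs_def]
  by (intro borel_measurable_add borel_measurable_sum
      borel_measurable_power borel_measurable_diff[OF borel_measurable_const] measurable_gap measurable_last)

lemma emeasure_chain_form_vimage:
  assumes [measurable]: "S \<in> sets borel"
  shows "emeasure (Pi\<^sub>M {1..k} (\<lambda>_. lborel)) {z\<in>space (Pi\<^sub>M {1..k} (\<lambda>_. lborel)). chain_form k z \<in> S} =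
    ennreal (1 / sqrt (real k + 1)) *
    emeasure (Pi\<^sub>M {1..k} (\<lambda>_. lborel)) {w\<in>space (Pi\<^sub>M {1..k} (\<lambda>_. lborel)). (\<Sum>i=1..k. (w i)\<^sup>2) \<in> S}"
    (is "emeasure ?P _ = _")
proof -
  have "emeasure ?P {z\<in>space ?P. chain_form k z \<in> S} = (\<integral>\<^sup>+z. indicator S (chain_form k z) \<partial>?P)"

  proof -
    have "emeasure ?P {z\<in>space ?P. chain_form k z \<in> S} = (\<integral>\<^sup>+z. indicator {z\<in>space ?P. chain_form k z \<in> S} z \<partial>?P)"
      by (subst nn_integral_indicator) measurable
    also have "\<dots> = (\<integral>\<^sup>+z. indicator S (chain_form k z) \<partial>?P)"
      by (intro nn_integral_cong) (simp add: indicator_def)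
    finally show ?thesis by simp
  qed
  also have "\<dots> = ennreal (1 / sqrt (real k + 1)) * (\<integral>\<^sup>+w. indicator S (\<Sum>i=1..k. (w i)\<^sup>2) \<partial>?P)"
    unfolding chain_form_def using chain_integral[of "indicator S" k 0] by simp
  also have "(\<integral>\<^sup>+w. indicator S (\<Sum>i=1..k. (w i)\<^sup>2) \<partial>?P) =
      emeasure ?P {w\<in>space ?P. (\<Sum>i=1..k. (w i)\<^sup>2) \<in> S}"

  proof -
    have "emeasure ?P {z\<in>space ?P. (\<Sum>i=1..k. (z i)\<^sup>2) \<in> S} = (\<integral>\<^sup>+z. indicator {z\<in>space ?P. (\<Sum>i=1..k. (z i)\<^sup>2) \<in> S} z \<partial>?P)"
      by (subst nn_integral_indicator) measurable
    also have "\<dots> = (\<integral>\<^sup>+z. indicator S (\<Sum>i=1..k. (z i)\<^sup>2) \<partial>?P)"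
      by (intro nn_integral_cong) (simp add: indicator_def)
    finally show ?thesis by simp
  qed
  finally show ?thesis .
qed

lemma emeasure_chain_form_le:
  assumes "R > 0"
  shows "emeasure (Pi\<^sub>M {1..k} (\<lambda>_. lborel)) {z\<in>space (Pi\<^sub>M {1..k} (\<lambda>_. lborel)). chain_form k z \<le> R} =
    ennreal (unit_ball_vol (real k) * sqrt R ^ k / sqrt (real k + 1))"
    (is "emeasure ?P _ = _")
proof -
  have "emeasure ?P {z\<in>space ?P. chain_form k z \<in> {..R}} = ennreal (1 / sqrt (real k + 1)) *
    emeasure ?P {w\<in>space ?P. (\<Sum>i=1..k. (w i)\<^sup>2) \<in> {..R}}"
    by (rule emeasure_chain_form_vimage) simp
  also have "{w\<in>space ?P. (\<Sum>i=1..k. (w i)\<^sup>2) \<in> {..R}} = {w. sqrt (\<Sum>i\<in>{1..k}. (w i)\<^sup>2) \<le> sqrt R} \<inter> space ?P"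
    by auto
  also have "emeasure ?P \<dots> = ennreal (unit_ball_vol (real (card {1..k})) * sqrt R ^ card {1..k})"
    using assms by (intro emeasure_cball_aux) auto
  finally show ?thesis using assms by (simp add: ennreal_mult[symmetric] sum_nonneg)
qed

text \<open>The level set lies between sublevel sets whose volumes depend continuously on the level.
  It is the boundary of the limiting ellipsoid, where the indicators of the rescaled hits need not
  converge.\<close>

lemma emeasure_chain_form_eq:
  assumes "R > 0"
  shows "emeasure (Pi\<^sub>M {1..k} (\<lambda>_. lborel)) {z\<in>space (Pi\<^sub>M {1..k} (\<lambda>_. lborel)). chain_form k z = R} = 0"
    (is "emeasure ?P ?E = _")
proof -
  define V where "V R = unit_ball_vol (real k) * sqrt R ^ k / sqrt (real k + 1)" for R
  have bound: "emeasure ?P ?E \<le> ennreal (V R - V R')" if "0 < R'" "R' < R" for R'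
  proof -
    have V_mono: "V R' \<le> V R"
      unfolding V_def using that by (intro divide_right_mono mult_left_mono power_mono) auto
    have "emeasure ?P ?E + ennreal (V R') =
      emeasure ?P ?E + emeasure ?P {z\<in>space ?P. chain_form k z \<le> R'}"
      using emeasure_chain_form_le[OF \<open>0 < R'\<close>] by (simp add: V_def)
    also have "\<dots> = emeasure ?P (?E \<union> {z\<in>space ?P. chain_form k z \<le> R'})"
      by (rule plus_emeasure) (use that in \<open>auto simp del: One_nat_def\<close>)
    also have "\<dots> \<le> emeasure ?P {z\<in>space ?P. chain_form k z \<le> R}"
      by (rule emeasure_mono) (use that in \<open>auto simp del: One_nat_def\<close>)
    also have "\<dots> = ennreal (V R)" using emeasure_chain_form_le[OF \<open>0 < R\<close>] by (simp add: V_def)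
    also have "\<dots> = ennreal (V R - V R') + ennreal (V R')"
      using V_mono that by (subst ennreal_plus[symmetric]) (auto simp: V_def)
    finally show ?thesis by simp
  qed
  have "((\<lambda>R'. ennreal (V R - V R')) \<longlongrightarrow> ennreal (V R - V R)) (at_left R)"
    unfolding V_def by (intro tendsto_ennrealI tendsto_intros) auto
  moreover have "\<forall>\<^sub>F R' in at_left R. emeasure ?P ?E \<le> ennreal (V R - V R')"
    using eventually_at_left_real[OF assms] by eventually_elim (use bound in auto)
  ultimately have "emeasure ?P ?E \<le> ennreal (V R - V R)" by (rule tendsto_lowerbound) simp
  then show ?thesis by simp
qed

section \<open>Product measures and rotations\<close>

lemma sorted_nth_le_iff:
  fixes zs :: "real list"
  assumes "sorted zs" "i < length zs"
  shows "zs ! i \<le> c \<longleftrightarrow> i < length (filter (\<lambda>x. x \<le> c) zs)" using assms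
proof (induction zs arbitrary: i)
  case (Cons x zs)
  show ?case
  proof (cases "x \<le> c")
    case True
    then show ?thesis using Cons by (cases i) auto
  next
    case False
    then have "filter (\<lambda>x. x \<le> c) zs = []" using Cons.prems(1) by (force simp: filter_empty_conv)
    moreover have "x \<le> (x # zs) ! i" using Cons.prems by (cases i) auto
    ultimately show ?thesis using False by simp
  qed
qed simp

text \<open>The entry at position i of the sorted list is at most c iff more than i of the values
  are, and the number of such values is a finite sum of measurable terms.\<close>

lemma measurable_sort_nth:
  fixes Y :: "'b \<Rightarrow> 'a \<Rightarrow> real"
  assumes Y: "\<And>j. j \<in> set js \<Longrightarrow> Y j \<in> borel_measurable M" and i: "i < length js"
  shows "(\<lambda>\<omega>. sort (map (\<lambda>j. Y j \<omega>) js) ! i) \<in> borel_measurable M"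
proof (rule borel_measurableI_le)
  fix c
  have [measurable]: "Measurable.pred M (\<lambda>\<omega>. Y (js ! k) \<omega> \<le> c)" if "k < length js" for k
    using Y[OF nth_mem[OF that]] by measurable
  have "sort (map (\<lambda>j. Y j \<omega>) js) ! i \<le> c \<longleftrightarrow>
      i < (\<Sum>k<length js. if Y (js ! k) \<omega> \<le> c then 1 else 0)" for \<omega>
  proof -
    let ?xs = "map (\<lambda>j. Y j \<omega>) js"
    have "sort ?xs ! i \<le> c \<longleftrightarrow> i < length (filter (\<lambda>x. x \<le> c) (sort ?xs))"
      using i by (intro sorted_nth_le_iff) auto
    also have "length (filter (\<lambda>x. x \<le> c) (sort ?xs)) = length (filter (\<lambda>x. x \<le> c) ?xs)"
      by (metis mset_filter mset_sort size_mset)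
    also have "\<dots> = card {k. k < length ?xs \<and> ?xs ! k \<le> c}" by (rule length_filter_conv_card)
    also have "{k. k < length ?xs \<and> ?xs ! k \<le> c} = {k\<in>{..<length js}. Y (js ! k) \<omega> \<le> c}" by auto
    also have "card \<dots> = (\<Sum>k<length js. if Y (js ! k) \<omega> \<le> c then 1 else 0)"
      by (simp add: sum.If_cases Int_def)
    finally show ?thesis .
  qed
  moreover have "{\<omega>\<in>space M. i < (\<Sum>k<length js. if Y (js ! k) \<omega> \<le> c then 1 else (0::nat))} \<in> sets M"
  proof -
    have [measurable]: "(\<lambda>\<omega>. \<Sum>k<length js. if Y (js ! k) \<omega> \<le> c then 1 else (0::nat)) \<in> M \<rightarrow>\<^sub>M count_space UNIV"
      by (intro measurable_sum_nat measurable_If measurable_const) (auto intro: predE)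
    show ?thesis by measurable
  qed
  ultimately show "{\<omega>\<in>space M. sort (map (\<lambda>j. Y j \<omega>) js) ! i \<le> c} \<in> sets M" by simp
qed

lemma measurable_side_h:
  fixes Y :: "'b \<Rightarrow> 'a \<Rightarrow> real"
  assumes [measurable]: "f \<in> borel_measurable borel"
    and Y: "\<And>j. j \<in> set js \<Longrightarrow> Y j \<in> borel_measurable M"
  shows "(\<lambda>\<omega>. side_h f (map (\<lambda>j. Y j \<omega>) js)) \<in> borel_measurable M"
proof -
  have nth: "(\<lambda>\<omega>. ([0] @ sort (map (\<lambda>j. Y j \<omega>) js) @ [2*pi]) ! i) \<in> borel_measurable M"
    if "i \<le> length js + 1" for i
  proof -
    consider "i = 0" | k where "i = Suc k" "k < length js" | "i = Suc (length js)"
      using \<open>i \<le> length js + 1\<close> by (cases i) force+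
    then show ?thesis
    proof cases
      case 2
      then show ?thesis using measurable_sort_nth[where js=js and i=k, OF Y] by (simp add: nth_append)
    qed (simp_all add: nth_append)
  qed
  show ?thesis unfolding side_h_def Let_def length_map
    by (intro borel_measurable_sum measurable_compose[OF _ assms(1)] borel_measurable_diff nth) auto
qed

section \<open>Densities and affine maps on finite products\<close>

lemma PiM_density:
  fixes M :: "'i \<Rightarrow> 'a measure"
  assumes I: "finite I" and "\<And>i. sigma_finite_measure (M i)"
    and f: "\<And>i. f i \<in> borel_measurable (M i)"
    and fin: "\<And>i. sigma_finite_measure (density (M i) (f i))"
  shows "PiM I (\<lambda>i. density (M i) (f i)) = density (PiM I M) (\<lambda>x. \<Prod>i\<in>I. f i (x i))"
proof -
  interpret D: product_sigma_finite "\<lambda>i. density (M i) (f i)" by (rule product_sigma_finite.intro) (rule fin)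
  interpret M: product_sigma_finite M by (rule product_sigma_finite.intro) (rule assms(2))
  note f[measurable]
  have sets_eq: "sets (PiM I (\<lambda>i. density (M i) (f i))) = sets (PiM I M)"
    by (intro sets_PiM_cong) auto
  show ?thesis
  proof (rule D.PiM_eqI[OF I, symmetric])
    show "sets (density (PiM I M) (\<lambda>x. \<Prod>i\<in>I. f i (x i))) = sets (PiM I (\<lambda>i. density (M i) (f i)))"
      by (simp add: sets_eq)
    fix A assume "\<And>i. i \<in> I \<Longrightarrow> A i \<in> sets (density (M i) (f i))"
    then have A [measurable]: "\<And>i. i \<in> I \<Longrightarrow> A i \<in> sets (M i)" by simp
    have "emeasure (density (PiM I M) (\<lambda>x. \<Prod>i\<in>I. f i (x i))) (PiE I A)
      = (\<integral>\<^sup>+x. (\<Prod>i\<in>I. f i (x i)) * indicator (PiE I A) x \<partial>PiM I M)"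
    proof (rule emeasure_density)
      show "(\<lambda>x. \<Prod>i\<in>I. f i (x i)) \<in> borel_measurable (PiM I M)" by measurable
      show "PiE I A \<in> sets (PiM I M)" using I A by (rule sets_PiM_I_finite)
    qed
    also have "\<dots> = (\<integral>\<^sup>+x. (\<Prod>i\<in>I. f i (x i) * indicator (A i) (x i)) \<partial>PiM I M)"
    proof (intro nn_integral_cong)
      fix x assume "x \<in> space (PiM I M)"
      then have "indicator (PiE I A) x = (\<Prod>i\<in>I. indicator (A i) (x i) :: ennreal)"
        using I by (auto simp: indicator_def space_PiM PiE_iff prod_zero_iff)
      then show "(\<Prod>i\<in>I. f i (x i)) * indicator (PiE I A) x = (\<Prod>i\<in>I. f i (x i) * indicator (A i) (x i))"
        by (simp add: prod.distrib)
    qed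
    also have "\<dots> = (\<Prod>i\<in>I. \<integral>\<^sup>+x. f i x * indicator (A i) x \<partial>M i)"
      using I by (intro M.product_nn_integral_prod) auto
    also have "\<dots> = (\<Prod>i\<in>I. emeasure (density (M i) (f i)) (A i))"
    proof (intro prod.cong refl)
      fix i assume "i \<in> I"
      then show "(\<integral>\<^sup>+x. f i x * indicator (A i) x \<partial>M i) = emeasure (density (M i) (f i)) (A i)"
        using A[of i] by (simp add: emeasure_density)
    qed
    finally show "emeasure (density (PiM I M) (\<lambda>x. \<Prod>i\<in>I. f i (x i))) (PiE I A) =
      (\<Prod>i\<in>I. emeasure (density (M i) (f i)) (A i))" .
  qed
qed

text \<open>Product measures are determined on boxes, and there every side scales separately, which
  gives one factor \<epsilon> for each coordinate.\<close>

lemma nn_integral_PiM_affine: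
  fixes t :: "'i \<Rightarrow> real"
  assumes I: "finite I" and \<epsilon>: "\<epsilon> > 0" and \<phi>: "\<phi> \<in> borel_measurable (PiM I (\<lambda>_. lborel))"
  shows "(\<integral>\<^sup>+y. \<phi> y \<partial>PiM I (\<lambda>_. lborel)) =
    ennreal (\<epsilon> ^ card I) * (\<integral>\<^sup>+z. \<phi> (\<lambda>j\<in>I. t j + \<epsilon> * z j) \<partial>PiM I (\<lambda>_. lborel))"
proof -
  interpret product_sigma_finite "\<lambda>_::'i. lborel :: real measure" by unfold_locales
  let ?P = "PiM I (\<lambda>_. lborel :: real measure)" and ?T = "\<lambda>z. \<lambda>j\<in>I. t j + \<epsilon> * z j"
  have T: "?T \<in> ?P \<rightarrow>\<^sub>M ?P" by (intro measurable_restrict) measurable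
  have eq: "density (distr ?P ?P ?T) (\<lambda>_. ennreal (\<epsilon> ^ card I)) = ?P"
  proof (rule PiM_eqI[OF I])
    fix A assume "\<And>i. i \<in> I \<Longrightarrow> A i \<in> sets (lborel :: real measure)"
    then have A [measurable]: "\<And>i. i \<in> I \<Longrightarrow> A i \<in> sets borel" by simp
    let ?A' = "\<lambda>i. (\<lambda>x. t i + \<epsilon> * x) -` A i"
    have A': "?A' i \<in> sets lborel" if "i \<in> I" for i
      using measurable_sets[of "\<lambda>x. t i + \<epsilon> * x" borel borel "A i"] A[OF that] by simp
    have E: "PiE I A \<in> sets ?P" using I A by (intro sets_PiM_I_finite) auto
    have "emeasure (density (distr ?P ?P ?T) (\<lambda>_. ennreal (\<epsilon> ^ card I))) (PiE I A) =
        ennreal (\<epsilon> ^ card I) * emeasure (distr ?P ?P ?T) (PiE I A)"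
      using E by (intro emeasure_density_const) simp
    also have "emeasure (distr ?P ?P ?T) (PiE I A) = emeasure ?P (?T -` PiE I A \<inter> space ?P)"
      by (rule emeasure_distr[OF T E])
    also have "?T -` PiE I A \<inter> space ?P = PiE I ?A'" by (auto simp: space_PiM PiE_iff)
    also have "emeasure ?P (PiE I ?A') = (\<Prod>i\<in>I. emeasure lborel (?A' i))"
      using I A' by (rule emeasure_PiM)
    also have "ennreal (\<epsilon> ^ card I) * \<dots> = (\<Prod>i\<in>I. ennreal \<epsilon> * emeasure lborel (?A' i))"
      using \<epsilon> by (simp add: prod.distrib ennreal_power)
    also have "\<dots> = (\<Prod>i\<in>I. emeasure lborel (A i))"
    proof (rule prod.cong[OF refl])
      fix i assume i: "i \<in> I"
      have "emeasure lborel (A i) = \<bar>\<epsilon>\<bar> * (\<integral>\<^sup>+x. indicator (A i) (t i + \<epsilon> * x) \<partial>lborel)"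
        using A[OF i] \<epsilon> nn_integral_real_affine[of "indicator (A i)" \<epsilon> "t i"] by simp
      also have "(\<integral>\<^sup>+x. indicator (A i) (t i + \<epsilon> * x) \<partial>lborel) = (\<integral>\<^sup>+x. indicator (?A' i) x \<partial>lborel)"
        by (intro nn_integral_cong) (simp add: indicator_def)
      finally show "ennreal \<epsilon> * emeasure lborel (?A' i) = emeasure lborel (A i)"
        using A'[OF i] \<epsilon> by simp
    qed
    finally show "emeasure (density (distr ?P ?P ?T) (\<lambda>_. ennreal (\<epsilon> ^ card I))) (PiE I A) =
      (\<Prod>i\<in>I. emeasure lborel (A i))" .
  qed simp
  have "(\<integral>\<^sup>+y. \<phi> y \<partial>?P) = (\<integral>\<^sup>+y. \<phi> y \<partial>density (distr ?P ?P ?T) (\<lambda>_. ennreal (\<epsilon> ^ card I)))"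
    by (simp only: eq)
  also have "\<dots> = (\<integral>\<^sup>+y. ennreal (\<epsilon> ^ card I) * \<phi> y \<partial>distr ?P ?P ?T)"
    using \<phi> by (intro nn_integral_density) simp_all
  also have "\<dots> = ennreal (\<epsilon> ^ card I) * (\<integral>\<^sup>+y. \<phi> y \<partial>distr ?P ?P ?T)"
    using \<phi> by (intro nn_integral_cmult) simp
  also have "(\<integral>\<^sup>+y. \<phi> y \<partial>distr ?P ?P ?T) = (\<integral>\<^sup>+z. \<phi> (?T z) \<partial>?P)"
    using T \<phi> by (intro nn_integral_distr) simp_all
  finally show ?thesis .
qed

text \<open>The counterclockwise angle from \<open>cis x\<close> to \<open>cis z\<close>, for \<open>x\<close> and \<open>z\<close> in \<open>[0, 2 pi)\<close>.\<close>

definition ccw :: "real \<Rightarrow> real \<Rightarrow> real" where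
  "ccw x z = (if x \<le> z then z - x else z - x + 2*pi)"

lemma ccw_measurable [measurable]:
  assumes "X \<in> borel_measurable M" "Z \<in> borel_measurable M"
  shows "(\<lambda>w. ccw (X w) (Z w)) \<in> borel_measurable M" using assms unfolding ccw_def by measurable

lemma ccw_range: "x \<in> {0..<2*pi} \<Longrightarrow> z \<in> {0..<2*pi} \<Longrightarrow> ccw x z \<in> {0..<2*pi}" by (auto simp: ccw_def)

lemma Arg2pi_cis_divide:
  assumes "x \<in> {0..<2*pi}" "z \<in> {0..<2*pi}"
  shows "Arg2pi (cis z / cis x) = ccw x z"
proof -
  have "cis z / cis x = cis (ccw x z)" by (simp add: cis_divide ccw_def cis_mult[symmetric])
  then show ?thesis using ccw_range[OF assms] by (simp add: Arg2pi_cis)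
qed

text \<open>Passes from the integral over the closed period, in terms of which
  \<open>circle_density\<close> is stated, to the Lebesgue integral over the half-open period, on
  which angles are unique; the end point is null.\<close>

lemma nn_integral_period:
  fixes f :: "real \<Rightarrow> real"
  assumes f: "f \<in> borel_measurable borel" "\<And>x. 0 \<le> f x" "(f has_integral r) {0..2*pi}"
  shows "(\<integral>\<^sup>+x. ennreal (f x) * indicator {0..<2*pi} x \<partial>lborel) = ennreal r"
proof -
  have "((\<lambda>x. if x \<in> {0..2*pi} then f x else 0) has_integral r) UNIV"
    using f(3) by (subst has_integral_restrict_UNIV)
  then have "(\<integral>\<^sup>+x. ennreal (if x \<in> {0..2*pi} then f x else 0) \<partial>lborel) = ennreal r"
    using f(1,2) by (intro nn_integral_has_integral_lborel) auto
  moreover have "AE x in lborel. x \<noteq> 2*pi" by (rule AE_lborel_singleton)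
  then have "AE x in lborel. ennreal (f x) * indicator {0..<2*pi} x = ennreal (if x \<in> {0..2*pi} then f x else 0)"
    by eventually_elim (auto simp: indicator_def)
  ultimately show ?thesis by (simp add: nn_integral_cong_AE)
qed

text \<open>Cutting the period at x turns the two branches of \<open>ccw\<close> into translations,
  by - x and by 2 pi - x, and periodicity of p joins the two pieces again.\<close>

lemma nn_integral_ccw:
  fixes p :: "real \<Rightarrow> real"
  assumes [measurable]: "p \<in> borel_measurable borel" "\<phi> \<in> borel_measurable borel"
    and per: "\<And>x. p (x + 2*pi) = p x" and x: "x \<in> {0..<2*pi}"
  shows "(\<integral>\<^sup>+z. ennreal (p z) * indicator {0..<2*pi} z * \<phi> (ccw x z) \<partial>lborel) =
    (\<integral>\<^sup>+y. ennreal (p (x + y)) * indicator {0..<2*pi} y * \<phi> y \<partial>lborel)"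
proof -
  have "(\<integral>\<^sup>+z. ennreal (p z) * indicator {0..<2*pi} z * \<phi> (ccw x z) \<partial>lborel) =
    (\<integral>\<^sup>+z. ennreal (p z) * indicator {x..<2*pi} z * \<phi> (z - x) + ennreal (p z) * indicator {0..<x} z * \<phi> (z - x + 2*pi) \<partial>lborel)"
    using x by (intro nn_integral_cong) (auto simp: ccw_def indicator_def)
  also have "\<dots> = (\<integral>\<^sup>+z. ennreal (p z) * indicator {x..<2*pi} z * \<phi> (z - x) \<partial>lborel)
     + (\<integral>\<^sup>+z. ennreal (p z) * indicator {0..<x} z * \<phi> (z - x + 2*pi) \<partial>lborel)"
    by (intro nn_integral_add) auto
  also have "(\<integral>\<^sup>+z. ennreal (p z) * indicator {x..<2*pi} z * \<phi> (z - x) \<partial>lborel) =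
     (\<integral>\<^sup>+y. ennreal (p (x + y)) * indicator {0..<2*pi - x} y * \<phi> y \<partial>lborel)"
    by (subst nn_integral_real_affine[of _ 1 x]) (auto intro!: nn_integral_cong simp: indicator_def)
  also have "(\<integral>\<^sup>+z. ennreal (p z) * indicator {0..<x} z * \<phi> (z - x + 2*pi) \<partial>lborel) =
     (\<integral>\<^sup>+y. ennreal (p (x + y)) * indicator {2*pi - x..<2*pi} y * \<phi> y \<partial>lborel)"
  proof -
    have "p (x - 2*pi + y) = p (x + y)" for y
      using per[of "x - 2*pi + y"] by (simp add: algebra_simps)
    then show ?thesis
      by (subst nn_integral_real_affine[of _ 1 "x - 2*pi"]) (auto intro!: nn_integral_cong simp: indicator_def)
  qed
  also have "(\<integral>\<^sup>+y. ennreal (p (x + y)) * indicator {0..<2*pi - x} y * \<phi> y \<partial>lborel) +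
     (\<integral>\<^sup>+y. ennreal (p (x + y)) * indicator {2*pi - x..<2*pi} y * \<phi> y \<partial>lborel) =
     (\<integral>\<^sup>+y. ennreal (p (x + y)) * indicator {0..<2*pi - x} y * \<phi> y +
         ennreal (p (x + y)) * indicator {2*pi - x..<2*pi} y * \<phi> y \<partial>lborel)"
    by (intro nn_integral_add[symmetric]) auto
  also have "\<dots> = (\<integral>\<^sup>+y. ennreal (p (x + y)) * indicator {0..<2*pi} y * \<phi> y \<partial>lborel)"
    using x by (intro nn_integral_cong) (auto simp: indicator_def)
  finally show ?thesis .
qed

section \<open>Hits and permutations\<close>

lemma sort_eq_of_mset_eq: "mset xs = mset ys \<Longrightarrow> sort xs = sort ys"
  by (metis mset_sort properties_for_sort sorted_sort)

lemma side_h_mset_cong: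
  assumes "mset xs = mset ys"
  shows "side_h f xs = side_h f ys"
  unfolding side_h_def by (simp only: sort_eq_of_mset_eq[OF assms] mset_eq_length[OF assms])

context side_max
begin

text \<open>\<open>g\<close> is arbitrary outside \<open>[0, 2 pi]\<close>; clamping makes it Borel measurable.\<close>

definition gc :: "real \<Rightarrow> real" where "gc x = g (max 0 (min (2*pi) x))"

lemma gc_measurable [measurable]: "gc \<in> borel_measurable borel"
proof -
  have "continuous_on UNIV gc"
    unfolding gc_def by (rule continuous_on_compose2[OF cont]) (auto intro!: continuous_intros)
  then show ?thesis by (rule borel_measurable_continuous_onI)
qed

lemma side_h_gc:
  assumes "\<And>j. j \<in> {1..<m} \<Longrightarrow> y j \<in> {0..2*pi}"
  shows "side_h gc (map y [1..<m]) = side_h g (map y [1..<m])"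
proof -
  obtain \<beta> p where \<beta>: "\<beta> 0 = 0" "\<beta> m = 2*pi" "\<And>i. i < m \<Longrightarrow> \<beta> i \<le> \<beta> (Suc i)"
    and h: "\<And>f. side_h f (map y [1..<m]) = (\<Sum>i<m. f (\<beta> (Suc i) - \<beta> i))"
    by (rule side_h_gaps[of y]) (erule assms, rule that)
  have "gap_tuple m (\<lambda>i. \<beta> (Suc i) - \<beta> i)"
    using \<beta> by (auto simp: gap_tuple_def sum_lessThan_telescope)
  from gap_tuple_le_2pi[OF this] \<beta>(3) show ?thesis
    unfolding h by (intro sum.cong) (auto simp: gc_def)
qed

abbreviation I :: "nat set" where "I \<equiv> {1..<m}"

lemma I_alt: "I = {1..m - 1}" using m2 by auto

text \<open>y holds the angles of the other m - 1 points as seen from the first, and s is the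
  shortfall allowed from the maximum. \<open>gc\<close> in place of g makes hits measurable.\<close>

definition hit :: "real \<Rightarrow> (nat \<Rightarrow> real) \<Rightarrow> bool" where
  "hit s y \<longleftrightarrow> real m * g a - s \<le> side_h gc (map y [1..<m])"

text \<open>a / 2 is half the distance between neighbouring vertices, so a number is this close to
  at most one multiple of a.\<close>

definition near :: "(nat \<Rightarrow> real) \<Rightarrow> bool" where
  "near y \<longleftrightarrow> (\<forall>j\<in>I. \<bar>y j - a * real j\<bar> < a / 2)"

lemma near_range:
  assumes "j \<in> I" "\<bar>y - a * real j\<bar> < a / 2"
  shows "0 < y" "y < 2*pi"
proof -
  have "real j \<le> real m - 1" "real j \<ge> 1" using assms(1) m2 by auto
  then have "a * real j \<le> a * (real m - 1)" "a * real j \<ge> a * 1"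
    using a_pos by (auto intro!: mult_left_mono)
  moreover have "a * (real m - 1) = 2*pi - a" using ma by (simp add: algebra_simps)
  moreover have "y - a * real j < a / 2" "- (a / 2) < y - a * real j"
    using assms(2) by (simp_all only: abs_less_iff) linarith
  ultimately show "0 < y" "y < 2*pi" using a_pos by linarith+
qed

lemma hit_measurable:
  assumes "\<And>j. j \<in> I \<Longrightarrow> (\<lambda>\<omega>. Y \<omega> j) \<in> borel_measurable M"
  shows "Measurable.pred M (\<lambda>\<omega>. hit s (Y \<omega>))"
proof -
  have [measurable]: "(\<lambda>\<omega>. side_h gc (map (\<lambda>j. Y \<omega> j) [1..<m])) \<in> borel_measurable M"
    using assms by (intro measurable_side_h) auto
  show ?thesis unfolding hit_def by measurable
qed

lemma hit_cong: "(\<And>j. j \<in> I \<Longrightarrow> y j = y' j) \<Longrightarrow> hit s y \<longleftrightarrow> hit s y'"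
proof -
  assume "\<And>j. j \<in> I \<Longrightarrow> y j = y' j"
  then have "map y [1..<m] = map y' [1..<m]" by (intro map_cong) auto
  then show ?thesis by (simp only: hit_def)
qed

lemma hit_permute:
  assumes "q permutes I"
  shows "hit s (\<lambda>j. y (q j)) \<longleftrightarrow> hit s y"
proof -
  have "mset (map q [1..<m]) = image_mset q (mset_set I)" by simp
  also have "\<dots> = mset_set (q ` I)" using permutes_inj_on[OF assms] by (rule image_mset_mset_set)
  also have "q ` I = I" using assms by (rule permutes_image)
  finally have "mset (map y (map q [1..<m])) = mset (map y [1..<m])" by (simp only: mset_map) simp
  then have "side_h gc (map (\<lambda>j. y (q j)) [1..<m]) = side_h gc (map y [1..<m])"
    by (intro side_h_mset_cong) (simp add: comp_def)
  then show ?thesis by (simp add: hit_def)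
qed

text \<open>Packages the constants of the compactness argument for all later estimates.
  \<open>q j\<close> is the number of the vertex close to \<open>y j\<close>; it is only a
  permutation because a hit ignores the order of the points, and the bound a / 2 makes it
  unique.\<close>

definition localizes :: "real \<Rightarrow> real \<Rightarrow> bool" where
  "localizes s0 C \<longleftrightarrow> s0 > 0 \<and> C > 0 \<and> (\<forall>s y. 0 \<le> s \<longrightarrow> s \<le> s0 \<longrightarrow> (\<forall>j\<in>I. y j \<in> {0..2*pi}) \<longrightarrow> hit s y \<longrightarrow>
     C * sqrt s < a / 2 \<and> (\<exists>q. q permutes I \<and> (\<forall>j\<in>I. \<bar>y j - a * real (q j)\<bar> \<le> C * sqrt s)))"

lemma localizesD:
  assumes "localizes s0 C" "0 \<le> s" "s \<le> s0" "\<And>j. j \<in> I \<Longrightarrow> y j \<in> {0..2*pi}" "hit s y"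
  shows "C * sqrt s < a / 2" "\<exists>q. q permutes I \<and> (\<forall>j\<in>I. \<bar>y j - a * real (q j)\<bar> \<le> C * sqrt s)"
  using assms unfolding localizes_def by blast+

lemma ex_localizes: "\<exists>s0 C. localizes s0 C"
proof -
  obtain s0 C where sC: "s0 > 0" "C > 0" "\<And>s \<gamma>. s \<le> s0 \<Longrightarrow> gap_tuple m \<gamma> \<Longrightarrow>
    (\<Sum>i<m. g (\<gamma> i)) \<ge> real m * g a - s \<Longrightarrow> (\<Sum>i<m. (\<gamma> i - a)\<^sup>2) \<le> C * s"
    by (rule gap_sum_near) (rule that)
  \<comment> \<open>Each gap is off by at most sqrt C * sqrt s, and at most m of these errors add up
    along the circle.\<close>
  define c where "c = real m * sqrt C"
  have c: "c > 0" using sC(2) m2 by (simp add: c_def)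
  \<comment> \<open>Forces c * sqrt s \<le> a / 4, safely below a / 2.\<close>
  define s1 where "s1 = min s0 ((a / (4 * c))\<^sup>2)"
  have pos: "s1 > 0" using sC(1) c a_pos by (simp add: s1_def)
  have "c * sqrt s < a / 2 \<and> (\<exists>q. q permutes I \<and> (\<forall>j\<in>I. \<bar>y j - a * real (q j)\<bar> \<le> c * sqrt s))"
    if s: "0 \<le> s" "s \<le> s1" and y: "\<And>j. j \<in> I \<Longrightarrow> y j \<in> {0..2*pi}" and hit: "hit s y" for s y
  proof -
    have "sqrt s \<le> sqrt ((a / (4 * c))\<^sup>2)" using s(2) by (intro real_sqrt_le_mono) (simp add: s1_def)
    then have "sqrt s \<le> a / (4 * c)" using a_pos c by simp
    then have "c * sqrt s \<le> c * (a / (4 * c))" using c by (intro mult_left_mono) auto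
    also have "c * (a / (4 * c)) < a / 2" using c a_pos by simp
    finally have lt: "c * sqrt s < a / 2" .
    obtain \<beta> q where q: "q permutes I" "\<And>j. j \<in> I \<Longrightarrow> y j = \<beta> (q j)"
      and \<beta>: "\<beta> 0 = 0" "\<beta> m = 2*pi" "\<And>i. i < m \<Longrightarrow> \<beta> i \<le> \<beta> (Suc i)"
      and h: "\<And>f. side_h f (map y [1..<m]) = (\<Sum>i<m. f (\<beta> (Suc i) - \<beta> i))"
      by (rule side_h_gaps[of y]) (erule y, rule that)
    define \<gamma> where "\<gamma> i = \<beta> (Suc i) - \<beta> i" for i
    have gt: "gap_tuple m \<gamma>" using \<beta> by (auto simp: gap_tuple_def \<gamma>_def sum_lessThan_telescope)
    have "real m * g a - s \<le> (\<Sum>i<m. g (\<gamma> i))"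
      using hit side_h_gc[of y, OF y] unfolding hit_def h \<gamma>_def by simp
    then have sq: "(\<Sum>i<m. (\<gamma> i - a)\<^sup>2) \<le> C * s"
      using s(2) by (intro sC(3)[OF _ gt]) (simp_all add: s1_def)
    have \<gamma>: "\<bar>\<gamma> i - a\<bar> \<le> sqrt C * sqrt s" if "i < m" for i
    proof -
      have "(\<gamma> i - a)\<^sup>2 \<le> (\<Sum>i<m. (\<gamma> i - a)\<^sup>2)" using that by (intro member_le_sum) auto
      then have "sqrt ((\<gamma> i - a)\<^sup>2) \<le> sqrt (C * s)" using sq by (intro real_sqrt_le_mono) linarith
      then show ?thesis by (simp add: real_sqrt_mult)
    qed
    have \<beta>_near: "\<bar>\<beta> i - a * real i\<bar> \<le> real i * (sqrt C * sqrt s)" if "i \<le> m" for i using that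
    proof (induction i)
      case (Suc i)
      then have "\<bar>\<beta> i - a * real i\<bar> \<le> real i * (sqrt C * sqrt s)" "\<bar>\<gamma> i - a\<bar> \<le> sqrt C * sqrt s"
        using \<gamma>[of i] by auto
      moreover have "\<beta> (Suc i) - a * real (Suc i) = (\<beta> i - a * real i) + (\<gamma> i - a)"
        by (simp add: \<gamma>_def algebra_simps)
      ultimately show ?case by (simp add: algebra_simps)
    qed (simp add: \<beta>)
    have "\<bar>y j - a * real (q j)\<bar> \<le> c * sqrt s" if "j \<in> I" for j
    proof -
      have qj: "q j \<le> m" using permutes_in_image[OF q(1), of j] that by auto
      have "real (q j) * (sqrt C * sqrt s) \<le> c * sqrt s"
        unfolding c_def mult.assoc using qj s(1) sC(2) by (intro mult_right_mono) auto
      then show ?thesis using \<beta>_near[OF qj] q(2)[OF that] by simp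
    qed
    then show ?thesis using q(1) lt by blast
  qed
  then have "localizes s1 c" using pos c unfolding localizes_def by blast
  then show ?thesis by blast
qed

text \<open>For a configuration \<open>z\<close> pinned to \<open>0\<close> at both ends, the points \<open>a j + \<epsilon> z j\<close> have the gaps
  \<open>a + \<epsilon> * gap_dev z i\<close>.\<close>

definition gap_dev :: "(nat \<Rightarrow> real) \<Rightarrow> nat \<Rightarrow> real" where
  "gap_dev z i = (if Suc i \<in> I then z (Suc i) else 0) - (if i \<in> I then z i else 0)"

lemma sum_gap_dev: "(\<Sum>i<m. gap_dev z i) = 0"
  unfolding gap_dev_def by (subst sum_lessThan_telescope) auto

lemma sum_gap_dev_sq: "(\<Sum>i<m. (gap_dev z i)\<^sup>2) = chain_form (m - 1) z"
proof -
  obtain k where k: "m = Suc k" "k \<ge> 1" using m2 by (cases m) auto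
  have dev: "gap_dev z i = z (Suc i) - (if Suc i = 1 then 0 else z i)" if "i < k" for i
    unfolding gap_dev_def using that k by auto
  have dev_k: "gap_dev z k = 0 - z k" unfolding gap_dev_def using k by auto
  have "(\<Sum>i<m. (gap_dev z i)\<^sup>2) = (\<Sum>i<k. (gap_dev z i)\<^sup>2) + (gap_dev z k)\<^sup>2"
    by (simp only: k(1) sum.lessThan_Suc)
  also have "(\<Sum>i<k. (gap_dev z i)\<^sup>2) = (\<Sum>i\<in>Suc ` {..<k}. (z i - (if i = 1 then 0 else z (i - 1)))\<^sup>2)"
    by (subst sum.reindex) (auto intro!: sum.cong simp: dev)
  also have "Suc ` {..<k} = {1..k}" by (simp add: image_Suc_lessThan)
  moreover have "m - 1 = k" "k \<noteq> 0" using k by auto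
  ultimately show ?thesis by (simp add: chain_form_def dev_k)
qed

text \<open>Displacements below a / 2 keep the points in the order of the vertices, so sorting
  changes nothing and the gaps are affine in z.\<close>

lemma hit_scaled_iff:
  assumes \<epsilon>: "\<epsilon> > 0" and z: "\<And>j. j \<in> I \<Longrightarrow> \<bar>\<epsilon> * z j\<bar> < a / 2"
  shows "hit (\<epsilon>\<^sup>2) (\<lambda>j. a * real j + \<epsilon> * z j) \<longleftrightarrow>
    (real m * g a - (\<Sum>i<m. g (a + \<epsilon> * gap_dev z i))) / \<epsilon>\<^sup>2 \<le> 1"
proof -
  define \<beta> where "\<beta> i = a * real i + \<epsilon> * (if i \<in> I then z i else 0)" for i
  have dev: "\<beta> (Suc i) - \<beta> i = a + \<epsilon> * gap_dev z i" for i
    by (simp add: \<beta>_def gap_dev_def algebra_simps)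
  have small: "\<bar>\<epsilon> * (if i \<in> I then z i else 0)\<bar> < a / 2" for i
    using z[of i] a_pos by (cases "i \<in> I") auto
  have "\<bar>\<epsilon> * gap_dev z i\<bar> < a" for i
    using small[of i] small[of "Suc i"] unfolding gap_dev_def by (auto simp: right_diff_distrib)
  then have pos: "0 \<le> a + \<epsilon> * gap_dev z i" for i by (smt (verit, best))
  have gt: "gap_tuple m (\<lambda>i. a + \<epsilon> * gap_dev z i)"
    using pos sum_gap_dev[of z] ma by (simp add: gap_tuple_def sum.distrib sum_distrib_left[symmetric])
  have "side_h gc (map (\<lambda>j. a * real j + \<epsilon> * z j) [1..<m]) = side_h gc (map \<beta> [1..<m])"
    by (intro arg_cong[where f="side_h gc"] map_cong) (auto simp: \<beta>_def)
  also have "\<dots> = (\<Sum>i<m. gc (\<beta> (Suc i) - \<beta> i))"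
  proof (rule side_h_mono)
    show "\<beta> i \<le> \<beta> (Suc i)" for i using dev[of i] pos[of i] by simp
  qed (use m2 ma in \<open>auto simp: \<beta>_def mult.commute\<close>)
  also have "\<dots> = (\<Sum>i<m. g (a + \<epsilon> * gap_dev z i))"
    using gap_tuple_le_2pi[OF gt] pos by (intro sum.cong refl) (auto simp: dev gc_def)
  finally show ?thesis using \<epsilon> by (simp add: hit_def divide_le_eq field_simps)
qed

end

section \<open>Angular laws and labellings of hits\<close>

locale side_max_density = side_max +
  fixes p :: "real \<Rightarrow> real"
  assumes dens: "circle_density p" and p_cont: "continuous_on UNIV p"
begin

lemma p_nonneg: "0 \<le> p x" and p_periodic: "p (x + 2*pi) = p x"
  and p_int: "(p has_integral 1) {0..2*pi}" using dens by (auto simp: circle_density_def)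

lemma p_measurable [measurable]: "p \<in> borel_measurable borel"
  using p_cont by (rule borel_measurable_continuous_onI)

text \<open>The range extends to 4 pi because p is evaluated at x + y with both angles below 2
  pi.\<close>

definition B :: real where "B = (SUP x\<in>{0..4*pi}. p x)"

lemma p_le_B: "0 \<le> x \<Longrightarrow> x \<le> 4*pi \<Longrightarrow> p x \<le> B"
proof -
  have "compact (p ` {0..4*pi})"
    by (intro compact_continuous_image continuous_on_subset[OF p_cont]) auto
  then have "bdd_above (p ` {0..4*pi})" by (intro bounded_imp_bdd_above compact_imp_bounded)
  then show "0 \<le> x \<Longrightarrow> x \<le> 4*pi \<Longrightarrow> p x \<le> B" unfolding B_def by (intro cSUP_upper) auto
qed

lemma B_nonneg: "0 \<le> B" using p_le_B[of 0] p_nonneg[of 0] by simp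

definition D :: "real measure" where
  "D = density lborel (\<lambda>y. ennreal (p y) * indicator {0..<2*pi} y)"

text \<open>For x in [0, 2 pi), the law of the counterclockwise angle from x to a point with law D,
  by \<open>distr_ccw\<close>.\<close>

definition Dx :: "real \<Rightarrow> real measure" where
  "Dx x = density lborel (\<lambda>y. ennreal (p (x + y)) * indicator {0..<2*pi} y)"

lemma sets_D [measurable_cong, simp]: "sets D = sets borel" and sets_Dx [measurable_cong, simp]: "sets (Dx x) = sets borel"
  and space_D [simp]: "space D = UNIV" and space_Dx [simp]: "space (Dx x) = UNIV"
  by (simp_all add: D_def Dx_def)

lemma prob_D: "prob_space D" unfolding D_def by (rule prob_spaceI)
    (simp add: emeasure_density nn_integral_period[OF p_measurable p_nonneg p_int])

lemma nn_integral_D: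
  assumes [measurable]: "f \<in> borel_measurable borel"
  shows "(\<integral>\<^sup>+x. f x \<partial>D) = (\<integral>\<^sup>+x. ennreal (p x) * indicator {0..<2*pi} x * f x \<partial>lborel)"
  unfolding D_def by (simp add: nn_integral_density)

lemma AE_D: "AE x in D. x \<in> {0..<2*pi}"
  unfolding D_def by (subst AE_density) (auto simp: indicator_def)

lemma AE_Dx: "AE y in Dx x. y \<in> {0..<2*pi}"
  unfolding Dx_def by (subst AE_density) (auto simp: indicator_def)

lemma distr_ccw:
  assumes "x \<in> {0..<2*pi}"
  shows "distr D (Dx x) (ccw x) = Dx x"
proof (rule measure_eqI)
  fix A assume "A \<in> sets (distr D (Dx x) (ccw x))"
  then have [measurable]: "A \<in> sets borel" by simp
  have "emeasure (distr D (Dx x) (ccw x)) A = (\<integral>\<^sup>+z. indicator A (ccw x z) \<partial>D)"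
  proof -
    have "(\<integral>\<^sup>+z. indicator A (ccw x z) \<partial>D) = (\<integral>\<^sup>+y. indicator A y \<partial>distr D (Dx x) (ccw x))"
      by (rule nn_integral_distr[symmetric]) measurable
    then show ?thesis by simp
  qed
  also have "\<dots> = (\<integral>\<^sup>+z. ennreal (p z) * indicator {0..<2*pi} z * indicator A (ccw x z) \<partial>lborel)"
    by (rule nn_integral_D) measurable
  also have "\<dots> = (\<integral>\<^sup>+y. ennreal (p (x + y)) * indicator {0..<2*pi} y * indicator A y \<partial>lborel)"
    using assms by (intro nn_integral_ccw p_periodic) auto
  also have "\<dots> = emeasure (Dx x) A" unfolding Dx_def by (simp add: emeasure_density)
  finally show "emeasure (distr D (Dx x) (ccw x)) A = emeasure (Dx x) A" .
qed simp

lemma prob_Dx: "x \<in> {0..<2*pi} \<Longrightarrow> prob_space (Dx x)"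
  using prob_space.prob_space_distr[OF prob_D, of "ccw x" "Dx x"] distr_ccw by simp

abbreviation PD :: "real \<Rightarrow> (nat \<Rightarrow> real) measure" where "PD x \<equiv> PiM I (\<lambda>_. Dx x)"

lemma distr_PiM_ccw:
  assumes "x \<in> {0..<2*pi}"
  shows "distr (PiM I (\<lambda>_. D)) (PD x) (compose I (ccw x)) = PD x"
  using assms by (subst distr_PiM_finite_prob_space') (auto simp: prob_D prob_Dx distr_ccw)

text \<open>A hit determines which of its points is close to \<open>a j\<close>, so the set of hits splits into \<open>(m - 1)!\<close>
  congruent pieces, one for each labelling of the vertices.\<close>

lemma emeasure_hit_eq_near:
  assumes loc: "localizes s0 C" and s: "0 \<le> s" "s \<le> s0" and x: "x \<in> {0..<2*pi}"
  shows "emeasure (PD x) {y\<in>space (PD x). hit s y} =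
    ennreal (fact (m - 1)) * emeasure (PD x) {y\<in>space (PD x). hit s y \<and> near y}"
proof -
  interpret Dx: prob_space "Dx x" using x by (rule prob_Dx)
  let ?P = "PD x"
  define F where "F q = {y\<in>space ?P. hit s y \<and> (\<forall>j\<in>I. \<bar>y j - a * real (q j)\<bar> < a / 2)}" for q :: "nat \<Rightarrow> nat"
  have [measurable]: "Measurable.pred ?P (\<lambda>y. hit s y)" by (rule hit_measurable) simp
  have F_sets [measurable]: "F q \<in> sets ?P" for q unfolding F_def by measurable
  have "emeasure ?P {y\<in>space ?P. hit s y} = emeasure ?P (\<Union>q\<in>{q. q permutes I}. F q)"
  proof (rule emeasure_eq_AE)
    \<comment> \<open>\<open>localizes\<close> speaks of angles in [0, 2 pi], while the product
      space contains all real tuples; the remaining ones have measure 0.\<close>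
    have "AE y in ?P. \<forall>j\<in>I. y j \<in> {0..<2*pi}"
      by (intro AE_finite_allI AE_PiM_component AE_Dx) (auto simp: Dx.prob_space_axioms)
    then show "AE y in ?P. y \<in> {y \<in> space ?P. hit s y} \<longleftrightarrow> y \<in> (\<Union>q\<in>{q. q permutes I}. F q)"
    proof (rule AE_mp, intro AE_I2 impI)
      fix y assume y: "y \<in> space ?P" "\<forall>j\<in>I. y j \<in> {0..<2*pi}"
      have y': "y j \<in> {0..2*pi}" if "j \<in> I" for j using y(2) that by force
      show "y \<in> {y \<in> space ?P. hit s y} \<longleftrightarrow> y \<in> (\<Union>q\<in>{q. q permutes I}. F q)"
        using localizesD[OF loc s y'] y(1) unfolding F_def by fastforce
    qed
    show "{y\<in>space ?P. hit s y} \<in> sets ?P" by measurable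
    show "(\<Union>q\<in>{q. q permutes I}. F q) \<in> sets ?P"
      by (intro sets.finite_UN finite_permutations F_sets) simp
  qed
  also have "\<dots> = (\<Sum>q\<in>{q. q permutes I}. emeasure ?P (F q))"
  proof (rule sum_emeasure[symmetric])
    show "disjoint_family_on F {q. q permutes I}" unfolding disjoint_family_on_def
    proof (intro ballI impI)
      fix q q' assume q: "q \<in> {q. q permutes I}" "q' \<in> {q. q permutes I}" "q \<noteq> q'"
      show "F q \<inter> F q' = {}"
      proof (rule ccontr)
        assume "F q \<inter> F q' \<noteq> {}"
        then obtain y where "y \<in> F q" "y \<in> F q'" by blast
        then have y: "\<bar>y j - a * real (q j)\<bar> < a / 2" "\<bar>y j - a * real (q' j)\<bar> < a / 2" if "j \<in> I" for j
          using that unfolding F_def by blast+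
        have "q j = q' j" for j
        proof (cases "j \<in> I")
          case True
          \<comment> \<open>Two labels for one point would put different vertices at a distance
            below a.\<close>
          have "\<bar>a * (real (q j) - real (q' j))\<bar> < a"
            using y[OF True] by (simp add: right_diff_distrib) (smt (verit))
          then have "\<bar>real (q j) - real (q' j)\<bar> < 1" using a_pos by (simp add: abs_mult)
          then show ?thesis by linarith
        next
          case False
          then show ?thesis using q by (simp add: permutes_not_in)
        qed
        then show False using q(3) by auto
      qed
    qed
  qed (use F_sets in \<open>auto simp: finite_permutations simp del: One_nat_def\<close>)
  also have "\<dots> = (\<Sum>q\<in>{q. q permutes I}. emeasure ?P (F id))"
  proof (intro sum.cong refl)
    fix q assume "q \<in> {q. q permutes I}"
    then have q: "q permutes I" by simp
    \<comment> \<open>The coordinates are independent with a common law, so permuting them by q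
      preserves the measure; it identifies the piece \<open>F q\<close> with
      \<open>F id\<close>.\<close>
    let ?T = "\<lambda>\<omega>. \<lambda>n\<in>I. \<omega> (q n)"
    have T: "?T \<in> ?P \<rightarrow>\<^sub>M ?P"
      using permutes_in_image[OF q] by (intro measurable_restrict measurable_component_singleton) auto
    have "distr ?P ?P ?T = ?P"
      using distr_PiM_reindex[of I "\<lambda>_. Dx x" q I] permutes_in_image[OF q] permutes_inj_on[OF q]
      by (auto simp: Dx.prob_space_axioms)
    then have "emeasure ?P (F q) = emeasure (distr ?P ?P ?T) (F q)" by simp
    also have "\<dots> = emeasure ?P (?T -` F q \<inter> space ?P)" by (rule emeasure_distr[OF T]) measurable
    also have "?T -` F q \<inter> space ?P = F id"
    proof -
      have "?T y \<in> F q \<longleftrightarrow> y \<in> F id" if y: "y \<in> space ?P" for y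
      proof -
        have "?T y \<in> space ?P" using measurable_space[OF T y] .
        moreover have "hit s (?T y) \<longleftrightarrow> hit s y"
          using hit_permute[OF q, of s y] hit_cong[of "?T y" "\<lambda>j. y (q j)" s] by simp
        moreover have "(\<forall>j\<in>I. \<bar>?T y j - a * real (q j)\<bar> < a / 2) \<longleftrightarrow> (\<forall>j\<in>q ` I. \<bar>y j - a * real j\<bar> < a / 2)"
          by simp
        ultimately show ?thesis using y unfolding F_def permutes_image[OF q] by simp
      qed
      then show ?thesis unfolding F_def by auto
    qed
    finally show "emeasure ?P (F q) = emeasure ?P (F id)" .
  qed
  also have "\<dots> = of_nat (fact (m - 1)) * emeasure ?P (F id)"
  proof -
    have "card {q. q permutes I} = fact (m - 1)" by (rule card_permutations) auto
    then show ?thesis by (simp only: sum_constant)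
  qed
  also have "of_nat (fact (m - 1)) = ennreal (fact (m - 1))"
    by (metis ennreal_of_nat_eq_real_of_nat of_nat_fact)
  finally show ?thesis by (simp add: F_def near_def)
qed

text \<open>The permutation from \<open>localizes\<close> must be the identity here, since
  \<open>y j\<close> is within a / 2 of vertex j by \<open>near\<close> and of vertex
  \<open>q j\<close> by localization. Thus the distance a / 2 improves to order sqrt s.\<close>

lemma near_hit_bound:
  assumes loc: "localizes s0 C" and s: "0 \<le> s" "s \<le> s0" and ny: "near y" and hit: "hit s y"
  shows "\<forall>j\<in>I. \<bar>y j - a * real j\<bar> \<le> C * sqrt s"
proof -
  have near: "\<bar>y j - a * real j\<bar> < a / 2" if "j \<in> I" for j using ny that by (simp add: near_def)
  have y: "y j \<in> {0..2*pi}" if "j \<in> I" for j using near_range[OF that near[OF that]] by simp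
  have lt: "C * sqrt s < a / 2" by (rule localizesD(1)[OF loc s y hit])
  obtain q where q: "\<And>j. j \<in> I \<Longrightarrow> \<bar>y j - a * real (q j)\<bar> \<le> C * sqrt s"
    using localizesD(2)[OF loc s y hit] by blast
  show "\<forall>j\<in>I. \<bar>y j - a * real j\<bar> \<le> C * sqrt s"
  proof
    fix j assume j: "j \<in> I"
    have "\<bar>a * real (q j) - a * real j\<bar> < a" using q[OF j] lt near[OF j] by linarith
    then have "\<bar>a * (real (q j) - real j)\<bar> < a" by (simp add: right_diff_distrib)
    then have "\<bar>real (q j) - real j\<bar> < 1" using a_pos by (simp add: abs_mult)
    then have "q j = j" by linarith
    then show "\<bar>y j - a * real j\<bar> \<le> C * sqrt s" using q[OF j] by simp
  qed
qed

subsection \<open>Probability of a hit\<close>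

abbreviation "P \<equiv> PiM I (\<lambda>_. lborel :: real measure)"

definition zoom :: "real \<Rightarrow> (nat \<Rightarrow> real) \<Rightarrow> nat \<Rightarrow> real" where
  "zoom \<epsilon> z = (\<lambda>j\<in>I. a * real j + \<epsilon> * z j)"

text \<open>The density of the near hits in the rescaled coordinates \<open>z\<close>, when the first point is \<open>x\<close>.\<close>

definition wt :: "real \<Rightarrow> real \<Rightarrow> (nat \<Rightarrow> real) \<Rightarrow> ennreal" where
  "wt x \<epsilon> z = ennreal (\<Prod>j\<in>I. p (x + (a * real j + \<epsilon> * z j))) *
     indicator {z. hit (\<epsilon>\<^sup>2) (zoom \<epsilon> z) \<and> near (zoom \<epsilon> z)} z"

lemma hit_pred [measurable]: "Measurable.pred P (\<lambda>y. hit s y)" by (rule hit_measurable) simp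

lemma near_pred [measurable]: "Measurable.pred P near" unfolding near_def by measurable

lemma zoom_measurable [measurable]: "zoom \<epsilon> \<in> P \<rightarrow>\<^sub>M P"
  unfolding zoom_def by (intro measurable_restrict) measurable

lemma hit_zoom_measurable [measurable]: "Measurable.pred P (\<lambda>z. hit s (zoom \<epsilon> z) \<and> near (zoom \<epsilon> z))"
  by measurable

lemma wt_measurable [measurable]:
  "(\<lambda>(x, z). wt x \<epsilon> z) \<in> borel_measurable (borel \<Otimes>\<^sub>M P)"
  "wt x \<epsilon> \<in> borel_measurable P"
proof -
  have 1: "(\<lambda>w. indicator {z. hit (\<epsilon>\<^sup>2) (zoom \<epsilon> z) \<and> near (zoom \<epsilon> z)} (snd w) :: ennreal)
     \<in> borel_measurable (borel \<Otimes>\<^sub>M P)" unfolding indicator_def by measurable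
  have 2: "(\<lambda>w. ennreal (\<Prod>j\<in>I. p (fst w + (a * real j + \<epsilon> * snd w j)))) \<in> borel_measurable (borel \<Otimes>\<^sub>M P)"
    by (intro measurable_compose[OF _ measurable_ennreal] borel_measurable_prod measurable_compose[OF _ p_measurable]) measurable
  show *: "(\<lambda>(x, z). wt x \<epsilon> z) \<in> borel_measurable (borel \<Otimes>\<^sub>M P)"
    unfolding wt_def split_beta' by (intro borel_measurable_times_ennreal 1 2)
  have "(\<lambda>z. (x, z)) \<in> P \<rightarrow>\<^sub>M borel \<Otimes>\<^sub>M P" by measurable
  from measurable_compose[OF this *] show "wt x \<epsilon> \<in> borel_measurable P" by simp
qed

lemma emeasure_near_hit:
  assumes x: "x \<in> {0..<2*pi}" and \<epsilon>: "\<epsilon> > 0"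
  shows "emeasure (PD x) {y\<in>space (PD x). hit (\<epsilon>\<^sup>2) y \<and> near y} =
    ennreal (\<epsilon> ^ (m - 1)) * (\<integral>\<^sup>+z. wt x \<epsilon> z \<partial>P)"
proof -
  define f where "f y = ennreal (p (x + y)) * indicator {0..<2*pi} y" for y
  have f_meas [measurable]: "f \<in> borel_measurable lborel" unfolding f_def by measurable
  interpret Dx: prob_space "Dx x" using x by (rule prob_Dx)
  have eq: "PD x = density P (\<lambda>y. \<Prod>j\<in>I. f (y j))" unfolding Dx_def f_def[symmetric]
    by (rule PiM_density) (use Dx.sigma_finite_measure_axioms in \<open>auto simp: Dx_def f_def[abs_def] sigma_finite_lborel\<close>)
  let ?E = "{y\<in>space P. hit (\<epsilon>\<^sup>2) y \<and> near y}"
  have E: "?E \<in> sets P" by measurable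
  have fm: "(\<lambda>y. \<Prod>j\<in>I. f (y j)) \<in> borel_measurable P"
    by (intro borel_measurable_prod_ennreal measurable_compose[OF _ f_meas]) measurable
  have "emeasure (PD x) {y\<in>space (PD x). hit (\<epsilon>\<^sup>2) y \<and> near y} =
      (\<integral>\<^sup>+y. (\<Prod>j\<in>I. f (y j)) * indicator ?E y \<partial>P)"
    unfolding eq space_density by (rule emeasure_density[OF fm E])
  also have "\<dots> = ennreal (\<epsilon> ^ card I) *
     (\<integral>\<^sup>+z. (\<Prod>j\<in>I. f ((\<lambda>j\<in>I. a * real j + \<epsilon> * z j) j)) * indicator ?E (\<lambda>j\<in>I. a * real j + \<epsilon> * z j) \<partial>P)"
    by (rule nn_integral_PiM_affine) (use \<epsilon> fm E in \<open>auto intro!: borel_measurable_times_ennreal borel_measurable_indicator\<close>)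
  also have "(\<integral>\<^sup>+z. (\<Prod>j\<in>I. f ((\<lambda>j\<in>I. a * real j + \<epsilon> * z j) j)) * indicator ?E (\<lambda>j\<in>I. a * real j + \<epsilon> * z j) \<partial>P) =
     (\<integral>\<^sup>+z. wt x \<epsilon> z \<partial>P)"
  proof (rule nn_integral_cong)
    fix z assume z: "z \<in> space P"
    then have sp: "zoom \<epsilon> z \<in> space P" using measurable_space[OF zoom_measurable] by blast
    show "(\<Prod>j\<in>I. f ((\<lambda>j\<in>I. a * real j + \<epsilon> * z j) j)) * indicator ?E (\<lambda>j\<in>I. a * real j + \<epsilon> * z j) = wt x \<epsilon> z"
      unfolding zoom_def[symmetric]
    proof (cases "hit (\<epsilon>\<^sup>2) (zoom \<epsilon> z) \<and> near (zoom \<epsilon> z)")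
      case True
      \<comment> \<open>Near tuples lie inside the open period, so the indicator in f equals
        1.\<close>
      have "(\<Prod>j\<in>I. f (zoom \<epsilon> z j)) = (\<Prod>j\<in>I. ennreal (p (x + (a * real j + \<epsilon> * z j))))"
      proof (rule prod.cong[OF refl])
        fix j assume j: "j \<in> I"
        then have "\<bar>zoom \<epsilon> z j - a * real j\<bar> < a / 2" using True by (simp add: near_def)
        from near_range[OF j this] j show "f (zoom \<epsilon> z j) = ennreal (p (x + (a * real j + \<epsilon> * z j)))"
          by (simp add: f_def zoom_def)
      qed
      also have "\<dots> = ennreal (\<Prod>j\<in>I. p (x + (a * real j + \<epsilon> * z j)))"
        by (rule prod_ennreal) (simp add: p_nonneg)
      finally show "(\<Prod>j\<in>I. f (zoom \<epsilon> z j)) * indicator ?E (zoom \<epsilon> z) = wt x \<epsilon> z"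
        using True sp by (simp add: wt_def)
    next
      case False
      then show "(\<Prod>j\<in>I. f (zoom \<epsilon> z j)) * indicator ?E (zoom \<epsilon> z) = wt x \<epsilon> z"
        by (auto simp: wt_def)
    qed
  qed
  finally show ?thesis by simp
qed

text \<open>The scaled deficit tends to \<open>curv * chain_form (m - 1) z\<close>. If this limit is
  not 1, the deficit finally stays on one side of the threshold and the indicator is constant; at
  the value 1 the side may keep changing, hence \<open>ne\<close>.\<close>

lemma wt_limit:
  assumes \<epsilon>: "\<And>n. \<epsilon> n > 0" "\<epsilon> \<longlonglongrightarrow> 0" and ne: "chain_form (m - 1) z \<noteq> 1 / curv"
  shows "(\<lambda>n. wt x (\<epsilon> n) z) \<longlonglongrightarrow>
    ennreal (\<Prod>j\<in>I. p (x + a * real j)) * indicator {z. chain_form (m - 1) z \<le> 1 / curv} z"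
proof -
  have lim_p: "(\<lambda>n. ennreal (\<Prod>j\<in>I. p (x + (a * real j + \<epsilon> n * z j)))) \<longlonglongrightarrow> ennreal (\<Prod>j\<in>I. p (x + a * real j))"
  proof (intro tendsto_ennrealI tendsto_prod)
    fix j
    have "(\<lambda>n. x + (a * real j + \<epsilon> n * z j)) \<longlonglongrightarrow> x + (a * real j + 0 * z j)"
      by (intro tendsto_intros \<epsilon>(2))
    then show "(\<lambda>n. p (x + (a * real j + \<epsilon> n * z j))) \<longlonglongrightarrow> p (x + a * real j)"
      using p_cont by (intro isCont_tendsto_compose[of _ p]) (auto simp: continuous_on_eq_continuous_at)
  qed
  have ev_near: "\<forall>\<^sub>F n in sequentially. \<forall>j\<in>I. \<bar>\<epsilon> n * z j\<bar> < a / 2"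
  proof (intro eventually_ball_finite ballI)
    fix j
    have "(\<lambda>n. \<bar>\<epsilon> n * z j\<bar>) \<longlonglongrightarrow> \<bar>0 * z j\<bar>" by (intro tendsto_intros \<epsilon>(2))
    then show "\<forall>\<^sub>F n in sequentially. \<bar>\<epsilon> n * z j\<bar> < a / 2"
      using a_pos by (intro order_tendstoD(2)) auto
  qed simp
  define r where "r n = (real m * g a - (\<Sum>i<m. g (a + \<epsilon> n * gap_dev z i))) / (\<epsilon> n)\<^sup>2" for n
  have "filterlim \<epsilon> (at 0) sequentially"
    using \<epsilon> by (intro filterlim_atI) (auto intro!: always_eventually simp: less_imp_neq[symmetric])
  then have r_lim: "r \<longlonglongrightarrow> curv * chain_form (m - 1) z"
    using filterlim_compose[OF gap_sum_scaled[OF sum_gap_dev[of z]]] unfolding r_def sum_gap_dev_sq by blast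
  have ne': "curv * chain_form (m - 1) z \<noteq> 1" using ne curv_pos by (auto simp: field_simps)
  have ev_r: "\<forall>\<^sub>F n in sequentially. r n \<le> 1 \<longleftrightarrow> chain_form (m - 1) z \<le> 1 / curv"
  proof (cases "curv * chain_form (m - 1) z < 1")
    case True
    then have "chain_form (m - 1) z \<le> 1 / curv" using curv_pos by (simp add: field_simps)
    with order_tendstoD(2)[OF r_lim True] show ?thesis by (auto elim: eventually_mono)
  next
    case False
    then have gt: "curv * chain_form (m - 1) z > 1" using ne' by simp
    then have "\<not> chain_form (m - 1) z \<le> 1 / curv" using curv_pos by (simp add: field_simps)
    with order_tendstoD(1)[OF r_lim gt] show ?thesis by (auto elim: eventually_mono)
  qed
  have ev: "\<forall>\<^sub>F n in sequentially. wt x (\<epsilon> n) z = ennreal (\<Prod>j\<in>I. p (x + (a * real j + \<epsilon> n * z j))) *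
      indicator {z. chain_form (m - 1) z \<le> 1 / curv} z" using ev_near ev_r
  proof eventually_elim
    case (elim n)
    have "near (zoom (\<epsilon> n) z)" using elim(1) by (auto simp: near_def zoom_def)
    moreover have "hit ((\<epsilon> n)\<^sup>2) (zoom (\<epsilon> n) z) \<longleftrightarrow> r n \<le> 1"
      using hit_scaled_iff[of "\<epsilon> n" z, OF \<epsilon>(1)] elim(1)
        hit_cong[of "zoom (\<epsilon> n) z" "\<lambda>j. a * real j + \<epsilon> n * z j"] by (simp add: zoom_def r_def)
    ultimately show ?case using elim(2) by (simp add: wt_def indicator_def)
  qed
  show ?thesis
  proof (cases "chain_form (m - 1) z \<le> 1 / curv")
    case True
    have "(\<lambda>n. wt x (\<epsilon> n) z) \<longlonglongrightarrow> ennreal (\<Prod>j\<in>I. p (x + a * real j))"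
      using ev True by (intro Lim_transform_eventually[OF lim_p]) (auto elim: eventually_mono)
    then show ?thesis using True by simp
  next
    case False
    have "(\<lambda>n. wt x (\<epsilon> n) z) \<longlonglongrightarrow> 0"
      using ev False by (intro Lim_transform_eventually[OF tendsto_const]) (auto elim: eventually_mono)
    then show ?thesis using False by simp
  qed
qed

text \<open>The volume of the limiting ellipsoid, by \<open>emeasure_V\<close>: a ball of radius 1 /
  sqrt curv, divided by the square root of the determinant m of
  \<open>chain_form (m - 1)\<close>.\<close>

definition V :: real where
  "V = unit_ball_vol (real (m - 1)) * sqrt (1 / curv) ^ (m - 1) / sqrt (real m)"

lemma V_nonneg: "V \<ge> 0" unfolding V_def using curv_pos by simp

lemma emeasure_V: "emeasure P {z\<in>space P. chain_form (m - 1) z \<le> 1 / curv} = ennreal V"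
proof -
  have "real (m - 1) + 1 = real m" using m2 by simp
  then show ?thesis using emeasure_chain_form_le[of "1 / curv" "m - 1"] curv_pos
    unfolding I_alt[symmetric] V_def by simp
qed

lemma chain_form_meas [measurable]: "chain_form (m - 1) \<in> borel_measurable P"
  using measurable_chain_form[of "m - 1"] unfolding I_alt[symmetric] .

lemma AE_chain_form: "AE z in P. chain_form (m - 1) z \<noteq> 1 / curv"
proof (rule AE_I)
  show "{z \<in> space P. \<not> chain_form (m - 1) z \<noteq> 1 / curv} \<subseteq> {z \<in> space P. chain_form (m - 1) z = 1 / curv}" by auto
  show "emeasure P {z \<in> space P. chain_form (m - 1) z = 1 / curv} = 0"
    using emeasure_chain_form_eq[of "1 / curv" "m - 1"] curv_pos unfolding I_alt[symmetric] by simp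
  show "{z \<in> space P. chain_form (m - 1) z = 1 / curv} \<in> sets P" by measurable
qed

definition overlap :: real where
  "overlap = integral {0..2*pi} (\<lambda>x. \<Prod>l<m. p (x + 2*pi * real l / real m))"

lemma overlap_has_integral: "((\<lambda>x. \<Prod>l<m. p (x + a * real l)) has_integral overlap) {0..2*pi}"
proof -
  have "continuous_on {0..2*pi} (\<lambda>x. \<Prod>l<m. p (x + a * real l))"
    by (intro continuous_on_prod continuous_on_compose2[OF p_cont] continuous_intros) auto
  then show ?thesis
    unfolding overlap_def using integrable_integral[OF integrable_continuous_interval]
    by (fastforce simp: a_def)
qed

lemma overlap_nonneg: "0 \<le> overlap"
  using overlap_has_integral by (rule has_integral_nonneg) (simp add: prod_nonneg p_nonneg)

lemma emeasure_D_UNIV: "emeasure D UNIV = 1" using prob_space.emeasure_space_1[OF prob_D] by simp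

text \<open>Dominated convergence, for the inner and then for the outer integral. By
  \<open>near_hit_bound\<close> a near hit at scale \<epsilon> is displaced by at most C \<epsilon>,
  so after rescaling all weight lies in the box with sides [-C, C], independent of n and x.\<close>

lemma wt_integral_limit:
  assumes loc: "localizes s0 C"
    and \<epsilon>: "\<And>n. \<epsilon> n > 0" "\<And>n. (\<epsilon> n)\<^sup>2 \<le> s0" "\<epsilon> \<longlonglongrightarrow> 0"
  shows "(\<lambda>n. \<integral>\<^sup>+x. (\<integral>\<^sup>+z. wt x (\<epsilon> n) z \<partial>P) \<partial>D) \<longlonglongrightarrow>
    ennreal (V * overlap)"
proof -
  interpret product_sigma_finite "\<lambda>_::nat. lborel :: real measure" by unfold_locales
  interpret P: finite_product_sigma_finite "\<lambda>_::nat. lborel :: real measure" I by unfold_locales simp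
  interpret D: prob_space D by (rule prob_D)
  let ?box = "PiE I (\<lambda>_. {-C..C})"
  have box [measurable]: "?box \<in> sets P" by (intro sets_PiM_I_finite) auto
  have dom: "wt x (\<epsilon> n) z \<le> ennreal (B ^ (m - 1)) * indicator ?box z"
    if x: "x \<in> {0..<2*pi}" and z: "z \<in> space P" for x n z
  proof (cases "hit ((\<epsilon> n)\<^sup>2) (zoom (\<epsilon> n) z) \<and> near (zoom (\<epsilon> n) z)")
    case True
    have nr: "\<bar>zoom (\<epsilon> n) z j - a * real j\<bar> < a / 2" if "j \<in> I" for j
      using True that by (auto simp: near_def)
    have "\<forall>j\<in>I. \<bar>zoom (\<epsilon> n) z j - a * real j\<bar> \<le> C * sqrt ((\<epsilon> n)\<^sup>2)"
      using True \<epsilon>(2) by (intro near_hit_bound[OF loc]) auto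
    then have "\<bar>z j\<bar> \<le> C" if "j \<in> I" for j using that \<epsilon>(1)[of n] by (auto simp: zoom_def abs_mult)
    then have "z \<in> ?box" using z by (auto simp: space_PiM PiE_iff abs_le_iff minus_le_iff)
    moreover have "(\<Prod>j\<in>I. p (x + (a * real j + \<epsilon> n * z j))) \<le> (\<Prod>j\<in>I. B)"
    proof (intro prod_mono conjI p_nonneg p_le_B)
      fix j assume j: "j \<in> I"
      from near_range[OF j nr[OF j]] j x
      show "0 \<le> x + (a * real j + \<epsilon> n * z j)" "x + (a * real j + \<epsilon> n * z j) \<le> 4 * pi"
        by (auto simp: zoom_def)
    qed
    ultimately show ?thesis using True by (simp add: wt_def ennreal_leI)
  next
    case False
    then have "wt x (\<epsilon> n) z = 0" unfolding wt_def by simp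
    then show ?thesis by simp
  qed
  define W where "W = ennreal (B ^ (m - 1)) * emeasure P ?box"
  have W: "W < \<infinity>" unfolding W_def using loc
    by (subst emeasure_PiM) (auto simp: localizes_def ennreal_mult_less_top prod_constant power_less_top_ennreal)
  have W_int: "(\<integral>\<^sup>+z. ennreal (B ^ (m - 1)) * indicator ?box z \<partial>P) = W"
    unfolding W_def by (rule nn_integral_cmult_indicator) measurable
  have inner: "(\<lambda>n. \<integral>\<^sup>+z. wt x (\<epsilon> n) z \<partial>P) \<longlonglongrightarrow> ennreal (\<Prod>j\<in>I. p (x + a * real j)) * ennreal V"
    if x: "x \<in> {0..<2*pi}" for x
  proof -
    have "(\<lambda>n. \<integral>\<^sup>+z. wt x (\<epsilon> n) z \<partial>P) \<longlonglongrightarrow>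
      (\<integral>\<^sup>+z. ennreal (\<Prod>j\<in>I. p (x + a * real j)) * indicator {z\<in>space P. chain_form (m - 1) z \<le> 1 / curv} z \<partial>P)"
    proof (rule nn_integral_dominated_convergence[where w="\<lambda>z. ennreal (B ^ (m - 1)) * indicator ?box z"])
      show "AE z in P. wt x (\<epsilon> j) z \<le> ennreal (B ^ (m - 1)) * indicator ?box z" for j
        using dom[OF x] by (intro AE_I2)
      show "(\<integral>\<^sup>+z. ennreal (B ^ (m - 1)) * indicator ?box z \<partial>P) < \<infinity>" using W W_int by simp
      show "AE z in P. (\<lambda>n. wt x (\<epsilon> n) z) \<longlonglongrightarrow> ennreal (\<Prod>j\<in>I. p (x + a * real j)) * indicator {z\<in>space P. chain_form (m - 1) z \<le> 1 / curv} z"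
        using AE_chain_form
      proof (rule AE_mp, intro AE_I2 impI)
        fix z assume z: "z \<in> space P" "chain_form (m - 1) z \<noteq> 1 / curv"
        have "indicator {z\<in>space P. chain_form (m - 1) z \<le> 1 / curv} z = (indicator {z. chain_form (m - 1) z \<le> 1 / curv} z :: ennreal)"
          using z(1) by (simp add: indicator_def)
        then show "(\<lambda>n. wt x (\<epsilon> n) z) \<longlonglongrightarrow> ennreal (\<Prod>j\<in>I. p (x + a * real j)) * indicator {z\<in>space P. chain_form (m - 1) z \<le> 1 / curv} z"
          using wt_limit[OF \<epsilon>(1,3) z(2), of x] by (simp only:)
      qed
    qed measurable
    also have "(\<integral>\<^sup>+z. ennreal (\<Prod>j\<in>I. p (x + a * real j)) * indicator {z\<in>space P. chain_form (m - 1) z \<le> 1 / curv} z \<partial>P)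
      = ennreal (\<Prod>j\<in>I. p (x + a * real j)) * ennreal V"
      using nn_integral_cmult_indicator[OF borel_measurable_le[OF chain_form_meas borel_measurable_const]]
      by (simp only: emeasure_V)
    finally show ?thesis .
  qed
  have inner_le: "(\<integral>\<^sup>+z. wt x (\<epsilon> n) z \<partial>P) \<le> W" if "x \<in> {0..<2*pi}" for x n
    unfolding W_int[symmetric] by (intro nn_integral_mono dom that)
  have "(\<lambda>n. \<integral>\<^sup>+x. (\<integral>\<^sup>+z. wt x (\<epsilon> n) z \<partial>P) \<partial>D) \<longlonglongrightarrow>
     (\<integral>\<^sup>+x. ennreal (\<Prod>j\<in>I. p (x + a * real j)) * ennreal V \<partial>D)"
  proof (rule nn_integral_dominated_convergence[where w="\<lambda>_. W"])
    show "(\<lambda>x. \<integral>\<^sup>+z. wt x (\<epsilon> n) z \<partial>P) \<in> borel_measurable D" for n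
      using P.borel_measurable_nn_integral[OF wt_measurable(1)[of "\<epsilon> n"]] by simp
    show "AE x in D. (\<integral>\<^sup>+z. wt x (\<epsilon> n) z \<partial>P) \<le> W" for n
      using AE_D inner_le by (auto elim: eventually_mono)
    show "AE x in D. (\<lambda>n. \<integral>\<^sup>+z. wt x (\<epsilon> n) z \<partial>P) \<longlonglongrightarrow> ennreal (\<Prod>j\<in>I. p (x + a * real j)) * ennreal V"
      using AE_D by (rule eventually_mono) (rule inner)
  qed (use W in \<open>auto simp: emeasure_D_UNIV\<close>)
  also have "(\<integral>\<^sup>+x. ennreal (\<Prod>j\<in>I. p (x + a * real j)) * ennreal V \<partial>D) =
     (\<integral>\<^sup>+x. ennreal (\<Prod>j\<in>I. p (x + a * real j)) \<partial>D) * ennreal V"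
    by (intro nn_integral_multc) measurable
  also have "(\<integral>\<^sup>+x. ennreal (\<Prod>j\<in>I. p (x + a * real j)) \<partial>D) = ennreal overlap"
  proof -
    \<comment> \<open>The law of the first point contributes the factor l = 0, the other points the
      factors l \<ge> 1.\<close>
    have q: "ennreal (\<Prod>l<m. p (x + a * real l)) = ennreal (p x) * ennreal (\<Prod>j\<in>I. p (x + a * real j))" for x
    proof -
      have "{..<m} = insert 0 I" using m2 by auto
      then have "(\<Prod>l<m. p (x + a * real l)) = p x * (\<Prod>j\<in>I. p (x + a * real j))" by simp
      then show ?thesis by (simp only: ennreal_mult'[OF p_nonneg])
    qed
    have "(\<integral>\<^sup>+x. ennreal (\<Prod>j\<in>I. p (x + a * real j)) \<partial>D) =
      (\<integral>\<^sup>+x. ennreal (p x) * indicator {0..<2*pi} x * ennreal (\<Prod>j\<in>I. p (x + a * real j)) \<partial>lborel)"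
      by (rule nn_integral_D) measurable
    also have "\<dots> = (\<integral>\<^sup>+x. ennreal (\<Prod>l<m. p (x + a * real l)) * indicator {0..<2*pi} x \<partial>lborel)"
      unfolding q by (intro nn_integral_cong) (simp only: mult_ac)
    also have "\<dots> = ennreal overlap"
      by (rule nn_integral_period[OF _ _ overlap_has_integral]) (auto intro: prod_nonneg p_nonneg)
    finally show ?thesis .
  qed
  also have "ennreal overlap * ennreal V =
     ennreal (V * overlap)"
    by (simp only: mult.commute[of _ "ennreal V"] ennreal_mult'[OF V_nonneg])
  finally show ?thesis .
qed

section \<open>Hits among m independent points\<close>

definition hit_tuple :: "real \<Rightarrow> (nat \<Rightarrow> real) \<Rightarrow> bool" where
  "hit_tuple s x \<longleftrightarrow> hit s (\<lambda>j. ccw (x 0) (x j))"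

lemma hit_tuple_measurable:
  assumes "\<And>j. j < m \<Longrightarrow> (\<lambda>\<omega>. Y \<omega> j) \<in> borel_measurable M"
  shows "Measurable.pred M (\<lambda>\<omega>. hit_tuple s (Y \<omega>))"
  unfolding hit_tuple_def using assms m2 by (intro hit_measurable ccw_measurable) auto

text \<open>Fubini fixes the first angle x; the remaining m - 1 points are independent, and their
  angles seen from x have the law \<open>Dx x\<close>.\<close>

lemma emeasure_hit_tuple:
  "emeasure (PiM {..<m} (\<lambda>_. D)) {x\<in>space (PiM {..<m} (\<lambda>_. D)). hit_tuple s x} =
   (\<integral>\<^sup>+x. emeasure (PD x) {y\<in>space (PD x). hit s y} \<partial>D)"
proof -
  interpret D: prob_space D by (rule prob_D)
  interpret product_sigma_finite "\<lambda>_::nat. D" by unfold_locales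
  let ?N = "PiM {..<m} (\<lambda>_. D)"
  let ?E = "{x\<in>space ?N. hit_tuple s x}"
  have ins: "{..<m} = insert 0 I" using m2 by auto
  have [measurable]: "Measurable.pred ?N (\<lambda>x. hit_tuple s x)"
    by (rule hit_tuple_measurable) (simp add: measurable_component_singleton)
  have E: "?E \<in> sets ?N" by measurable
  have "emeasure ?N ?E = (\<integral>\<^sup>+x. indicator ?E x \<partial>?N)" using E by simp
  also have "\<dots> = (\<integral>\<^sup>+x. (\<integral>\<^sup>+y. indicator ?E (y(0 := x)) \<partial>PiM I (\<lambda>_. D)) \<partial>D)"
    using E unfolding ins by (intro product_nn_integral_insert_rev) auto
  also have "\<dots> = (\<integral>\<^sup>+x. emeasure (PD x) {y\<in>space (PD x). hit s y} \<partial>D)"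
  proof (rule nn_integral_cong_AE, rule AE_mp[OF AE_D], intro AE_I2 impI)
    fix x :: real assume x: "x \<in> {0..<2*pi}"
    let ?DD = "PiM I (\<lambda>_. D)" and ?DX = "PD x"
    let ?F = "{y\<in>space ?DX. hit s y}"
    have [measurable]: "Measurable.pred ?DX (\<lambda>y. hit s y)" by (rule hit_measurable) simp
    have F: "?F \<in> sets ?DX" by measurable
    have T: "compose I (ccw x) \<in> ?DD \<rightarrow>\<^sub>M ?DX"
      unfolding compose_def by (intro measurable_restrict) measurable
    have "emeasure ?DX ?F = emeasure (distr ?DD ?DX (compose I (ccw x))) ?F"
      using distr_PiM_ccw[OF x] by simp
    also have "\<dots> = emeasure ?DD (compose I (ccw x) -` ?F \<inter> space ?DD)"
      by (rule emeasure_distr[OF T F])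
    also have "\<dots> = (\<integral>\<^sup>+y. indicator (compose I (ccw x) -` ?F \<inter> space ?DD) y \<partial>?DD)"
      using measurable_sets[OF T F] by simp
    also have "\<dots> = (\<integral>\<^sup>+y. indicator ?E (y(0 := x)) \<partial>?DD)"
    proof (rule nn_integral_cong)
      fix y assume y: "y \<in> space ?DD"
      have "y(0 := x) \<in> space ?N" using y unfolding ins by (auto simp: space_PiM PiE_iff extensional_def)
      moreover have "compose I (ccw x) y \<in> space ?DX" using measurable_space[OF T y] .
      moreover have "hit s (compose I (ccw x) y) \<longleftrightarrow> hit_tuple s (y(0 := x))"
        unfolding hit_tuple_def by (rule hit_cong) (auto simp: compose_def)
      ultimately show "indicator (compose I (ccw x) -` ?F \<inter> space ?DD) y = (indicator ?E (y(0 := x)) :: ennreal)"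
        using y by (simp add: indicator_def)
    qed
    finally show "(\<integral>\<^sup>+y. indicator ?E (y(0 := x)) \<partial>?DD) = emeasure ?DX ?F" by simp
  qed
  finally show ?thesis .
qed

text \<open>The exponent m - 1 counts the points that are pinned once the first is given, and the
  factorial counts their labellings.\<close>

lemma hit_tuple_limit:
  assumes \<epsilon>: "\<And>n. \<epsilon> n > 0" "\<epsilon> \<longlonglongrightarrow> 0"
  shows "(\<lambda>n. measure (PiM {..<m} (\<lambda>_. D)) {x\<in>space (PiM {..<m} (\<lambda>_. D)). hit_tuple ((\<epsilon> n)\<^sup>2) x} / \<epsilon> n ^ (m - 1)) \<longlonglongrightarrow>
    fact (m - 1) * (V * overlap)"
proof -
  obtain s0 C where loc: "localizes s0 C" using ex_localizes by blast
  let ?N = "PiM {..<m} (\<lambda>_. D)"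
  interpret D: prob_space D by (rule prob_D)
  interpret N: prob_space ?N by (rule prob_space_PiM) (rule prob_D)
  have "(\<lambda>n. (\<epsilon> n)\<^sup>2) \<longlonglongrightarrow> 0\<^sup>2" by (intro tendsto_intros \<epsilon>(2))
  then have "\<forall>\<^sub>F n in sequentially. (\<epsilon> n)\<^sup>2 < s0" using loc by (intro order_tendstoD(2)) (auto simp: localizes_def)
  then obtain n0 where n0: "\<And>n. n \<ge> n0 \<Longrightarrow> (\<epsilon> n)\<^sup>2 < s0" by (auto simp: eventually_sequentially)
  \<comment> \<open>Shifting the index makes the localization bound valid for all n instead of
    eventually.\<close>
  define \<delta> where "\<delta> n = \<epsilon> (n + n0)" for n
  have \<delta>: "\<And>n. \<delta> n > 0" "\<And>n. (\<delta> n)\<^sup>2 \<le> s0" "\<delta> \<longlonglongrightarrow> 0"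
    using \<epsilon>(1) n0 LIMSEQ_ignore_initial_segment[OF \<epsilon>(2), of n0] unfolding \<delta>_def by (auto simp: less_imp_le)
  define J where "J n = (\<integral>\<^sup>+x. (\<integral>\<^sup>+z. wt x (\<delta> n) z \<partial>P) \<partial>D)" for n
  have VI: "V * overlap \<ge> 0" using V_nonneg overlap_nonneg by simp
  have J_lim: "J \<longlonglongrightarrow> ennreal (V * overlap)" unfolding J_def by (rule wt_integral_limit[OF loc \<delta>])
  have eqJ: "emeasure ?N {x\<in>space ?N. hit_tuple ((\<delta> n)\<^sup>2) x} =
      ennreal (fact (m - 1) * \<delta> n ^ (m - 1)) * J n" for n
  proof -
    have "emeasure ?N {x\<in>space ?N. hit_tuple ((\<delta> n)\<^sup>2) x} =
      (\<integral>\<^sup>+x. ennreal (fact (m - 1) * \<delta> n ^ (m - 1)) * (\<integral>\<^sup>+z. wt x (\<delta> n) z \<partial>P) \<partial>D)"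
      unfolding emeasure_hit_tuple
    proof (rule nn_integral_cong_AE, rule AE_mp[OF AE_D], intro AE_I2 impI)
      fix x :: real assume x: "x \<in> {0..<2*pi}"
      show "emeasure (PD x) {y\<in>space (PD x). hit ((\<delta> n)\<^sup>2) y} =
        ennreal (fact (m - 1) * \<delta> n ^ (m - 1)) * (\<integral>\<^sup>+z. wt x (\<delta> n) z \<partial>P)"
        using emeasure_hit_eq_near[OF loc _ \<delta>(2) x] emeasure_near_hit[OF x \<delta>(1)[of n]] \<delta>(1)[of n]
        by (simp add: ennreal_mult' mult.assoc)
    qed
    also have "\<dots> = ennreal (fact (m - 1) * \<delta> n ^ (m - 1)) * J n"
    proof -
      interpret P: finite_product_sigma_finite "\<lambda>_::nat. lborel :: real measure" I by unfold_locales simp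
      show ?thesis unfolding J_def
        using P.borel_measurable_nn_integral[OF wt_measurable(1)[of "\<delta> n"]] by (intro nn_integral_cmult) simp
    qed
    finally show ?thesis .
  qed
  have lim: "(\<lambda>n. fact (m - 1) * enn2real (J n)) \<longlonglongrightarrow> fact (m - 1) * (V * overlap)"
    by (intro tendsto_mult_left tendsto_enn2real[OF J_lim VI])
  have "fact (m - 1) * enn2real (J n) = measure ?N {x\<in>space ?N. hit_tuple ((\<delta> n)\<^sup>2) x} / \<delta> n ^ (m - 1)" for n
    unfolding measure_def eqJ using \<delta>(1)[of n] by (simp add: enn2real_mult)
  from lim[unfolded this] have "(\<lambda>n. measure ?N {x\<in>space ?N. hit_tuple ((\<delta> n)\<^sup>2) x} / \<delta> n ^ (m - 1)) \<longlonglongrightarrow> fact (m - 1) * (V * overlap)" .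
  then show ?thesis unfolding \<delta>_def by (rule LIMSEQ_offset)
qed

end

section \<open>Dependent hits\<close>

lemma binomial_over_power_limit:
  "(\<lambda>n. real (n choose m) / real n ^ m) \<longlonglongrightarrow> 1 / fact m"
proof -
  have lim: "(\<lambda>n. \<Prod>i<m. real (n - i) / real n / real (m - i)) \<longlonglongrightarrow> (\<Prod>i<m. 1 / real (m - i))"
  proof (intro tendsto_prod tendsto_divide tendsto_const)
    fix i assume i: "i \<in> {..<m}"
    then show "real (m - i) \<noteq> 0" by simp
    have "(\<lambda>n. 1 - real i / real n) \<longlonglongrightarrow> 1 - 0" by (intro tendsto_intros lim_const_over_n)
    moreover have "\<forall>\<^sub>F n in sequentially. 1 - real i / real n = real (n - i) / real n"
      using eventually_ge_at_top[of "Suc i"]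
      by eventually_elim (auto simp: of_nat_diff field_simps)
    ultimately show "(\<lambda>n. real (n - i) / real n) \<longlonglongrightarrow> 1" using Lim_transform_eventually by fastforce
  qed
  have "(\<Prod>i<m. 1 / real (m - i)) = 1 / real (\<Prod>i<m. m - i)" by (simp add: prod_dividef)
  also have "(\<Prod>i<m. m - i) = fact m" unfolding fact_prod_rev by (simp add: lessThan_atLeast0)
  finally have lim': "(\<lambda>n. \<Prod>i<m. real (n - i) / real n / real (m - i)) \<longlonglongrightarrow> 1 / fact m"
    using lim by simp
  moreover have "\<forall>\<^sub>F n in sequentially. (\<Prod>i<m. real (n - i) / real n / real (m - i)) = real (n choose m) / real n ^ m"
    using eventually_ge_at_top[of m]
  proof eventually_elim
    case (elim n)
    have "(\<Prod>i<m. real (n - i) / real n / real (m - i)) = (\<Prod>i<m. real (n - i) / real (m - i)) / (\<Prod>i<m. real n)"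
      unfolding prod_dividef[symmetric]
      by (intro prod.cong refl) (simp add: divide_divide_eq_left mult.commute)
    also have "(\<Prod>i<m. real (n - i) / real (m - i)) = real (n choose m)"
      using binomial_altdef_of_nat[OF elim, where 'a=real] by (simp add: lessThan_atLeast0)
    finally show ?case by simp
  qed
  ultimately show ?thesis by (rule Lim_transform_eventually)
qed

text \<open>Increasing lists represent the m-element subsets of {1..n}, in the form in which
  \<open>U_max\<close> runs through them.\<close>

definition index_lists :: "nat \<Rightarrow> nat \<Rightarrow> nat list set" where
  "index_lists m n = {ks. length ks = m \<and> sorted_wrt (<) ks \<and> set ks \<subseteq> {1..n}}"

lemma finite_index_lists: "finite (index_lists m n)" unfolding index_lists_def
  by (rule finite_subset[OF _ finite_lists_length_eq[of "{1..n}" m]]) auto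

lemma index_listsD:
  assumes "ks \<in> index_lists m n"
  shows "length ks = m" "distinct ks" "sorted ks" "set ks \<subseteq> {1..n}" "card (set ks) = m"
  using assms strict_sorted_imp_sorted distinct_card
  by (auto simp: index_lists_def strict_sorted_iff)

lemma card_index_lists: "card (index_lists m n) = n choose m"
proof -
  have "bij_betw set (index_lists m n) {S. S \<subseteq> {1..n} \<and> card S = m}" unfolding bij_betw_def
  proof
    show "inj_on set (index_lists m n)"
      using index_listsD by (intro inj_onI) (metis sorted_distinct_set_unique)
    show "set ` index_lists m n = {S. S \<subseteq> {1..n} \<and> card S = m}"
    proof (intro equalityI subsetI)
      fix S assume S: "S \<in> {S. S \<subseteq> {1..n} \<and> card S = m}"
      then have "finite S" using finite_subset by auto
      then have "sorted_list_of_set S \<in> index_lists m n" "set (sorted_list_of_set S) = S"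
        using S by (auto simp: index_lists_def)
      then show "S \<in> set ` index_lists m n" by blast
    next
      fix S assume "S \<in> set ` index_lists m n"
      then obtain ks where "ks \<in> index_lists m n" "S = set ks" by blast
      then show "S \<in> {S. S \<subseteq> {1..n} \<and> card S = m}" using index_listsD(4,5)[of ks m n] by simp
    qed
  qed
  then have "card (index_lists m n) = card {S. S \<subseteq> {1..n} \<and> card S = m}" by (rule bij_betw_same_card)
  then show ?thesis by (simp add: n_subsets)
qed

text \<open>The union is chosen first, in at most n^u ways, then both lists from its u elements.
  Ignoring the order within the lists costs only a factor independent of n.\<close>

lemma card_pairs_union_le:
  "card {(ks, js) \<in> index_lists m n \<times> index_lists m n. card (set ks \<union> set js) = u} \<le> n ^ u * (u ^ m * u ^ m)"
  (is "card ?A \<le> _")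
proof -
  let ?L = "\<lambda>S::nat set. {ks. set ks \<subseteq> S \<and> length ks = m}" and ?SS = "{S. S \<subseteq> {1..n} \<and> card S = u}"
  have fin: "finite S" if "S \<in> ?SS" for S using that finite_subset by auto
  have finSS: "finite ?SS" by (rule finite_subset[of _ "Pow {1..n}"]) auto
  have "?A \<subseteq> (\<Union>S\<in>?SS. ?L S \<times> ?L S)"
  proof (rule subsetI)
    fix w assume w: "w \<in> ?A"
    obtain ks js where eq: "w = (ks, js)" by (cases w)
    have ks: "ks \<in> index_lists m n" "js \<in> index_lists m n" "card (set ks \<union> set js) = u" using w unfolding eq by blast+
    show "w \<in> (\<Union>S\<in>?SS. ?L S \<times> ?L S)"
    proof (rule UN_I)
      show "set ks \<union> set js \<in> ?SS" using ks(3) index_listsD(4)[OF ks(1)] index_listsD(4)[OF ks(2)] by blast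
      show "w \<in> ?L (set ks \<union> set js) \<times> ?L (set ks \<union> set js)"
        unfolding eq using index_listsD(1)[OF ks(1)] index_listsD(1)[OF ks(2)] by blast
    qed
  qed
  moreover have "finite (\<Union>S\<in>?SS. ?L S \<times> ?L S)"
    by (rule finite_UN_I[OF finSS]) (intro finite_cartesian_product finite_lists_length_eq fin; assumption)
  ultimately have "card ?A \<le> card (\<Union>S\<in>?SS. ?L S \<times> ?L S)" by (rule card_mono[rotated])
  also have "\<dots> \<le> (\<Sum>S\<in>?SS. card (?L S \<times> ?L S))" by (rule card_UN_le[OF finSS])
  also have "\<dots> = (\<Sum>S\<in>?SS. u ^ m * u ^ m)"
  proof (intro sum.cong refl)
    fix S assume S: "S \<in> ?SS"
    have "card (?L S) = card S ^ m" by (rule card_lists_length_eq[OF fin[OF S]])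
    moreover have "card S = u" using S by blast
    ultimately show "card (?L S \<times> ?L S) = u ^ m * u ^ m" by (simp only: card_cartesian_product)
  qed
  also have "\<dots> = (n choose u) * (u ^ m * u ^ m)" using n_subsets[of "{1..n}" u] by simp
  also have "n choose u \<le> n ^ u" by (cases "u \<le> n") (auto intro: binomial_le_pow simp: binomial_eq_0 not_le)
  finally show ?thesis by simp
qed

context side_max_density
begin

text \<open>Points in \<open>[0, 2 pi)\<close> differ by less than \<open>m a\<close>, which is why finitely many \<open>t\<close> suffice.\<close>

definition aligned :: "real \<Rightarrow> real \<Rightarrow> real \<Rightarrow> bool" where
  "aligned r x y \<longleftrightarrow> (\<exists>t\<in>{- int m..int m}. \<bar>y - x - a * of_int t\<bar> \<le> r)"

text \<open>Both points lie within C sqrt s of vertices of the polygon through \<open>x 0\<close>,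
  so their difference is within twice that of a multiple of a. Arbitrary k and l are allowed because
  two hits may meet in any of their points.\<close>

lemma hit_tuple_aligned:
  assumes loc: "localizes s0 C" and s: "0 \<le> s" "s \<le> s0"
    and x: "\<And>j. j < m \<Longrightarrow> x j \<in> {0..<2*pi}" and hit: "hit_tuple s x" and kl: "k < m" "l < m"
  shows "aligned (2 * C * sqrt s) (x k) (x l)"
proof -
  have 0: "x 0 \<in> {0..<2*pi}" using x m2 by auto
  have y: "ccw (x 0) (x j) \<in> {0..2*pi}" if "j \<in> I" for j
    using ccw_range[OF 0 x[of j]] that by auto
  note locD = localizesD[OF loc s y hit[unfolded hit_tuple_def]]
  obtain q where q: "\<And>j. j \<in> I \<Longrightarrow> \<bar>ccw (x 0) (x j) - a * real (q j)\<bar> \<le> C * sqrt s"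
    using locD(2) by blast
  have Cs: "0 \<le> C * sqrt s" using loc s(1) by (simp add: localizes_def)
  have ex: "\<exists>t::int. \<bar>x j - x 0 - a * of_int t\<bar> \<le> C * sqrt s" if "j < m" for j
  proof (cases "j = 0")
    case True
    then show ?thesis using Cs by (intro exI[of _ 0]) simp
  next
    case False
    then have j: "j \<in> I" using that by simp
    show ?thesis
    proof (cases "x 0 \<le> x j")
      case True
      then show ?thesis using q[OF j] by (intro exI[of _ "int (q j)"]) (simp add: ccw_def)
    next
      case False
      \<comment> \<open>Passing the angle 0 costs a full turn, so the vertex number drops by
        m.\<close>
      then have "ccw (x 0) (x j) - a * real (q j) = x j - x 0 - a * of_int (int (q j) - int m)"
        using ma by (simp add: ccw_def algebra_simps)
      then show ?thesis using q[OF j] by metis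
    qed
  qed
  obtain tk tl :: int where tk: "\<bar>x k - x 0 - a * of_int tk\<bar> \<le> C * sqrt s" and tl: "\<bar>x l - x 0 - a * of_int tl\<bar> \<le> C * sqrt s"
    using ex[OF kl(1)] ex[OF kl(2)] by blast
  define t where "t = tl - tk"
  have close: "\<bar>x l - x k - a * of_int t\<bar> \<le> 2 * C * sqrt s"
    using tk tl by (simp add: t_def right_diff_distrib)
  have "\<bar>a * of_int t\<bar> \<le> \<bar>x l - x k\<bar> + 2 * C * sqrt s" using close by linarith
  moreover have "\<bar>x l - x k\<bar> < 2 * pi" using x[OF kl(1)] x[OF kl(2)] by auto
  moreover have "2 * C * sqrt s < a" using locD(1) by simp
  moreover have "a * (real m + 1) = 2 * pi + a" using ma by (simp add: algebra_simps)
  ultimately have "\<bar>a * of_int t\<bar> < a * (real m + 1)" by linarith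
  then have "\<bar>real_of_int t\<bar> < real m + 1" using a_pos by (simp add: abs_mult)
  then have "t \<in> {- int m..int m}" by simp linarith
  then show ?thesis using close unfolding aligned_def by blast
qed

lemma aligned_alt:
  "{y. aligned r x y} = (\<Union>t\<in>{- int m..int m}. {x + a * of_int t - r..x + a * of_int t + r})"
proof -
  have "\<bar>y - x - a * of_int t\<bar> \<le> r \<longleftrightarrow> y \<in> {x + a * of_int t - r..x + a * of_int t + r}" for y t
    by auto
  then show ?thesis by (simp only: aligned_def) blast
qed

lemma measurable_into_D: "N \<rightarrow>\<^sub>M D = borel_measurable N" by (rule measurable_cong_sets) auto

lemma aligned_sets: "{y. aligned r x y} \<in> sets borel"
proof -
  show ?thesis unfolding aligned_alt by auto
qed

lemma aligned_measurable:
  assumes [measurable]: "Y \<in> borel_measurable N" "Z \<in> borel_measurable N"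
  shows "Measurable.pred N (\<lambda>\<omega>. aligned r (Y \<omega>) (Z \<omega>))" unfolding aligned_def by measurable

text \<open>There are 2 m + 1 intervals of length 2 r, and the density of D is at most B on
  each.\<close>

lemma emeasure_D_aligned:
  assumes "r \<ge> 0"
  shows "emeasure D {y. aligned r x y} \<le> ennreal ((2 * real m + 1) * B * 2 * r)"
proof -
  have Icc: "emeasure D {u..v} \<le> ennreal (B * (v - u))" if "u \<le> v" for u v
  proof -
    have "emeasure D {u..v} = (\<integral>\<^sup>+y. ennreal (p y) * indicator {0..<2*pi} y * indicator {u..v} y \<partial>lborel)"
      unfolding D_def by (rule emeasure_density) auto
    also have "\<dots> \<le> (\<integral>\<^sup>+y. ennreal B * indicator {u..v} y \<partial>lborel)"
      by (intro nn_integral_mono) (auto simp: indicator_def intro!: ennreal_leI p_le_B)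
    also have "\<dots> = ennreal (B * (v - u))"
      using that B_nonneg by (subst nn_integral_cmult_indicator) (auto simp: ennreal_mult[symmetric])
    finally show ?thesis .
  qed
  have "emeasure D {y. aligned r x y} \<le> (\<Sum>t\<in>{- int m..int m}. emeasure D {x + a * of_int t - r..x + a * of_int t + r})"
    unfolding aligned_alt by (rule emeasure_subadditive_finite) auto
  also have "\<dots> \<le> (\<Sum>t\<in>{- int m..int m}. ennreal (B * (2 * r)))"
  proof (rule sum_mono)
    fix t
    show "emeasure D {x + a * of_int t - r..x + a * of_int t + r} \<le> ennreal (B * (2 * r))"
      using Icc[of "x + a * of_int t - r" "x + a * of_int t + r"] assms by (simp add: algebra_simps)
  qed
  also have "\<dots> = ennreal (real (card {- int m..int m}) * (B * (2 * r)))"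
    using assms B_nonneg by (subst sum_ennreal) auto
  also have "real (card {- int m..int m}) * (B * (2 * r)) = (2 * real m + 1) * B * 2 * r" by simp
  finally show ?thesis .
qed

end

section \<open>Hits in an independent sample\<close>

locale side_max_sample = side_max_density m g p + prob_space M
  for m :: nat and g p :: "real \<Rightarrow> real" and M :: "'a measure" +
  fixes X :: "nat \<Rightarrow> 'a \<Rightarrow> real"
  assumes X_indep: "indep_vars (\<lambda>_. borel) X {1..}"
    and X_distr: "\<And>i. i \<ge> 1 \<Longrightarrow> distr M borel (X i) = D"
    and X_range: "\<And>i \<omega>. i \<ge> 1 \<Longrightarrow> \<omega> \<in> space M \<Longrightarrow> X i \<omega> \<in> {0..<2*pi}"
begin

lemma X_meas: "i \<ge> 1 \<Longrightarrow> X i \<in> borel_measurable M" using X_indep by (auto simp: indep_vars_def)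

lemma joint_distr:
  assumes "J \<noteq> {}" "J \<subseteq> {1..}"
  shows "distr M (PiM J (\<lambda>_. borel)) (\<lambda>\<omega>. \<lambda>i\<in>J. X i \<omega>) = PiM J (\<lambda>_. D)"
proof -
  have "indep_vars (\<lambda>_. borel) X J" using X_indep assms(2) by (rule indep_vars_subset)
  then have "distr M (PiM J (\<lambda>_. borel)) (\<lambda>\<omega>. \<lambda>i\<in>J. X i \<omega>) = PiM J (\<lambda>i. distr M borel (X i))"
    using assms X_meas by (subst (asm) indep_vars_iff_distr_eq_PiM') auto
  also have "\<dots> = PiM J (\<lambda>_. D)" using assms(2) X_distr by (intro PiM_cong) auto
  finally show ?thesis .
qed

lemma prob_joint:
  assumes J: "J \<noteq> {}" "J \<subseteq> {1..}" and Q: "Measurable.pred (PiM J (\<lambda>_. D)) Q"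
  shows "prob {\<omega>\<in>space M. Q (\<lambda>i\<in>J. X i \<omega>)} = measure (PiM J (\<lambda>_. D)) {x\<in>space (PiM J (\<lambda>_. D)). Q x}"
proof -
  have sets_eq: "sets (PiM J (\<lambda>_. D)) = sets (PiM J (\<lambda>_. borel))" by (intro sets_PiM_cong) auto
  have T: "(\<lambda>\<omega>. \<lambda>i\<in>J. X i \<omega>) \<in> M \<rightarrow>\<^sub>M PiM J (\<lambda>_. borel)"
    using J(2) X_meas by (intro measurable_restrict) auto
  have E: "{x\<in>space (PiM J (\<lambda>_. D)). Q x} \<in> sets (PiM J (\<lambda>_. borel))"
    using predE[OF Q] by (simp only: sets_eq)
  have "measure (PiM J (\<lambda>_. D)) {x\<in>space (PiM J (\<lambda>_. D)). Q x} =
    prob ((\<lambda>\<omega>. \<lambda>i\<in>J. X i \<omega>) -` {x\<in>space (PiM J (\<lambda>_. D)). Q x} \<inter> space M)"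
    using measure_distr[OF T E] joint_distr[OF J] by simp
  also have "(\<lambda>\<omega>. \<lambda>i\<in>J. X i \<omega>) -` {x\<in>space (PiM J (\<lambda>_. D)). Q x} \<inter> space M = {\<omega>\<in>space M. Q (\<lambda>i\<in>J. X i \<omega>)}"
    using measurable_space[OF T] by (auto simp: space_PiM)
  finally show ?thesis by simp
qed

definition E :: "real \<Rightarrow> nat list \<Rightarrow> 'a set" where
  "E s ks = {\<omega>\<in>space M. hit_tuple s (\<lambda>j. X (ks ! j) \<omega>)}"

definition q :: "real \<Rightarrow> real" where
  "q s = measure (PiM {..<m} (\<lambda>_. D)) {x\<in>space (PiM {..<m} (\<lambda>_. D)). hit_tuple s x}"

lemma index_lists_nth:
  assumes "ks \<in> index_lists m n" "j < m"
  shows "ks ! j \<in> set ks \<and> ks ! j \<ge> 1"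
proof -
  have "ks ! j \<in> set ks" using assms(2) index_listsD(1)[OF assms(1)] by simp
  then show ?thesis using index_listsD(4)[OF assms(1)] by auto
qed

lemma hit_tuple_cong:
  assumes "\<And>j. j < m \<Longrightarrow> x j = x' j"
  shows "hit_tuple s x \<longleftrightarrow> hit_tuple s x'"
  unfolding hit_tuple_def using assms m2 by (intro hit_cong) auto

lemma E_events:
  assumes "ks \<in> index_lists m n"
  shows "E s ks \<in> events"
proof -
  have "Measurable.pred M (\<lambda>\<omega>. hit_tuple s (\<lambda>j. X (ks ! j) \<omega>))"
    using index_lists_nth[OF assms] X_meas by (intro hit_tuple_measurable) auto
  then show ?thesis unfolding E_def by measurable
qed

text \<open>The indices in ks are distinct, so picking out these coordinates is a reindexing of a
  product of equal laws; only s matters.\<close>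

lemma prob_E:
  assumes ks: "ks \<in> index_lists m n"
  shows "prob (E s ks) = q s"
proof -
  note isD = index_listsD[OF ks]
  let ?J = "set ks"
  have J: "?J \<noteq> {}" "?J \<subseteq> {1..}" using isD m2 by (cases "ks"; auto)+
  let ?N = "PiM ?J (\<lambda>_. D)" and ?N' = "PiM {..<m} (\<lambda>_. D)"
  let ?T = "\<lambda>x. \<lambda>j\<in>{..<m}. x (ks ! j)"
  have T: "?T \<in> ?N \<rightarrow>\<^sub>M ?N'"
    using index_lists_nth[OF ks] by (intro measurable_restrict measurable_component_singleton) auto
  have pred: "Measurable.pred ?N (\<lambda>x. hit_tuple s (\<lambda>j. x (ks ! j)))"
  proof (rule hit_tuple_measurable)
    fix j assume "j < m"
    then have "(\<lambda>x. x (ks ! j)) \<in> ?N \<rightarrow>\<^sub>M D"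
      using index_lists_nth[OF ks] by (intro measurable_component_singleton) auto
    then show "(\<lambda>x. x (ks ! j)) \<in> borel_measurable ?N" unfolding measurable_into_D .
  qed
  have pred': "Measurable.pred ?N' (\<lambda>x. hit_tuple s x)"
    by (rule hit_tuple_measurable) (simp add: measurable_component_singleton)
  then have S: "{x\<in>space ?N'. hit_tuple s x} \<in> sets ?N'" by measurable
  have "inj_on (\<lambda>j. ks ! j) {..<m}" using isD by (auto intro!: inj_onI simp: nth_eq_iff_index_eq)
  then have distr: "distr ?N ?N' ?T = ?N'"
    using distr_PiM_reindex[of ?J "\<lambda>_. D" "\<lambda>j. ks ! j" "{..<m}"] index_lists_nth[OF ks] prob_D by auto
  have "E s ks = {\<omega>\<in>space M. hit_tuple s (\<lambda>j. (\<lambda>i\<in>?J. X i \<omega>) (ks ! j))}"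
    unfolding E_def using index_lists_nth[OF ks] by (intro Collect_cong conj_cong refl hit_tuple_cong) auto
  then have "prob (E s ks) = measure ?N {x\<in>space ?N. hit_tuple s (\<lambda>j. x (ks ! j))}"
    using prob_joint[OF J pred] by simp
  also have "{x\<in>space ?N. hit_tuple s (\<lambda>j. x (ks ! j))} = ?T -` {x\<in>space ?N'. hit_tuple s x} \<inter> space ?N"
  proof -
    have "hit_tuple s (?T x) \<longleftrightarrow> hit_tuple s (\<lambda>j. x (ks ! j))" for x :: "nat \<Rightarrow> real"
      by (rule hit_tuple_cong) simp
    then show ?thesis using measurable_space[OF T] by auto
  qed
  also have "measure ?N \<dots> = measure ?N' {x\<in>space ?N'. hit_tuple s x}"
    using measure_distr[OF T S] distr by simp
  finally show ?thesis by (simp add: q_def)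
qed

text \<open>Lists disjoint from ks read only the sample outside \<open>set ks\<close>, and
  restrictions of the sample to disjoint index sets are independent. This is the factorization
  required by \<open>prob_none_poisson_approx\<close>.\<close>

lemma E_indep:
  assumes ks: "ks \<in> index_lists m n"
    and A: "A \<subseteq> {js \<in> index_lists m n. set js \<inter> set ks = {}}" and u: "0 \<le> u" "u \<le> (1::real)"
  shows "expectation (\<lambda>\<omega>. indicator (E s ks) \<omega> * u ^ card {js\<in>A. \<omega> \<in> E s js}) =
    prob (E s ks) * expectation (\<lambda>\<omega>. u ^ card {js\<in>A. \<omega> \<in> E s js})"
proof -
  let ?S = "set ks" and ?T = "{1..n} - set ks"
  have finA: "finite A" using A finite_index_lists finite_subset by fastforce
  let ?PS = "PiM ?S (\<lambda>_. borel :: real measure)" and ?PT = "PiM ?T (\<lambda>_. borel :: real measure)"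
  let ?R = "\<lambda>K \<omega>. restrict (\<lambda>i. X i \<omega>) K"
  have "indep_var ?PS (?R ?S) ?PT (?R ?T)"
    using index_listsD(4)[OF ks] by (intro indep_var_restrict[OF X_indep]) auto
  moreover define Y1 where "Y1 x = (if hit_tuple s (\<lambda>j. x (ks ! j)) then 1 else 0 :: real)" for x
  moreover define Y2 where "Y2 x = u ^ (\<Sum>js\<in>A. if hit_tuple s (\<lambda>j. x (js ! j)) then 1 else 0)" for x
  moreover have "Y1 \<in> borel_measurable ?PS"
  proof -
    have "Measurable.pred ?PS (\<lambda>x. hit_tuple s (\<lambda>j. x (ks ! j)))"
      using index_lists_nth[OF ks] by (intro hit_tuple_measurable measurable_component_singleton) auto
    then show ?thesis unfolding Y1_def by measurable
  qed
  moreover have "Y2 \<in> borel_measurable ?PT"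
  proof -
    have "Measurable.pred ?PT (\<lambda>x. hit_tuple s (\<lambda>j. x (js ! j)))" if "js \<in> A" for js
    proof -
      have js: "js \<in> index_lists m n" "set js \<inter> set ks = {}" using A that by auto
      show ?thesis
      proof (intro hit_tuple_measurable measurable_component_singleton)
        fix j assume "j < m"
        then show "js ! j \<in> ?T"
          using index_lists_nth[OF js(1), of j] js(2) index_listsD(4)[OF js(1)] by blast
      qed
    qed
    then have "(\<lambda>x. \<Sum>js\<in>A. if hit_tuple s (\<lambda>j. x (js ! j)) then 1 else (0::nat)) \<in> ?PT \<rightarrow>\<^sub>M count_space UNIV"
      by (intro measurable_sum_nat measurable_If measurable_const) (auto intro: predE)
    then show ?thesis unfolding Y2_def by measurable
  qed
  ultimately have ind: "indep_var borel (Y1 \<circ> ?R ?S) borel (Y2 \<circ> ?R ?T)"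
    by (intro indep_var_compose) auto
  have Y1: "(Y1 \<circ> ?R ?S) \<omega> = indicator (E s ks) \<omega>" if "\<omega> \<in> space M" for \<omega>
  proof -
    have "hit_tuple s (\<lambda>j. ?R ?S \<omega> (ks ! j)) \<longleftrightarrow> hit_tuple s (\<lambda>j. X (ks ! j) \<omega>)"
      using index_lists_nth[OF ks] by (intro hit_tuple_cong) auto
    then show ?thesis using that by (simp add: Y1_def E_def indicator_def)
  qed
  have Y2: "(Y2 \<circ> ?R ?T) \<omega> = u ^ card {js\<in>A. \<omega> \<in> E s js}" if "\<omega> \<in> space M" for \<omega>
  proof -
    have "hit_tuple s (\<lambda>j. ?R ?T \<omega> (js ! j)) \<longleftrightarrow> \<omega> \<in> E s js" if "js \<in> A" for js
    proof -
      have js: "js \<in> index_lists m n" "set js \<inter> set ks = {}" using A that by auto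
      have "hit_tuple s (\<lambda>j. ?R ?T \<omega> (js ! j)) \<longleftrightarrow> hit_tuple s (\<lambda>j. X (js ! j) \<omega>)"
      proof (rule hit_tuple_cong)
        fix j assume "j < m"
        then have "js ! j \<in> ?T"
          using index_lists_nth[OF js(1), of j] js(2) index_listsD(4)[OF js(1)] by blast
        then show "?R ?T \<omega> (js ! j) = X (js ! j) \<omega>" by simp
      qed
      then show ?thesis using \<open>\<omega> \<in> space M\<close> by (simp add: E_def)
    qed
    then have "(\<Sum>js\<in>A. if hit_tuple s (\<lambda>j. ?R ?T \<omega> (js ! j)) then 1 else (0::nat)) = card {js\<in>A. \<omega> \<in> E s js}"
      using finA by (simp add: sum.If_cases Int_def cong: sum.cong)
    then show ?thesis unfolding Y2_def comp_def by (simp only:)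
  qed
  have rv: "Y1 \<circ> ?R ?S \<in> borel_measurable M" "Y2 \<circ> ?R ?T \<in> borel_measurable M"
    using indep_var_rv1[OF ind] indep_var_rv2[OF ind] by auto
  have int: "integrable M (Y1 \<circ> ?R ?S)" "integrable M (Y2 \<circ> ?R ?T)"
    using rv u by (auto intro!: integrable_const_bound[where B=1] simp: Y1_def Y2_def power_le_one)
  have "expectation (\<lambda>\<omega>. indicator (E s ks) \<omega> * u ^ card {js\<in>A. \<omega> \<in> E s js}) =
     expectation (\<lambda>\<omega>. (Y1 \<circ> ?R ?S) \<omega> * (Y2 \<circ> ?R ?T) \<omega>)"
    by (intro Bochner_Integration.integral_cong refl) (simp only: Y1 Y2)
  also have "\<dots> = expectation (Y1 \<circ> ?R ?S) * expectation (Y2 \<circ> ?R ?T)"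
    by (rule indep_var_lebesgue_integral[OF ind int])
  also have "expectation (Y1 \<circ> ?R ?S) = expectation (indicator (E s ks))"
    by (intro Bochner_Integration.integral_cong refl) (simp only: Y1)
  also have "expectation (indicator (E s ks)) = prob (E s ks)" using E_events[OF ks] by simp
  also have "expectation (Y2 \<circ> ?R ?T) = expectation (\<lambda>\<omega>. u ^ card {js\<in>A. \<omega> \<in> E s js})"
    by (intro Bochner_Integration.integral_cong refl) (simp only: Y2)
  finally show ?thesis .
qed

text \<open>Given the point at a common index, every other point of the union must be aligned with
  it. These points are independent, so each contributes one factor, and the exponent is one less
  than the size of the union.\<close>

lemma prob_pair:
  assumes loc: "localizes s0 C" and s: "0 \<le> s" "s \<le> s0"
    and ks: "ks \<in> index_lists m n" and js: "js \<in> index_lists m n" and meet: "set ks \<inter> set js \<noteq> {}"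
  shows "prob (E s ks \<inter> E s js) \<le> ((2 * real m + 1) * B * 4 * C * sqrt s) ^ (card (set ks \<union> set js) - 1)"
proof -
  \<comment> \<open>Comes from \<open>emeasure_D_aligned\<close> with r = 2 * C * sqrt s.\<close>
  define c where "c = (2 * real m + 1) * B * 4 * C"
  have C: "C > 0" using loc by (simp add: localizes_def)
  then have c: "c \<ge> 0" using B_nonneg by (simp add: c_def)
  interpret D: prob_space D by (rule prob_D)
  interpret product_sigma_finite "\<lambda>_::nat. D" by unfold_locales
  obtain i0 where i0: "i0 \<in> set ks" "i0 \<in> set js" using meet by blast
  define K where "K = set ks \<union> set js - {i0}"
  have K: "finite K" "i0 \<notin> K" by (auto simp: K_def)
  have cardK: "card K = card (set ks \<union> set js) - 1" using i0 by (simp add: K_def)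
  let ?J = "insert i0 K"
  have J: "?J \<noteq> {}" "?J \<subseteq> {1..}"
    using i0 index_listsD(4)[OF ks] index_listsD(4)[OF js] by (auto simp: K_def)
  let ?N = "PiM ?J (\<lambda>_. D)"
  let ?r = "2 * C * sqrt s"
  define Q where "Q x \<longleftrightarrow> (\<forall>k\<in>K. aligned ?r (x i0) (x k))" for x :: "nat \<Rightarrow> real"
  have al: "aligned ?r (X i0 \<omega>) (X k \<omega>)"
    if ls: "ls \<in> index_lists m n" and E: "\<omega> \<in> E s ls" and i: "i0 \<in> set ls" "k \<in> set ls" for ls \<omega> k
  proof -
    obtain j j' where j: "ls ! j = i0" "j < m" "ls ! j' = k" "j' < m"
      using i index_listsD(1)[OF ls] by (metis in_set_conv_nth)
    have "aligned ?r (X (ls ! j) \<omega>) (X (ls ! j') \<omega>)" using s E index_lists_nth[OF ls] j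
      by (intro hit_tuple_aligned[OF loc, of s "\<lambda>j. X (ls ! j) \<omega>"] X_range) (auto simp: E_def)
    then show ?thesis using j by simp
  qed
  have pred: "Measurable.pred ?N Q"
  proof -
    have comp: "(\<lambda>x. x i) \<in> borel_measurable ?N" if "i \<in> ?J" for i
      using measurable_component_singleton[OF that, of "\<lambda>_. D"] unfolding measurable_into_D .
    have "Measurable.pred ?N (\<lambda>x. aligned ?r (x i0) (x k))" if "k \<in> K" for k
      using that by (intro aligned_measurable comp) auto
    then show ?thesis unfolding Q_def using K(1) by (intro pred_intros_finite)
  qed
  have "E s ks \<inter> E s js \<subseteq> {\<omega>\<in>space M. Q (\<lambda>i\<in>?J. X i \<omega>)}"
  proof
    fix \<omega> assume \<omega>: "\<omega> \<in> E s ks \<inter> E s js"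
    have "aligned ?r (X i0 \<omega>) (X k \<omega>)" if "k \<in> K" for k
      using al[OF ks, of \<omega> k] al[OF js, of \<omega> k] that \<omega> i0 by (auto simp: K_def)
    then show "\<omega> \<in> {\<omega>\<in>space M. Q (\<lambda>i\<in>?J. X i \<omega>)}" using \<omega> by (auto simp: Q_def E_def)
  qed
  moreover have "{\<omega>\<in>space M. Q (\<lambda>i\<in>?J. X i \<omega>)} \<in> events"
  proof -
    have T: "(\<lambda>\<omega>. \<lambda>i\<in>?J. X i \<omega>) \<in> M \<rightarrow>\<^sub>M ?N" using J(2) X_meas by (intro measurable_restrict) auto
    from measurable_compose[OF T pred] show ?thesis by measurable
  qed
  ultimately have "prob (E s ks \<inter> E s js) \<le> prob {\<omega>\<in>space M. Q (\<lambda>i\<in>?J. X i \<omega>)}"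
    by (rule finite_measure_mono)
  also have "\<dots> = measure ?N {x\<in>space ?N. Q x}" by (rule prob_joint[OF J pred])
  also have "\<dots> \<le> (c * sqrt s) ^ card K"
  proof -
    let ?F = "{x\<in>space ?N. Q x}"
    have F: "?F \<in> sets ?N" using pred by measurable
    have "emeasure ?N ?F = (\<integral>\<^sup>+x. indicator ?F x \<partial>?N)" using F by simp
    also have "\<dots> = (\<integral>\<^sup>+x. (\<integral>\<^sup>+y. indicator ?F (y(i0 := x)) \<partial>PiM K (\<lambda>_. D)) \<partial>D)"
      using F K by (intro product_nn_integral_insert_rev) auto
    also have "\<dots> \<le> (\<integral>\<^sup>+x. ennreal ((c * sqrt s) ^ card K) \<partial>D)"
    proof (rule nn_integral_mono)
      fix x
      have "(\<integral>\<^sup>+y. indicator ?F (y(i0 := x)) \<partial>PiM K (\<lambda>_. D)) \<le>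
        (\<integral>\<^sup>+y. indicator (PiE K (\<lambda>_. {z. aligned ?r x z})) y \<partial>PiM K (\<lambda>_. D))"
      proof (rule nn_integral_mono)
        fix y assume y: "y \<in> space (PiM K (\<lambda>_. D))"
        have "y \<in> PiE K (\<lambda>_. {z. aligned ?r x z})" if "y(i0 := x) \<in> ?F"
          using that y K(2) by (auto simp: Q_def PiE_iff space_PiM split: if_splits)
        then show "indicator ?F (y(i0 := x)) \<le> (indicator (PiE K (\<lambda>_. {z. aligned ?r x z})) y :: ennreal)"
          by (auto simp: indicator_def)
      qed
      also have "\<dots> = emeasure (PiM K (\<lambda>_. D)) (PiE K (\<lambda>_. {z. aligned ?r x z}))"
        using K(1) aligned_sets by (intro nn_integral_indicator sets_PiM_I_finite) auto
      also have "\<dots> = (\<Prod>k\<in>K. emeasure D {z. aligned ?r x z})"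
        using K(1) aligned_sets by (intro emeasure_PiM) auto
      also have "\<dots> \<le> (\<Prod>k\<in>K. ennreal (c * sqrt s))"
      proof -
        have "emeasure D {z. aligned ?r x z} \<le> ennreal (c * sqrt s)"
          using emeasure_D_aligned[of ?r x] C s(1) by (simp add: c_def mult.assoc)
        then show ?thesis by (intro prod_mono_ennreal)
      qed
      also have "\<dots> = ennreal ((c * sqrt s) ^ card K)" using c s(1) by (simp add: ennreal_power)
      finally show "(\<integral>\<^sup>+y. indicator ?F (y(i0 := x)) \<partial>PiM K (\<lambda>_. D)) \<le> ennreal ((c * sqrt s) ^ card K)" .
    qed
    also have "\<dots> = ennreal ((c * sqrt s) ^ card K)" by (simp add: emeasure_D_UNIV)
    finally have "emeasure ?N ?F \<le> ennreal ((c * sqrt s) ^ card K)" .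
    then show ?thesis unfolding measure_def using c s(1) by (intro enn2real_leI) auto
  qed
  finally show ?thesis by (simp add: cardK c_def)
qed

end

section \<open>The limit\<close>

text \<open>Groups the pairs by the size u of their union; u \<le> 2 m makes the number of lists
  within the union bounded by a constant free of u.\<close>

lemma pair_sum_le:
  fixes f :: "nat \<Rightarrow> real"
  assumes f: "\<And>u. 0 \<le> f u"
    and C: "\<And>ks. ks \<in> index_lists m n \<Longrightarrow> C ks \<subseteq> index_lists m n"
    and R: "\<And>ks js. ks \<in> index_lists m n \<Longrightarrow> js \<in> C ks \<Longrightarrow> card (set ks \<union> set js) \<in> R" "finite R" "R \<subseteq> {..2*m}"
  shows "(\<Sum>ks\<in>index_lists m n. \<Sum>js\<in>C ks. f (card (set ks \<union> set js)))
    \<le> (\<Sum>u\<in>R. f u * (real n ^ u * ((2 * real m) ^ m * (2 * real m) ^ m)))"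
proof -
  let ?A = "index_lists m n"
  let ?Z = "SIGMA ks:?A. C ks"
  let ?h = "\<lambda>(ks, js). card (set ks \<union> set js)"
  have finC: "finite (C ks)" if "ks \<in> ?A" for ks
    using C[OF that] finite_index_lists finite_subset by blast
  have finZ: "finite ?Z" using finC by (intro finite_SigmaI finite_index_lists)
  have "(\<Sum>ks\<in>?A. \<Sum>js\<in>C ks. f (card (set ks \<union> set js))) = (\<Sum>z\<in>?Z. f (?h z))"
    using finC by (subst sum.Sigma) (auto simp: finite_index_lists split_beta')
  also have "\<dots> = (\<Sum>u\<in>R. \<Sum>z\<in>{z\<in>?Z. ?h z = u}. f (?h z))"
    using R(1) by (intro sum.group[symmetric] finZ R(2)) auto
  also have "\<dots> \<le> (\<Sum>u\<in>R. f u * (real n ^ u * ((2 * real m) ^ m * (2 * real m) ^ m)))"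
  proof (rule sum_mono)
    fix u assume u: "u \<in> R"
    have "{z\<in>?Z. ?h z = u} \<subseteq> {(ks, js) \<in> ?A \<times> ?A. card (set ks \<union> set js) = u}"
    proof (rule subsetI)
      fix z assume z: "z \<in> {z\<in>?Z. ?h z = u}"
      obtain ks js where eq: "z = (ks, js)" by (cases z)
      have "ks \<in> ?A" "js \<in> C ks" "card (set ks \<union> set js) = u" using z unfolding eq by auto
      then show "z \<in> {(ks, js) \<in> ?A \<times> ?A. card (set ks \<union> set js) = u}"
        unfolding eq using C[of ks] by blast
    qed
    then have "card {z\<in>?Z. ?h z = u} \<le> card {(ks, js) \<in> ?A \<times> ?A. card (set ks \<union> set js) = u}"
      by (rule card_mono[rotated]) (rule finite_subset[of _ "?A \<times> ?A"], auto simp: finite_index_lists)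
    also have "\<dots> \<le> n ^ u * (u ^ m * u ^ m)" by (rule card_pairs_union_le)
    also have "\<dots> \<le> n ^ u * ((2 * m) ^ m * (2 * m) ^ m)"
      using u R(3) by (intro mult_mono power_mono) auto
    finally have "real (card {z\<in>?Z. ?h z = u}) \<le> real (n ^ u * ((2 * m) ^ m * (2 * m) ^ m))"
      by (rule of_nat_mono)
    then have "f u * real (card {z\<in>?Z. ?h z = u}) \<le> f u * (real n ^ u * ((2 * real m) ^ m * (2 * real m) ^ m))"
      using f by (intro mult_left_mono) simp_all
    moreover have "(\<Sum>z\<in>{z\<in>?Z. ?h z = u}. f (?h z)) = (\<Sum>z\<in>{z\<in>?Z. ?h z = u}. f u)"
      by (rule sum.cong) auto
    ultimately show "(\<Sum>z\<in>{z\<in>?Z. ?h z = u}. f (?h z)) \<le> f u * (real n ^ u * ((2 * real m) ^ m * (2 * real m) ^ m))"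
      by (simp only: sum_constant) (simp only: mult.commute)
  qed
  finally show ?thesis .
qed

text \<open>Both ends of the range matter for the error terms: a size below 2 m leaves a factor 1 /
  n in the product of two probabilities, and a size above m leaves a factor n \<epsilon> in the
  joint probability.\<close>

lemma card_union_index_lists:
  assumes ks: "ks \<in> index_lists m n" and js: "js \<in> index_lists m n" and meet: "set js \<inter> set ks \<noteq> {}"
  shows "m \<le> card (set ks \<union> set js)" "card (set ks \<union> set js) \<le> 2 * m - 1"
    and "ks \<noteq> js \<Longrightarrow> m < card (set ks \<union> set js)"
proof -
  have "card (set ks \<union> set js) + card (set ks \<inter> set js) = 2 * m"
    using card_Un_Int[of "set ks" "set js"] index_listsD(5)[OF ks] index_listsD(5)[OF js] by simp
  moreover have "card (set ks \<inter> set js) \<ge> 1" using meet by (simp add: Suc_le_eq card_gt_0_iff Int_commute)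
  ultimately show "card (set ks \<union> set js) \<le> 2 * m - 1" by simp
  show ge: "m \<le> card (set ks \<union> set js)"
    using card_mono[of "set ks \<union> set js" "set ks"] index_listsD(5)[OF ks] by simp
  assume "ks \<noteq> js"
  show "m < card (set ks \<union> set js)"
  proof (rule ccontr)
    assume "\<not> ?thesis"
    then have c: "card (set ks \<union> set js) = m" using ge by simp
    have "set ks = set ks \<union> set js" using c index_listsD(5)[OF ks] by (intro card_subset_eq) auto
    moreover have "set js = set ks \<union> set js"
      using c index_listsD(5)[OF js] by (intro card_subset_eq) auto
    ultimately have "set ks = set js" by simp
    then have "ks = js"
      using index_listsD(2,3)[OF ks] index_listsD(2,3)[OF js] by (intro sorted_distinct_set_unique)
    then show False using \<open>ks \<noteq> js\<close> by simp
  qed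
qed

context side_max_sample
begin

text \<open>\<open>scale\<close> keeps the mean number of hits bounded and
  \<open>n \<epsilon> \<longlonglongrightarrow> 0\<close> removes the overlapping pairs; the powers
  of t enter only later, through \<theta>.\<close>

lemma prob_no_hit_limit:
  assumes \<epsilon>: "\<And>n. \<epsilon> n > 0" "(\<lambda>n. real n * \<epsilon> n) \<longlonglongrightarrow> 0"
    and scale: "\<And>n. n \<ge> 1 \<Longrightarrow> real n ^ m * \<epsilon> n ^ (m - 1) = \<theta>"
  shows "(\<lambda>n. prob {\<omega>\<in>space M. \<forall>ks\<in>index_lists m n. \<omega> \<notin> E ((\<epsilon> n)\<^sup>2) ks}) \<longlonglongrightarrow>
    exp (- (\<theta> * (V * overlap) / real m))"
proof -
  obtain s0 C where loc: "localizes s0 C" using ex_localizes by blast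
  then have s0: "s0 > 0" and C: "C > 0" by (simp_all add: localizes_def)
  define c where "c = (2 * real m + 1) * B * 4 * C"
  have c: "c \<ge> 0" using C B_nonneg by (simp add: c_def)
  define L where "L = fact (m - 1) * (V * overlap)"
  define Q where "Q n = q ((\<epsilon> n)\<^sup>2)" for n
  define Kc where "Kc = (2 * real m) ^ m * (2 * real m) ^ m"
  define A where "A n = index_lists m n" for n
  define nb where "nb n ks = {js\<in>A n. set js \<inter> set ks \<noteq> {}}" for n ks
  have \<epsilon>0: "\<epsilon> \<longlonglongrightarrow> 0"
  proof (rule tendsto_sandwich[OF _ _ tendsto_const \<epsilon>(2)])
    show "\<forall>\<^sub>F n in sequentially. 0 \<le> \<epsilon> n" using \<epsilon>(1) by (simp add: less_imp_le)
    show "\<forall>\<^sub>F n in sequentially. \<epsilon> n \<le> real n * \<epsilon> n" using eventually_ge_at_top[of 1]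
    proof eventually_elim
      case (elim n)
      have "1 * \<epsilon> n \<le> real n * \<epsilon> n" using elim \<epsilon>(1)[of n] by (intro mult_right_mono) auto
      then show ?case by simp
    qed
  qed
  have Q_lim: "(\<lambda>n. Q n / \<epsilon> n ^ (m - 1)) \<longlonglongrightarrow> L"
    unfolding Q_def q_def L_def by (rule hit_tuple_limit[OF \<epsilon>(1) \<epsilon>0])
  have nQ: "real n ^ m * Q n = \<theta> * (Q n / \<epsilon> n ^ (m - 1))" if "n \<ge> 1" for n
    using scale[OF that] \<epsilon>(1)[of n] by (auto simp: field_simps)
  have nQ_lim: "(\<lambda>n. real n ^ m * Q n) \<longlonglongrightarrow> \<theta> * L"
  proof (rule Lim_transform_eventually[OF tendsto_mult_left[OF Q_lim]])
    show "\<forall>\<^sub>F n in sequentially. \<theta> * (Q n / \<epsilon> n ^ (m - 1)) = real n ^ m * Q n"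
      using eventually_ge_at_top[of 1] by eventually_elim (simp only: nQ)
  qed
  have lam_lim: "(\<lambda>n. real (n choose m) * Q n) \<longlonglongrightarrow> 1 / fact m * (\<theta> * L)"
  proof (rule Lim_transform_eventually[OF tendsto_mult[OF binomial_over_power_limit nQ_lim]])
    show "\<forall>\<^sub>F n in sequentially. real (n choose m) / real n ^ m * (real n ^ m * Q n) = real (n choose m) * Q n"
      using eventually_ge_at_top[of 1] by eventually_elim simp
  qed
  \<comment> \<open>The (m - 1)! labellings cancel against n choose m, which is about n^m / m!, and
    leave 1 / m.\<close>
  have m_fact: "fact m = real m * fact (m - 1)" using m2 by (cases m) auto
  have lam_eq: "1 / fact m * (\<theta> * L) = \<theta> * (V * overlap) / real m"
    unfolding L_def m_fact using m2 by simp
  \<comment> \<open>b1 and b2 bound the two error terms of the Poisson approximation. The size u = m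
    occurs in b1 only, for the pair of a list with itself.\<close>
  define b1 where "b1 n = (\<Sum>u\<in>{m..2*m-1}. (Q n * Q n) * (real n ^ u * Kc))" for n
  define b2 where "b2 n = (\<Sum>u\<in>{m+1..2*m-1}. (c * \<epsilon> n) ^ (u - 1) * (real n ^ u * Kc))" for n
  have b1_lim: "b1 \<longlonglongrightarrow> 0"
  proof -
    have summand: "(\<lambda>n. (Q n * Q n) * (real n ^ u * Kc)) \<longlonglongrightarrow> 0" if u: "u \<in> {m..2*m-1}" for u
    proof -
      \<comment> \<open>Each factor \<open>Q n\<close> balances n^m, and u < 2 m leaves a positive
        power of 1 / n.\<close>
      have "(\<lambda>n. ((real n ^ m * Q n) * (real n ^ m * Q n)) * (inverse (real n) ^ (2 * m - u)) * Kc) \<longlonglongrightarrow>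
        ((\<theta> * L) * (\<theta> * L)) * 0 ^ (2 * m - u) * Kc"
        by (intro tendsto_mult tendsto_power nQ_lim tendsto_const lim_inverse_n)
      moreover have "2 * m - u > 0" using u m2 unfolding atLeastAtMost_iff by linarith
      then have "(0::real) ^ (2 * m - u) = 0" by (simp add: power_0_left)
      moreover have "\<forall>\<^sub>F n in sequentially. ((real n ^ m * Q n) * (real n ^ m * Q n)) * (inverse (real n) ^ (2 * m - u)) * Kc
        = (Q n * Q n) * (real n ^ u * Kc)" using eventually_ge_at_top[of 1]
      proof eventually_elim
        case (elim n)
        have "2 * m = u + (2 * m - u)" using u m2 unfolding atLeastAtMost_iff by linarith
        then have "real n ^ m * real n ^ m = real n ^ u * real n ^ (2 * m - u)"
          by (metis power_add mult_2)
        moreover have "real n ^ (2 * m - u) * inverse (real n) ^ (2 * m - u) = 1"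
          using elim by (simp add: power_mult_distrib[symmetric])
        ultimately have h: "real n ^ m * real n ^ m * inverse (real n) ^ (2 * m - u) = real n ^ u"
          by (simp add: mult.assoc)
        show ?case unfolding h[symmetric] by (simp only: mult_ac)
      qed
      ultimately show ?thesis by (simp only: Lim_transform_eventually mult_zero_left mult_zero_right)
    qed
    show ?thesis unfolding b1_def using tendsto_sum[OF summand, of "{m..2*m-1}"] by simp
  qed
  have b2_lim: "b2 \<longlonglongrightarrow> 0"
  proof -
    have summand: "(\<lambda>n. (c * \<epsilon> n) ^ (u - 1) * (real n ^ u * Kc)) \<longlonglongrightarrow> 0" if u: "u \<in> {m+1..2*m-1}" for u
    proof -
      \<comment> \<open>In n^u \<epsilon>^(u - 1) the part n^m \<epsilon>^(m - 1) is the constant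
        \<theta>; what remains is n \<epsilon> to the positive power u - m.\<close>
      have "(\<lambda>n. c ^ (u - 1) * Kc * \<theta> * (real n * \<epsilon> n) ^ (u - m)) \<longlonglongrightarrow> c ^ (u - 1) * Kc * \<theta> * 0 ^ (u - m)"
        by (intro tendsto_mult tendsto_power tendsto_const \<epsilon>(2))
      moreover have "(0::real) ^ (u - m) = 0" using u by (simp add: power_0_left)
      moreover have "\<forall>\<^sub>F n in sequentially. c ^ (u - 1) * Kc * \<theta> * (real n * \<epsilon> n) ^ (u - m) = (c * \<epsilon> n) ^ (u - 1) * (real n ^ u * Kc)"
        using eventually_ge_at_top[of 1]
      proof eventually_elim
        case (elim n)
        have "u - 1 = (m - 1) + (u - m)" "u = m + (u - m)" using u m2 by auto
        then have "\<epsilon> n ^ (u - 1) = \<epsilon> n ^ (m - 1) * \<epsilon> n ^ (u - m)" "real n ^ u = real n ^ m * real n ^ (u - m)"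
          by (metis power_add)+
        then show ?case
          unfolding scale[OF elim, symmetric] power_mult_distrib by (simp add: mult_ac)
      qed
      ultimately show ?thesis by (simp only: Lim_transform_eventually mult_zero_right)
    qed
    show ?thesis unfolding b2_def using tendsto_sum[OF summand, of "{m+1..2*m-1}"] by simp
  qed
  define Pn where "Pn n = prob {\<omega>\<in>space M. \<forall>ks\<in>A n. \<omega> \<notin> E ((\<epsilon> n)\<^sup>2) ks}" for n
  have "\<forall>\<^sub>F n in sequentially. \<bar>Pn n - exp (- (real (n choose m) * Q n))\<bar> \<le> b1 n + b2 n"
  proof -
    have "(\<lambda>n. (\<epsilon> n)\<^sup>2) \<longlonglongrightarrow> 0\<^sup>2" by (intro tendsto_power \<epsilon>0)
    then have "\<forall>\<^sub>F n in sequentially. (\<epsilon> n)\<^sup>2 < s0" using s0 by (intro order_tendstoD(2)) auto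
    then show ?thesis
    proof eventually_elim
      case (elim n)
      let ?E = "E ((\<epsilon> n)\<^sup>2)"
      have PE: "prob (?E ks) = Q n" if "ks \<in> A n" for ks
        using prob_E that unfolding A_def Q_def by blast
      have nb_sub: "nb n ks \<subseteq> A n" for ks by (auto simp: nb_def)
      have bound: "\<bar>prob {\<omega>\<in>space M. \<forall>ks\<in>A n. \<omega> \<notin> ?E ks} - exp (- (\<Sum>ks\<in>A n. prob (?E ks)))\<bar>
        \<le> (\<Sum>ks\<in>A n. \<Sum>js\<in>nb n ks. prob (?E ks) * prob (?E js)) +
          (\<Sum>ks\<in>A n. \<Sum>js\<in>nb n ks - {ks}. prob (?E ks \<inter> ?E js))"
      proof (rule prob_none_poisson_approx)
        show "finite (A n)" by (simp add: A_def finite_index_lists)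
        fix ks assume ks: "ks \<in> A n"
        show "?E ks \<in> events" using ks E_events by (simp add: A_def)
        have "set ks \<noteq> {}" using index_listsD(1)[of ks m n] ks m2 by (auto simp: A_def)
        then show "ks \<in> nb n ks" using ks by (simp add: nb_def)
        show "nb n ks \<subseteq> A n" by (rule nb_sub)
        fix u :: real assume u: "0 \<le> u" "u \<le> 1"
        show "expectation (\<lambda>\<omega>. indicator (?E ks) \<omega> * u ^ card {js\<in>A n - nb n ks. \<omega> \<in> ?E js}) =
          prob (?E ks) * expectation (\<lambda>\<omega>. u ^ card {js\<in>A n - nb n ks. \<omega> \<in> ?E js})"
          using ks u by (intro E_indep[where n=n]) (auto simp: A_def nb_def)
      qed
      have sumQ: "(\<Sum>ks\<in>A n. prob (?E ks)) = real (n choose m) * Q n"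
        using PE by (simp add: A_def card_index_lists)
      have "(\<Sum>ks\<in>A n. \<Sum>js\<in>nb n ks. prob (?E ks) * prob (?E js)) = (\<Sum>ks\<in>A n. \<Sum>js\<in>nb n ks. Q n * Q n)"
        using PE nb_sub by (intro sum.cong refl arg_cong2[where f="(*)"]) auto
      also have "\<dots> \<le> b1 n" unfolding b1_def A_def Kc_def
        by (rule pair_sum_le[where f="\<lambda>_. Q n * Q n"])
          (use nb_sub card_union_index_lists in \<open>auto simp: A_def nb_def\<close>)
      finally have B1: "(\<Sum>ks\<in>A n. \<Sum>js\<in>nb n ks. prob (?E ks) * prob (?E js)) \<le> b1 n" .
      have "(\<Sum>ks\<in>A n. \<Sum>js\<in>nb n ks - {ks}. prob (?E ks \<inter> ?E js)) \<le>
        (\<Sum>ks\<in>A n. \<Sum>js\<in>nb n ks - {ks}. (c * \<epsilon> n) ^ (card (set ks \<union> set js) - 1))"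
      proof (intro sum_mono)
        fix ks js assume ks: "ks \<in> A n" and js: "js \<in> nb n ks - {ks}"
        have "prob (?E ks \<inter> ?E js) \<le> (c * sqrt ((\<epsilon> n)\<^sup>2)) ^ (card (set ks \<union> set js) - 1)"
          unfolding c_def
        proof (rule prob_pair[OF loc])
          show "ks \<in> index_lists m n" "js \<in> index_lists m n" "set ks \<inter> set js \<noteq> {}"
            using ks js by (auto simp: A_def nb_def)
        qed (use elim in simp_all)
        then show "prob (?E ks \<inter> ?E js) \<le> (c * \<epsilon> n) ^ (card (set ks \<union> set js) - 1)"
          using \<epsilon>(1)[of n] by simp
      qed
      also have "\<dots> \<le> b2 n" unfolding b2_def A_def Kc_def
      proof (rule pair_sum_le[where f="\<lambda>u. (c * \<epsilon> n) ^ (u - 1)"])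
        show "0 \<le> (c * \<epsilon> n) ^ (u - 1)" for u using c \<epsilon>(1)[of n] by simp
        show "card (set ks \<union> set js) \<in> {m+1..2*m-1}"
          if "ks \<in> index_lists m n" "js \<in> nb n ks - {ks}" for ks js
          using card_union_index_lists[OF that(1), of js] that(2) by (auto simp: A_def nb_def)
      qed (auto simp: nb_def A_def)
      finally have B2: "(\<Sum>ks\<in>A n. \<Sum>js\<in>nb n ks - {ks}. prob (?E ks \<inter> ?E js)) \<le> b2 n" .
      show ?case unfolding Pn_def using bound B1 B2 unfolding sumQ by linarith
    qed
  qed
  then have "\<forall>\<^sub>F n in sequentially. norm (Pn n - exp (- (real (n choose m) * Q n))) \<le> b1 n + b2 n"
    by (simp only: real_norm_def)
  moreover have "(\<lambda>n. b1 n + b2 n) \<longlonglongrightarrow> 0"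
    using tendsto_add[OF b1_lim b2_lim] by (simp only: add_0_right)
  ultimately have "(\<lambda>n. Pn n - exp (- (real (n choose m) * Q n))) \<longlonglongrightarrow> 0"
    by (rule Lim_null_comparison)
  moreover have "(\<lambda>n. exp (- (real (n choose m) * Q n))) \<longlonglongrightarrow> exp (- (\<theta> * (V * overlap) / real m))"
    unfolding lam_eq[symmetric] by (intro tendsto_exp tendsto_minus lam_lim)
  ultimately have "(\<lambda>n. (Pn n - exp (- (real (n choose m) * Q n))) + exp (- (real (n choose m) * Q n))) \<longlonglongrightarrow>
      0 + exp (- (\<theta> * (V * overlap) / real m))" by (rule tendsto_add)
  then show ?thesis by (simp add: Pn_def A_def )
qed

end

text \<open>With e = (m - 1) / 2, the unit ball contributes pi powr e / Gamma (e + 1), and 1 / curv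
  is 2 divided by minus the second derivative; the powers of 2 and pi combine to (2 pi) powr
  e.\<close>

lemma (in side_max_density) V_eq_limit_const:
  "V * overlap = limit_const m g p"
proof -
  define e where "e = (real m - 1) / 2"
  have m1: "real (m - 1) = real m - 1" using m2 by (simp add: of_nat_diff)
  have G: "- (deriv ^^ 2) g a > 0" using curv_pos by (simp add: curv_def)
  have "sqrt (1 / curv) ^ (m - 1) = (1 / curv) powr e"
  proof -
    have "sqrt (1 / curv) ^ (m - 1) = ((1 / curv) powr (1 / 2)) powr real (m - 1)"
      using curv_pos by (simp add: powr_half_sqrt powr_realpow)
    then show ?thesis by (simp add: powr_powr m1 e_def del: One_nat_def)
  qed
  also have "(1 / curv) powr e = 2 powr e / (- (deriv ^^ 2) g a) powr e"
  proof -
    have "1 / curv = 2 / (- (deriv ^^ 2) g a)" by (simp add: curv_def)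
    then show ?thesis using G by (simp only:) (subst powr_divide, auto)
  qed
  finally have 1: "sqrt (1 / curv) ^ (m - 1) = 2 powr e / (- (deriv ^^ 2) g a) powr e" .
  have 2: "unit_ball_vol (real (m - 1)) = pi powr e / Gamma ((real m + 1) / 2)"
  proof -
    have "e + 1 = (real m + 1) / 2" by (simp add: e_def field_simps)
    moreover have "real (m - 1) / 2 = e" unfolding m1 e_def ..
    ultimately show ?thesis by (simp only: unit_ball_vol_def)
  qed
  have 3: "(2 * pi) powr e = 2 powr e * pi powr e" by (rule powr_mult)
  show ?thesis
    unfolding V_def overlap_def limit_const_def e_def[symmetric] 1 2 3 a_def by (simp add: field_simps)
qed

section \<open>From points on the circle to angles\<close>

lemma Arg2pi_range: "Arg2pi z \<in> {0..<2*pi}" using Arg2pi[of z] by auto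

lemma cis_Arg2pi_sphere: "z \<in> sphere 0 1 \<Longrightarrow> cis (Arg2pi z) = z"
  using complex_norm_eq_1_exp[of z] by (simp add: cis_conv_exp)

lemma space_arc_length: "space arc_length = sphere 0 1"
  and sets_arc_length: "sets arc_length = sets (restrict_space borel (sphere 0 1))"
  by (auto simp: arc_length_def space_restrict_space)

text \<open>\<open>Arg2pi\<close> jumps at 1, so continuity is replaced by sublevel sets: each is
  empty, a closed arc starting at 1, or the whole circle.\<close>

lemma Arg2pi_measurable: "Arg2pi \<in> borel_measurable arc_length"
proof (rule borel_measurableI_le)
  fix c :: real
  have "{z\<in>space arc_length. Arg2pi z \<le> c} = (if c < 2*pi then cis ` {0..c} else sphere 0 1)"
  proof (cases "c < 2*pi")
    case True
    have "z \<in> cis ` {0..c}" if "z \<in> sphere 0 1" "Arg2pi z \<le> c" for z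
      using that cis_Arg2pi_sphere[of z] Arg2pi_range[of z] by (intro image_eqI[of _ _ "Arg2pi z"]) auto
    moreover have "cis x \<in> sphere 0 1 \<and> Arg2pi (cis x) \<le> c" if "x \<in> {0..c}" for x
      using that True Arg2pi_cis[of x] by auto
    ultimately show ?thesis using True by (auto simp: space_arc_length)
  next
    case False
    have "Arg2pi z \<le> c" for z using Arg2pi_range[of z] False by simp
    then show ?thesis using False by (auto simp: space_arc_length)
  qed
  moreover have "cis ` {0..c} \<in> sets borel"
    by (intro borel_closed compact_imp_closed compact_continuous_image continuous_intros) auto
  moreover have "cis ` {0..c} \<subseteq> sphere 0 1" by auto
  ultimately show "{z\<in>space arc_length. Arg2pi z \<le> c} \<in> sets arc_length"
    by (auto simp: sets_arc_length sets_restrict_space_iff)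
qed

text \<open>\<open>arc_length\<close> is an image under \<open>cis\<close>, which
  \<open>Arg2pi\<close> inverts on [0, 2 pi); pulling the density back along \<open>cis\<close>
  therefore returns p.\<close>

lemma (in side_max_density) distr_Arg2pi:
  assumes U: "distributed M arc_length U (\<lambda>z. ennreal (p (Arg2pi z)))"
  shows "distr M borel (\<lambda>\<omega>. Arg2pi (U \<omega>)) = D"
proof (rule measure_eqI)
  fix A assume "A \<in> sets (distr M borel (\<lambda>\<omega>. Arg2pi (U \<omega>)))"
  then have A [measurable]: "A \<in> sets borel" by simp
  have U_meas: "U \<in> M \<rightarrow>\<^sub>M arc_length" and U_distr: "distr M arc_length U = density arc_length (\<lambda>z. ennreal (p (Arg2pi z)))"
    and dens_meas: "(\<lambda>z. ennreal (p (Arg2pi z))) \<in> borel_measurable arc_length"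
    using U by (auto simp: distributed_def)
  note [measurable] = Arg2pi_measurable
  let ?R = "restrict_space lborel {0..<2*pi}"
  have cis_meas: "cis \<in> ?R \<rightarrow>\<^sub>M restrict_space borel (sphere 0 1)"
  proof (rule measurable_restrict_space2)
    have "cis \<in> borel_measurable borel"
      by (intro borel_measurable_continuous_onI continuous_intros)
    then show "cis \<in> ?R \<rightarrow>\<^sub>M borel" by (intro measurable_restrict_space1) simp
  qed auto
  have ind: "(\<lambda>z. indicator A (Arg2pi z) :: ennreal) \<in> borel_measurable arc_length" by measurable
  have fm: "(\<lambda>z. ennreal (p (Arg2pi z)) * indicator A (Arg2pi z)) \<in> borel_measurable arc_length"
    by (intro borel_measurable_times_ennreal dens_meas ind)
  have "distr M borel (\<lambda>\<omega>. Arg2pi (U \<omega>)) = distr (distr M arc_length U) borel Arg2pi"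
    by (subst distr_distr) (auto simp: comp_def U_meas Arg2pi_measurable)
  then have "emeasure (distr M borel (\<lambda>\<omega>. Arg2pi (U \<omega>))) A =
      (\<integral>\<^sup>+z. indicator A z \<partial>distr (distr M arc_length U) borel Arg2pi)" by simp
  also have "\<dots> = (\<integral>\<^sup>+z. indicator A (Arg2pi z) \<partial>distr M arc_length U)"
    by (rule nn_integral_distr) (simp_all add: Arg2pi_measurable)
  also have "\<dots> = (\<integral>\<^sup>+z. ennreal (p (Arg2pi z)) * indicator A (Arg2pi z) \<partial>arc_length)"
    unfolding U_distr by (rule nn_integral_density[OF dens_meas ind])
  also have "\<dots> = (\<integral>\<^sup>+x. ennreal (p (Arg2pi (cis x))) * indicator A (Arg2pi (cis x)) \<partial>?R)"
    unfolding arc_length_def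
    by (rule nn_integral_distr[OF cis_meas]) (use fm in \<open>simp cong: measurable_cong_sets add: arc_length_def\<close>)
  also have "\<dots> = (\<integral>\<^sup>+x. ennreal (p x) * indicator A x \<partial>?R)"
    by (intro nn_integral_cong) (simp add: space_restrict_space Arg2pi_cis)
  also have "\<dots> = (\<integral>\<^sup>+x. ennreal (p x) * indicator A x * indicator {0..<2*pi} x \<partial>lborel)"
    by (rule nn_integral_restrict_space) simp
  also have "\<dots> = (\<integral>\<^sup>+x. ennreal (p x) * indicator {0..<2*pi} x * indicator A x \<partial>lborel)"
    by (intro nn_integral_cong) (simp add: mult_ac)
  also have "\<dots> = emeasure D A" unfolding D_def by (rule emeasure_density[symmetric]) auto
  finally show "emeasure (distr M borel (\<lambda>\<omega>. Arg2pi (U \<omega>))) A = emeasure D A" .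
qed simp

lemma (in side_max_density) side_kernel_eq:
  assumes "length us = m" "set us \<subseteq> sphere 0 1"
  shows "side_kernel g us = side_h gc (map (\<lambda>j. ccw (Arg2pi (us ! 0)) (Arg2pi (us ! j))) [1..<m])"
proof -
  let ?y = "\<lambda>j. ccw (Arg2pi (us ! 0)) (Arg2pi (us ! j))"
  have ne: "us \<noteq> []" using assms(1) m2 by auto
  have tl: "tl us = map (\<lambda>j. us ! j) [1..<m]"
    using assms(1) by (intro nth_equalityI) (auto simp: nth_tl)
  have "map (\<lambda>v. Arg2pi (v / hd us)) (tl us) = map (\<lambda>j. Arg2pi (us ! j / us ! 0)) [1..<m]"
    unfolding tl using ne by (simp add: hd_conv_nth)
  also have "\<dots> = map ?y [1..<m]"
  proof (rule map_cong[OF refl])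
    fix j assume "j \<in> set [1..<m]"
    then have "j < length us" "0 < length us" using assms(1) ne by auto
    then have "us ! j \<in> sphere 0 1" "us ! 0 \<in> sphere 0 1" using assms(2) nth_mem by blast+
    then show "Arg2pi (us ! j / us ! 0) = ?y j"
      using Arg2pi_cis_divide[OF Arg2pi_range[of "us ! 0"] Arg2pi_range[of "us ! j"]]
      by (simp only: cis_Arg2pi_sphere)
  qed
  finally have "side_kernel g us = side_h g (map ?y [1..<m])" by (simp only: side_kernel_def)
  also have "\<dots> = side_h gc (map ?y [1..<m])"
  proof (rule side_h_gc[symmetric])
    show "?y j \<in> {0..2*pi}" for j
      using ccw_range[OF Arg2pi_range[of "us ! 0"] Arg2pi_range[of "us ! j"]] by auto
  qed
  finally show ?thesis .
qed

theorem theorem5p1: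
  fixes m :: nat and g p :: "real \<Rightarrow> real"
    and M :: "'a measure" and U :: "nat \<Rightarrow> 'a \<Rightarrow> complex" and t :: real
  assumes "m \<ge> 2"
    and "continuous_on {0..2*pi} g"
    and "Ck_near 3 g (2*pi / real m)"
    and "(deriv ^^ 2) g (2*pi / real m) \<noteq> 0"
    and "max_only_at_regular_polygons m (side_kernel g)"
    and "prob_space M"
    and "circle_density p"
    and "continuous_on UNIV p"
    and "integral {0..2*pi} (\<lambda>x. \<Prod>l<m. p (x + 2*pi * real l / real m)) > 0"
    and "prob_space.indep_vars M (\<lambda>_. arc_length) U {1..}"
    and "\<And>i. i \<ge> 1 \<Longrightarrow> distributed M arc_length (U i) (\<lambda>z. ennreal (p (Arg2pi z)))"
    and "t > 0"
  shows "(\<lambda>n. measure M {\<omega> \<in> space M.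
            real n powr (2 * real m / (real m - 1))
              * (real m * g (2*pi / real m) - U_max (side_kernel g) m (\<lambda>i. U i \<omega>) n) \<le> t})
         \<longlonglongrightarrow> 1 - exp (- (t powr ((real m - 1) / 2) * limit_const m g p / real m))"
proof -
  let ?H = "\<lambda>n \<omega>. real n powr (2 * real m / (real m - 1))
    * (real m * g (2*pi / real m) - U_max (side_kernel g) m (\<lambda>i. U i \<omega>) n)"
  interpret S: side_max_density m g p using assms(1-5,7,8) by unfold_locales
  interpret M: prob_space M by fact
  define X where "X i \<omega> = Arg2pi (U i \<omega>)" for i \<omega>
  have U_sphere: "U i \<omega> \<in> sphere 0 1" if "i \<ge> 1" "\<omega> \<in> space M" for i \<omega>
  proof -
    have "U i \<in> M \<rightarrow>\<^sub>M arc_length" using assms(11)[OF that(1)] by (simp add: distributed_def)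
    from measurable_space[OF this that(2)] show ?thesis by (simp add: space_arc_length)
  qed
  interpret side_max_sample m g p M X
  proof unfold_locales
    show "M.indep_vars (\<lambda>_. borel) X {1..}"
      unfolding X_def[abs_def] by (rule M.indep_vars_compose2[OF assms(10)]) (rule Arg2pi_measurable)
    show "distr M borel (X i) = S.D" if "i \<ge> 1" for i
      using S.distr_Arg2pi[OF assms(11)[OF that]] by (simp add: X_def[abs_def])
    show "X i \<omega> \<in> {0..<2*pi}" for i \<omega> unfolding X_def by (rule Arg2pi_range)
  qed
  define b where "b = real m / (real m - 1)"
  have m1: "real m - 1 > 0" using assms(1) by simp
  \<comment> \<open>Its square is the threshold t / n powr (2 m / (m - 1)). The value at n = 0 only
    keeps \<epsilon> positive everywhere.\<close>
  define \<epsilon> where "\<epsilon> n = (if n = 0 then 1 else sqrt t * real n powr - b)" for n :: nat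
  have \<epsilon>_pos: "\<epsilon> n > 0" for n using \<open>t > 0\<close> by (simp add: \<epsilon>_def)
  have \<epsilon>_lim: "(\<lambda>n. real n * \<epsilon> n) \<longlonglongrightarrow> 0"
  proof -
    have "b - 1 = 1 / (real m - 1)" using m1 by (simp add: b_def field_simps)
    moreover have "1 / (real m - 1) > 0" using m1 by simp
    ultimately have "1 - b < 0" by linarith
    then have "(\<lambda>n. sqrt t * real n powr (1 - b)) \<longlonglongrightarrow> sqrt t * 0"
      by (intro tendsto_mult_left tendsto_neg_powr filterlim_real_sequentially)
    moreover have "\<forall>\<^sub>F n in sequentially. sqrt t * real n powr (1 - b) = real n * \<epsilon> n"
      using eventually_ge_at_top[of 1]
    proof eventually_elim
      case (elim n)
      then have "real n powr (1 - b) = real n * real n powr - b"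
        using powr_add[of "real n" 1 "- b"] by simp
      then show ?case using elim by (simp add: \<epsilon>_def)
    qed
    ultimately show ?thesis using Lim_transform_eventually by fastforce
  qed
  have scale: "real n ^ m * \<epsilon> n ^ (m - 1) = t powr ((real m - 1) / 2)" if "n \<ge> 1" for n
  proof -
    have mm: "real (m - 1) = real m - 1" using assms(1) by (simp add: of_nat_diff)
    have "\<epsilon> n ^ (m - 1) = sqrt t ^ (m - 1) * (real n powr - b) ^ (m - 1)"
      using that by (simp add: \<epsilon>_def power_mult_distrib)
    also have "(real n powr - b) ^ (m - 1) = real n powr (- b * (real m - 1))"
      using that by (simp add: powr_realpow[symmetric] powr_powr mm del: One_nat_def)
    also have "- b * (real m - 1) = - real m" using m1 by (simp add: b_def)
    also have "real n powr - real m = inverse (real n ^ m)"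
      using that by (simp add: powr_minus powr_realpow)
    also have "sqrt t ^ (m - 1) = t powr ((real m - 1) / 2)"
    proof -
      have "sqrt t ^ (m - 1) = (t powr (1 / 2)) powr real (m - 1)"
        using \<open>t > 0\<close> by (simp add: powr_half_sqrt powr_realpow)
      then show ?thesis by (simp add: powr_powr mm del: One_nat_def)
    qed
    finally show ?thesis using that by simp
  qed
  define none where "none n = {\<omega>\<in>space M. \<forall>ks\<in>index_lists m n. \<omega> \<notin> E ((\<epsilon> n)\<^sup>2) ks}" for n
  have none_events: "none n \<in> M.events" for n
  proof -
    have "none n = space M - (\<Union>ks\<in>index_lists m n. E ((\<epsilon> n)\<^sup>2) ks)" by (auto simp: none_def)
    also have "\<dots> \<in> M.events" by (intro sets.compl_sets sets.finite_UN finite_index_lists E_events)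
    finally show ?thesis .
  qed
  have "(\<lambda>n. M.prob (none n)) \<longlonglongrightarrow> exp (- (t powr ((real m - 1) / 2) * limit_const m g p / real m))"
    using prob_no_hit_limit[OF \<epsilon>_pos \<epsilon>_lim scale] unfolding none_def S.V_eq_limit_const .
  then have lim: "(\<lambda>n. 1 - M.prob (none n)) \<longlonglongrightarrow> 1 - exp (- (t powr ((real m - 1) / 2) * limit_const m g p / real m))"
    by (intro tendsto_diff tendsto_const)
  \<comment> \<open>The maximum falls short by at most \<open>(\<epsilon> n)\<^sup>2\<close> iff
    some tuple of the sample is a hit. For n < m there are no tuples, so the identity is claimed
    from n = m on.\<close>
  have event: "{\<omega> \<in> space M. ?H n \<omega> \<le> t} = space M - none n"
    if n: "n \<ge> m" for n
  proof -
    have n1: "n \<ge> 1" using n assms(1) by simp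
    have sq: "(\<epsilon> n)\<^sup>2 = t / real n powr (2 * real m / (real m - 1))"
    proof -
      have "(\<epsilon> n)\<^sup>2 = t * (real n powr - b)\<^sup>2"
        using n1 \<open>t > 0\<close> by (simp add: \<epsilon>_def power_mult_distrib)
      also have "(real n powr - b)\<^sup>2 = real n powr - (2 * b)"
        by (simp add: power2_eq_square powr_add[symmetric])
      also have "2 * b = 2 * real m / (real m - 1)" by (simp add: b_def)
      finally show ?thesis by (simp add: powr_minus divide_inverse)
    qed
    have "?H n \<omega> \<le> t
       \<longleftrightarrow> (\<exists>ks\<in>index_lists m n. \<omega> \<in> E ((\<epsilon> n)\<^sup>2) ks)" if \<omega>: "\<omega> \<in> space M" for \<omega>
    proof -
      let ?f = "\<lambda>ks. side_kernel g (map (\<lambda>i. U i \<omega>) ks)"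
      have set_eq: "{?f ks |ks. length ks = m \<and> sorted_wrt (<) ks \<and> set ks \<subseteq> {1..n}} = ?f ` index_lists m n"
        by (auto simp: index_lists_def)
      have "card (index_lists m n) \<noteq> 0" using n by (simp add: card_index_lists)
      then have ne: "index_lists m n \<noteq> {}" by auto
      have hit_iff: "\<omega> \<in> E ((\<epsilon> n)\<^sup>2) ks \<longleftrightarrow> real m * g S.a - (\<epsilon> n)\<^sup>2 \<le> ?f ks"
        if ks: "ks \<in> index_lists m n" for ks
      proof -
        note D = index_listsD[OF ks]
        have "set (map (\<lambda>i. U i \<omega>) ks) \<subseteq> sphere 0 1"
          using D(4) U_sphere \<omega> by (auto simp: subset_iff)
        then have "?f ks = side_h S.gc (map (\<lambda>j. ccw (Arg2pi (map (\<lambda>i. U i \<omega>) ks ! 0)) (Arg2pi (map (\<lambda>i. U i \<omega>) ks ! j))) [1..<m])"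
          using D(1) by (intro S.side_kernel_eq) auto
        also have "\<dots> = side_h S.gc (map (\<lambda>j. ccw (X (ks ! 0) \<omega>) (X (ks ! j) \<omega>)) [1..<m])"
          using D(1) assms(1) by (intro arg_cong[where f="side_h S.gc"] map_cong) (auto simp: X_def)
        finally show ?thesis using \<omega> by (simp add: E_def S.hit_tuple_def S.hit_def)
      qed
      have "real n powr (2 * real m / (real m - 1)) > 0" using n1 by simp
      then have "?H n \<omega> \<le> t
        \<longleftrightarrow> real m * g (2*pi / real m) - (\<epsilon> n)\<^sup>2 \<le> U_max (side_kernel g) m (\<lambda>i. U i \<omega>) n"
        unfolding sq by (simp add: pos_le_divide_eq mult.commute) (simp add: field_simps)
      also have "\<dots> \<longleftrightarrow> (\<exists>y\<in>?f ` index_lists m n. real m * g (2*pi / real m) - (\<epsilon> n)\<^sup>2 \<le> y)"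
        unfolding U_max_def set_eq
        by (rule Max_ge_iff) (use ne in \<open>auto simp: finite_index_lists\<close>)
      also have "\<dots> \<longleftrightarrow> (\<exists>ks\<in>index_lists m n. \<omega> \<in> E ((\<epsilon> n)\<^sup>2) ks)"
        using hit_iff by (auto simp: S.a_def)
      finally show ?thesis .
    qed
    then show ?thesis unfolding none_def by blast
  qed
  show ?thesis
  proof (rule Lim_transform_eventually[OF lim])
    show "\<forall>\<^sub>F n in sequentially. 1 - M.prob (none n) = M.prob {\<omega> \<in> space M. ?H n \<omega> \<le> t}"
      using eventually_ge_at_top[of m]
      by eventually_elim (simp only: event M.prob_compl[OF none_events])
  qed
qed

end
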